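(* Let $\Omega\subseteq\mathbb{R}^N$, $N\ge2$, be an unbounded domain and let $p,q:\overline\Omega\to[1,\infty)$ and $\mu:\overline\Omega\to[0,\infty)$ be bounded, Hölder continuous functions such that $p$ satisfies Nekvinda's decay condition, $1<p(x)\le q(x)$ for all $x\in\overline\Omega$ and $$\Big(\frac qp\Big)_+<1+\frac{\gamma}{N},$$ where $\gamma$ is the Hölder exponent of $\mu$. Then $\mathcal{H}_{\log}$ satisfies (A0), (A1), (A2) and (aDec), and $C^\infty(\Omega)\cap W^{1,\mathcal{H}_{\log}}(\Omega)$ is dense in $W^{1,\mathcal{H}_{\log}}(\Omega)$.
   Context: $(q/p)_+=\sup_{x\in\overline\Omega}q(x)/p(x)$. Hölder exponents lie in $(0,1]$; $\mu$ has Hölder exponent $\gamma$ if $|\mu(x)-\mu(y)|\le c|x-y|^\gamma$ for some $c$ and all $x,y\in\overline\Omega$. Let $\mathcal{H}_{\log}(x,t)=t^{p(x)}+\mu(x)t^{q(x)}\log(e+t)$ for $x\in\overline\Omega$, $t\ge0$. A measurable $r:\Omega\to[1,\infty]$ satisfies Nekvinda's decay condition if there exist $r_\infty\in[1,\infty]$ and $c\in(0,1)$ such that $\int_\Omega c^{1/|\frac1{r(x)}-\frac1{r_\infty}|}\,dx<\infty$ (with $1/\infty=0$, $1/0=\infty$, $c^\infty=0$). For $\varphi:\Omega\times[0,\infty)\to[0,\infty]$ put $\varphi^{-1}(x,s)=\inf\{t\ge0:\varphi(x,t)\ge s\}$. Then $\varphi$ satisfies: (A0) if there is $0<\beta\le1$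 with $\beta\le\varphi^{-1}(x,1)\le\beta^{-1}$ for a.a. $x\in\Omega$; (A1) if there is $0<\beta<1$ such that $\beta\varphi^{-1}(x,t)\le\varphi^{-1}(y,t)$ for every $t\in[1,1/|B|]$, for a.a. $x,y\in B\cap\Omega$ and for every ball $B$ with $|B|\le1$; (A2) if for every $s>0$ there are $0<\beta\le1$ and $h\in L^1(\Omega)\cap L^\infty(\Omega)$ such that $\beta\varphi^{-1}(x,t)\le\varphi^{-1}(y,t)$ for every $t\in[h(x)+h(y),s]$ and for a.a. $x,y\in\Omega$; (aDec) if there are $0<Q<\infty$ and $a\ge1$ such that $a\,s^{-Q}\varphi(x,s)\ge t^{-Q}\varphi(x,t)$ for all $0<s<t$ and a.a. $x\in\Omega$. For measurable $u$ set $\varrho_{\mathcal{H}_{\log}}(u)=\int_\Omega\mathcal{H}_{\log}(x,|u|)\,dx$; $L^{\mathcal{H}_{\log}}(\Omega)$ is the space of measurable $u:\Omega\to\mathbb{R}$ with $\varrho_{\mathcal{H}_{\log}}(u)<\infty$. $W^{1,\mathcal{H}_{\log}}(\Omega)=\{u\in L^{\mathcal{H}_{\log}}(\Omega): |\nabla u|\in L^{\mathcal{H}_{\log}}(\Omega)\}$ (weak gradient) with norm $\|u\|_{1,\mathcal{H}_{\log}}=\inf\{\lambda>0:\varrho_{\mathcal{H}_{\log}}(u/\lambda)+\varrho_{\mathcal{H}_{\log}}(|\nabla u|/\lambda)\le1\}$. *)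

theory Defs
  imports "HOL-Analysis.Analysis"
begin

definition holder_on :: "'a::metric_space set \<Rightarrow> real \<Rightarrow> ('a \<Rightarrow> real) \<Rightarrow> bool" where
  "holder_on S \<gamma> f \<longleftrightarrow> 0 < \<gamma> \<and> \<gamma> \<le> 1 \<and>
     (\<exists>c. \<forall>x\<in>S. \<forall>y\<in>S. \<bar>f x - f y\<bar> \<le> c * dist x y powr \<gamma>)"

definition holder_continuous_on :: "'a::metric_space set \<Rightarrow> ('a \<Rightarrow> real) \<Rightarrow> bool" where
  "holder_continuous_on S f \<longleftrightarrow> (\<exists>\<gamma>. holder_on S \<gamma> f)"

text \<open>The value of \<open>c\<close> to the power \<open>1/d\<close> for \<open>0 < c < 1\<close>, with \<open>1/0 = \<infinity>\<close> and \<open>c\<close> to the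
  power \<open>\<infinity>\<close> equal to \<open>0\<close>; the case distinction is needed because \<open>1 / 0 = 0\<close> in type \<^typ>\<open>real\<close>.\<close>

definition decay_weight :: "real \<Rightarrow> real \<Rightarrow> real" where
  "decay_weight c d = (if d = 0 then 0 else c powr (1 / d))"

definition nekvinda :: "'a::euclidean_space set \<Rightarrow> ('a \<Rightarrow> ereal) \<Rightarrow> bool" where
  "nekvinda \<Omega> r \<longleftrightarrow>
     r \<in> borel_measurable (lebesgue_on \<Omega>) \<and> (\<forall>x\<in>\<Omega>. 1 \<le> r x) \<and>
     (\<exists>r_inf c. 1 \<le> r_inf \<and> 0 < c \<and> c < 1 \<and>
        (\<integral>\<^sup>+x. ennreal (decay_weight c \<bar>real_of_ereal (1 / r x) - real_of_ereal (1 / r_inf)\<bar>)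
           \<partial>lebesgue_on \<Omega>) < \<infinity>)"

text \<open>Only the values \<open>\<phi> x t\<close> with \<open>x \<in> \<Omega>\<close> and \<open>t \<ge> 0\<close> matter below. The infimum is taken in
  \<^typ>\<open>ennreal\<close>, so that it is \<open>\<infinity>\<close> for the empty set.\<close>

definition phi_inv :: "('a \<Rightarrow> real \<Rightarrow> ennreal) \<Rightarrow> 'a \<Rightarrow> real \<Rightarrow> ennreal" where
  "phi_inv \<phi> x s = Inf {ennreal t | t. 0 \<le> t \<and> ennreal s \<le> \<phi> x t}"

definition cond_A0 :: "'a::euclidean_space set \<Rightarrow> ('a \<Rightarrow> real \<Rightarrow> ennreal) \<Rightarrow> bool" where
  "cond_A0 \<Omega> \<phi> \<longleftrightarrow> (\<exists>\<beta>. 0 < \<beta> \<and> \<beta> \<le> 1 \<and>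
     (AE x in lebesgue_on \<Omega>. ennreal \<beta> \<le> phi_inv \<phi> x 1 \<and> phi_inv \<phi> x 1 \<le> ennreal (1 / \<beta>)))"

definition cond_A1 :: "'a::euclidean_space set \<Rightarrow> ('a \<Rightarrow> real \<Rightarrow> ennreal) \<Rightarrow> bool" where
  "cond_A1 \<Omega> \<phi> \<longleftrightarrow> (\<exists>\<beta>. 0 < \<beta> \<and> \<beta> < 1 \<and>
     (\<forall>z r. 0 < r \<and> measure lebesgue (ball z r) \<le> 1 \<longrightarrow>
        (AE x in lebesgue_on (ball z r \<inter> \<Omega>). AE y in lebesgue_on (ball z r \<inter> \<Omega>).
           \<forall>t\<in>{1 .. 1 / measure lebesgue (ball z r)}.
             ennreal \<beta> * phi_inv \<phi> x t \<le> phi_inv \<phi> y t)))"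

definition cond_A2 :: "'a::euclidean_space set \<Rightarrow> ('a \<Rightarrow> real \<Rightarrow> ennreal) \<Rightarrow> bool" where
  "cond_A2 \<Omega> \<phi> \<longleftrightarrow> (\<forall>s>0. \<exists>\<beta> h. 0 < \<beta> \<and> \<beta> \<le> 1 \<and>
     integrable (lebesgue_on \<Omega>) h \<and> (\<exists>C. AE x in lebesgue_on \<Omega>. \<bar>h x\<bar> \<le> C) \<and>
     (AE x in lebesgue_on \<Omega>. AE y in lebesgue_on \<Omega>.
        \<forall>t\<in>{h x + h y .. s}. ennreal \<beta> * phi_inv \<phi> x t \<le> phi_inv \<phi> y t))"

definition cond_aDec :: "'a::euclidean_space set \<Rightarrow> ('a \<Rightarrow> real \<Rightarrow> ennreal) \<Rightarrow> bool" where
  "cond_aDec \<Omega> \<phi> \<longleftrightarrow> (\<exists>Q a. 0 < Q \<and> 1 \<le> a \<and>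
     (AE x in lebesgue_on \<Omega>. \<forall>s t. 0 < s \<and> s < t \<longrightarrow>
        ennreal (t powr (-Q)) * \<phi> x t \<le> ennreal (a * s powr (-Q)) * \<phi> x s))"

definition H_log ::
  "('a \<Rightarrow> real) \<Rightarrow> ('a \<Rightarrow> real) \<Rightarrow> ('a \<Rightarrow> real) \<Rightarrow> 'a \<Rightarrow> real \<Rightarrow> ennreal" where
  "H_log p q \<mu> x t = ennreal (t powr p x + \<mu> x * t powr q x * ln (exp 1 + t))"

primrec Ck_on :: "nat \<Rightarrow> 'a::euclidean_space set \<Rightarrow> ('a \<Rightarrow> real) \<Rightarrow> bool" where
  "Ck_on 0 S f \<longleftrightarrow> continuous_on S f"
| "Ck_on (Suc k) S f \<longleftrightarrow> (\<forall>x\<in>S. f differentiable at x) \<and>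
     (\<forall>v. Ck_on k S (\<lambda>x. frechet_derivative f (at x) v))"

definition smooth_on :: "'a::euclidean_space set \<Rightarrow> ('a \<Rightarrow> real) \<Rightarrow> bool" where
  "smooth_on S f \<longleftrightarrow> (\<forall>k. Ck_on k S f)"

text \<open>Test functions on \<open>\<Omega>\<close> are represented by their extension by zero to the whole space.\<close>

definition test_fun :: "'a::euclidean_space set \<Rightarrow> ('a \<Rightarrow> real) \<Rightarrow> bool" where
  "test_fun \<Omega> \<eta> \<longleftrightarrow> smooth_on UNIV \<eta> \<and>
     compact (closure {x. \<eta> x \<noteq> 0}) \<and> closure {x. \<eta> x \<noteq> 0} \<subseteq> \<Omega>"

definition locally_integrable_on ::
  "('a::euclidean_space \<Rightarrow> 'b::euclidean_space) \<Rightarrow> 'a set \<Rightarrow> bool" where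
  "locally_integrable_on f \<Omega> \<longleftrightarrow>
     (\<forall>K. compact K \<and> K \<subseteq> \<Omega> \<longrightarrow> f absolutely_integrable_on K)"

definition has_weak_gradient ::
  "'a::euclidean_space set \<Rightarrow> ('a \<Rightarrow> real) \<Rightarrow> ('a \<Rightarrow> 'a) \<Rightarrow> bool" where
  "has_weak_gradient \<Omega> u g \<longleftrightarrow>
     locally_integrable_on u \<Omega> \<and> locally_integrable_on g \<Omega> \<and>
     (\<forall>\<eta>. test_fun \<Omega> \<eta> \<longrightarrow> (\<forall>i\<in>Basis.
        (LINT x|lebesgue_on \<Omega>. u x * frechet_derivative \<eta> (at x) i) =
        - (LINT x|lebesgue_on \<Omega>. (g x \<bullet> i) * \<eta> x)))"

text \<open>On an open \<open>\<Omega>\<close>, weak gradients are unique up to null sets, so the choice is immaterial.\<close>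

definition weak_gradient :: "'a::euclidean_space set \<Rightarrow> ('a \<Rightarrow> real) \<Rightarrow> 'a \<Rightarrow> 'a" where
  "weak_gradient \<Omega> u = (SOME g. has_weak_gradient \<Omega> u g)"

text \<open>Spaces consist of functions, not of classes modulo null sets; values outside \<open>\<Omega>\<close> are
  irrelevant.\<close>

definition modular ::
  "'a::euclidean_space set \<Rightarrow> ('a \<Rightarrow> real \<Rightarrow> ennreal) \<Rightarrow> ('a \<Rightarrow> real) \<Rightarrow> ennreal" where
  "modular \<Omega> \<phi> u = (\<integral>\<^sup>+x. \<phi> x \<bar>u x\<bar> \<partial>lebesgue_on \<Omega>)"

definition L_space ::
  "'a::euclidean_space set \<Rightarrow> ('a \<Rightarrow> real \<Rightarrow> ennreal) \<Rightarrow> ('a \<Rightarrow> real) set" where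
  "L_space \<Omega> \<phi> = {u. u \<in> borel_measurable (lebesgue_on \<Omega>) \<and> modular \<Omega> \<phi> u < \<infinity>}"

definition W1_space ::
  "'a::euclidean_space set \<Rightarrow> ('a \<Rightarrow> real \<Rightarrow> ennreal) \<Rightarrow> ('a \<Rightarrow> real) set" where
  "W1_space \<Omega> \<phi> = {u \<in> L_space \<Omega> \<phi>. (\<exists>g. has_weak_gradient \<Omega> u g) \<and>
     (\<lambda>x. norm (weak_gradient \<Omega> u x)) \<in> L_space \<Omega> \<phi>}"

definition W1_norm ::
  "'a::euclidean_space set \<Rightarrow> ('a \<Rightarrow> real \<Rightarrow> ennreal) \<Rightarrow> ('a \<Rightarrow> real) \<Rightarrow> real" where
  "W1_norm \<Omega> \<phi> u = Inf {l. 0 < l \<and>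
     modular \<Omega> \<phi> (\<lambda>x. u x / l) + modular \<Omega> \<phi> (\<lambda>x. norm (weak_gradient \<Omega> u x) / l) \<le> 1}"

definition dense_in_W1 ::
  "'a::euclidean_space set \<Rightarrow> ('a \<Rightarrow> real \<Rightarrow> ennreal) \<Rightarrow> ('a \<Rightarrow> real) set \<Rightarrow> bool" where
  "dense_in_W1 \<Omega> \<phi> D \<longleftrightarrow> D \<subseteq> W1_space \<Omega> \<phi> \<and>
     (\<forall>u\<in>W1_space \<Omega> \<phi>. \<forall>\<epsilon>>0. \<exists>v\<in>D. W1_norm \<Omega> \<phi> (\<lambda>x. u x - v x) < \<epsilon>)"

end

theory Submission
  imports Defs
begin

text \<open>
Write \<open>H(x,t) = t\<^sup>p + \<mu> t\<^sup>q ln (e + t)\<close> with \<open>p\<close>, \<open>q\<close>, \<open>\<mu>\<close> taken at \<open>x\<close>, let \<open>N\<close> be the dimension, and let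
  \<open>\<theta> < 1 + \<gamma> / N\<close> be the supremum of \<open>q / p\<close>.

  Everything rests on one estimate (\<open>H_comparison\<close>): if \<open>x\<close> and \<open>y\<close> are at distance at most \<open>\<epsilon>\<close> and
  \<open>t \<ge> 1\<close> is so small that \<open>t\<^sup>p\<close> is bounded by a multiple of \<open>\<epsilon>\<close> to the power \<open>-N\<close>, then \<open>H(x,t)\<close> and
  \<open>H(y,t)\<close> are comparable. Indeed such a \<open>t\<close> is at most polynomially large in \<open>1 / \<epsilon>\<close>, so replacing the
  Hoelder continuous exponents \<open>p(x)\<close>, \<open>q(x)\<close> by \<open>p(y)\<close>, \<open>q(y)\<close> costs a bounded factor; and replacing \<open>\<mu>(x)\<close> by
  \<open>\<mu>(y)\<close> costs \<open>\<epsilon>\<^sup>\<gamma> t\<^sup>q ln (e + t)\<close>, which is \<open>t\<^sup>p\<close> times a positive power of \<open>\<epsilon>\<close> times a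
  logarithm, because \<open>N (\<theta> - 1) < \<gamma>\<close> holds with strict inequality. On a ball of radius \<open>r\<close> the values of
  \<open>H\<close> that occur in (A1) are bounded by a multiple of \<open>r\<close> to the power \<open>-N\<close>, so (A1) is this estimate read
  through the inverse. For (A2) only bounded \<open>t\<close> matter, and for \<open>t \<le> 1\<close> the value \<open>H(x,t)\<close> lies between \<open>t\<^sup>p\<close> and a
  multiple of it; the weight in the decay condition is exactly the threshold above which
  \<open>t\<close> to the power \<open>\<bar>1 / p(x) - 1 / p\<^sub>\<infinity>\<bar>\<close> is at least \<open>c\<close>, and serves as \<open>h\<close>. (A0) and (aDec) are
  elementary.

  For density one follows Meyers and Serrin: split \<open>u\<close> by a smooth partition of unity \<open>\<zeta>\<^sub>j\<close> that is
  subordinate to a compact exhaustion, mollify each piece \<open>\<zeta>\<^sub>j u\<close> with its own small radius, and add up.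
  Mollification commutes with the weak gradient (\<open>grad_conv\<close>), so one needs that mollifying a compactly
  supported \<open>h\<close> of finite modular, here the pair of \<open>\<zeta>\<^sub>j u\<close> and its gradient, converges in the modular
  (\<open>modular_approx\<close>). Convergence in \<open>L\<^sup>1\<close> is classical (\<open>moll_conv_tendsto_L1\<close>). It is upgraded by
  dominated convergence with the moving bound
  \<open>H(x,\<bar>h\<^sub>\<epsilon>(x)\<bar>) \<le> C (H(\<cdot>,\<bar>h\<bar>)\<^sub>\<epsilon>(x) + 1)\<close> (\<open>moll_pointwise_bound\<close>), whose right-hand side converges in \<open>L\<^sup>1\<close>
  as well. This bound is a Jensen inequality with the point \<open>x\<close> frozen. It is obtained without convexity: the
  part of the average where \<open>\<bar>h\<bar>\<close> exceeds half of the mean carries at least half of it, and there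
  \<open>\<bar>h\<bar>\<close> is controlled by \<open>H(y,\<bar>h\<bar>)\<close>, since \<open>H(y,t) / t\<close> is increasing, and the comparison estimate replaces
  \<open>y\<close> by \<open>x\<close>. The errors of the pieces are summed by monotonicity alone, because
  \<open>\<Sum>\<^sub>j 2\<^sup>-\<^sup>j a\<^sub>j\<close> is at most a multiple of the largest \<open>a\<^sub>j\<close>, so its modular is at most the sum of the modulars
  (\<open>modular_density_sum_le\<close>). The weak gradient of the error is identified by the uniqueness of weak gradients
  (\<open>borel_weak_gradient_unique\<close>), which again follows by mollification.

  The analytic core is carried out for an abstract modular in the locale \<open>comparable_modular\<close>; the locale
  \<open>log_double_phase\<close> treats \<open>H\<close>.
\<close>

section \<open>Smooth functions\<close>

lemma Ck_on_cong:
  assumes "open S" "\<And>x. x \<in> S \<Longrightarrow> f x = g x"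
  shows "Ck_on k S f = Ck_on k S g"
  using assms(2)
proof (induction k arbitrary: f g)
  case 0
  then show ?case by (auto cong: continuous_on_cong)
next
  case (Suc k)
  have d: "(f has_derivative D) (at x) \<longleftrightarrow> (g has_derivative D) (at x)" if "x \<in> S" for x D
    using has_derivative_transform_within_open[of f D x UNIV S g]
      has_derivative_transform_within_open[of g D x UNIV S f] that assms(1) Suc.prems by metis
  have "frechet_derivative f (at x) = frechet_derivative g (at x)" if "x \<in> S" for x
    unfolding frechet_derivative_def using d[OF that] by simp
  moreover have "f differentiable at x \<longleftrightarrow> g differentiable at x" if "x \<in> S" for x
    unfolding differentiable_def using d[OF that] by simp
  ultimately show ?case
    using Suc.IH[of "\<lambda>x. frechet_derivative f (at x) v" "\<lambda>x. frechet_derivative g (at x) v" for v] by auto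
qed

lemma Ck_on_Suc_I:
  assumes "open S" "\<And>x. x \<in> S \<Longrightarrow> (f has_derivative D x) (at x)"
    and "\<And>v. Ck_on k S (\<lambda>x. D x v)"
  shows "Ck_on (Suc k) S f"
proof -
  have "frechet_derivative f (at x) = D x" if "x \<in> S" for x
    using frechet_derivative_at assms(2) that by metis
  then have "Ck_on k S (\<lambda>x. frechet_derivative f (at x) v)" for v
    using assms(3)[of v] Ck_on_cong[OF assms(1), of "\<lambda>x. frechet_derivative f (at x) v" "\<lambda>x. D x v" k] by auto
  then show ?thesis using assms(2) by (auto simp: differentiable_def)
qed

lemma Ck_on_Suc_derivative:
  "Ck_on (Suc k) S f \<Longrightarrow> x \<in> S \<Longrightarrow> (f has_derivative frechet_derivative f (at x)) (at x)"
  by (auto simp: frechet_derivative_works)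

lemma Ck_on_Suc_imp_Ck_on: "open S \<Longrightarrow> Ck_on (Suc k) S f \<Longrightarrow> Ck_on k S f"
proof (induction k arbitrary: f)
  case 0
  then show ?case
    by (auto intro!: continuous_at_imp_continuous_on differentiable_imp_continuous_within)
next
  case (Suc k)
  then show ?case by auto
qed

lemma Ck_on_subset: "Ck_on k S f \<Longrightarrow> T \<subseteq> S \<Longrightarrow> Ck_on k T f"
  by (induction k arbitrary: f) (auto intro: continuous_on_subset)

lemma Ck_on_const: "Ck_on k S (\<lambda>x. c)"
  by (induction k arbitrary: c) auto

lemma Ck_on_inner_left: "open S \<Longrightarrow> Ck_on k S (\<lambda>x. x \<bullet> v)"
proof (cases k)
  case (Suc l)
  assume "open S"
  have "Ck_on (Suc l) S (\<lambda>x. x \<bullet> v)"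
    by (rule Ck_on_Suc_I[where D="\<lambda>x h. h \<bullet> v"]) (auto intro!: derivative_eq_intros Ck_on_const \<open>open S\<close>)
  then show ?thesis using Suc by simp
qed (auto intro!: continuous_intros)

lemma Ck_on_add:
  assumes "open S"
  shows "Ck_on k S f \<Longrightarrow> Ck_on k S g \<Longrightarrow> Ck_on k S (\<lambda>x. f x + g x)"
proof (induction k arbitrary: f g)
  case 0
  then show ?case by (auto intro: continuous_on_add)
next
  case (Suc k)
  show ?case
    by (rule Ck_on_Suc_I[OF assms has_derivative_add[OF Ck_on_Suc_derivative Ck_on_Suc_derivative]])
      (use Suc in auto)
qed

lemma Ck_on_mult:
  assumes "open S"
  shows "Ck_on k S f \<Longrightarrow> Ck_on k S g \<Longrightarrow> Ck_on k S (\<lambda>x. f x * g x)"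
proof (induction k arbitrary: f g)
  case 0
  then show ?case by (auto intro: continuous_on_mult)
next
  case (Suc k)
  have "Ck_on k S f" "Ck_on k S g"
    using Suc.prems Ck_on_Suc_imp_Ck_on[OF assms] by blast+
  with Suc show ?case
    by (intro Ck_on_Suc_I[OF assms has_derivative_mult[OF Ck_on_Suc_derivative Ck_on_Suc_derivative]]
          Ck_on_add[OF assms]) auto
qed

lemma Ck_on_cmult: "open S \<Longrightarrow> Ck_on k S f \<Longrightarrow> Ck_on k S (\<lambda>x. c * f x)"
  by (intro Ck_on_mult Ck_on_const)

lemma Ck_on_diff: "open S \<Longrightarrow> Ck_on k S f \<Longrightarrow> Ck_on k S g \<Longrightarrow> Ck_on k S (\<lambda>x. f x - g x)"
  using Ck_on_add[of S k f "\<lambda>x. (-1) * g x"] Ck_on_cmult[of S k g "-1"] by simp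

lemma Ck_on_sum:
  "open S \<Longrightarrow> (\<And>i. i \<in> I \<Longrightarrow> Ck_on k S (f i)) \<Longrightarrow> Ck_on k S (\<lambda>x. \<Sum>i\<in>I. f i x)"
  by (induction I rule: infinite_finite_induct) (auto intro: Ck_on_const Ck_on_add)

lemma smooth_onD: "smooth_on S f \<Longrightarrow> Ck_on k S f"
  by (simp add: smooth_on_def)

lemma smooth_on_has_derivative:
  "smooth_on S f \<Longrightarrow> x \<in> S \<Longrightarrow> (f has_derivative frechet_derivative f (at x)) (at x)"
  using Ck_on_Suc_derivative smooth_onD by blast

lemma smooth_on_derivative: "smooth_on S f \<Longrightarrow> smooth_on S (\<lambda>x. frechet_derivative f (at x) v)"
  unfolding smooth_on_def using Ck_on.simps(2) by blast

lemma smooth_on_continuous: "smooth_on S f \<Longrightarrow> continuous_on S f"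
  using smooth_onD[of S f 0] by simp

lemma smooth_on_mult: "open S \<Longrightarrow> smooth_on S f \<Longrightarrow> smooth_on S g \<Longrightarrow> smooth_on S (\<lambda>x. f x * g x)"
  by (simp add: smooth_on_def Ck_on_mult)

lemma smooth_on_diff: "open S \<Longrightarrow> smooth_on S f \<Longrightarrow> smooth_on S g \<Longrightarrow> smooth_on S (\<lambda>x. f x - g x)"
  by (simp add: smooth_on_def Ck_on_diff)

lemma smooth_on_sum: "open S \<Longrightarrow> (\<And>i. i \<in> I \<Longrightarrow> smooth_on S (f i)) \<Longrightarrow> smooth_on S (\<lambda>x. \<Sum>i\<in>I. f i x)"
  by (simp add: smooth_on_def Ck_on_sum)

lemma smooth_on_subset: "smooth_on S f \<Longrightarrow> T \<subseteq> S \<Longrightarrow> smooth_on T f"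
  by (auto simp: smooth_on_def intro: Ck_on_subset)

lemma smooth_on_cong: "open S \<Longrightarrow> (\<And>x. x \<in> S \<Longrightarrow> f x = g x) \<Longrightarrow> smooth_on S f = smooth_on S g"
  unfolding smooth_on_def using Ck_on_cong by metis

text \<open>Being of class \<open>C\<^sup>k\<close> is a local property because derivatives are taken in the ambient space; this glues
locally finite sums and extensions by zero.\<close>

lemma Ck_on_local:
  assumes "\<And>x. x \<in> S \<Longrightarrow> \<exists>T. open T \<and> x \<in> T \<and> Ck_on k T f"
  shows "Ck_on k S f"
  using assms
proof (induction k arbitrary: f)
  case 0
  then show ?case
    by (meson Ck_on.simps(1) continuous_at_imp_continuous_on continuous_on_eq_continuous_at)
next
  case (Suc k)
  then have "f differentiable at x" if "x \<in> S" for x using that by force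
  moreover have "Ck_on k S (\<lambda>x. frechet_derivative f (at x) v)" for v
    by (rule Suc.IH) (use Suc.prems in force)
  ultimately show ?case by simp
qed

lemma smooth_on_local:
  "(\<And>x. x \<in> S \<Longrightarrow> \<exists>T. open T \<and> x \<in> T \<and> smooth_on T f) \<Longrightarrow> smooth_on S f"
  unfolding smooth_on_def using Ck_on_local by metis

subsection \<open>A bump function\<close>

text \<open>The functions \<open>exp (-1/t) / t\<^sup>n\<close>, extended by zero to \<open>t \<le> 0\<close>, are closed under differentiation up to linear
combinations. Treating the whole family at once turns smoothness of a composition into a plain induction on
the order of differentiability.\<close>

definition flat_exp :: "nat \<Rightarrow> real \<Rightarrow> real" where
  "flat_exp n t = (if t > 0 then exp (- (1 / t)) / t ^ n else 0)"

lemma flat_exp_tendsto_0: "((\<lambda>t. flat_exp n t) \<longlongrightarrow> 0) (at_right 0)"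
proof -
  have "((\<lambda>x::real. x ^ n / exp x) \<longlongrightarrow> 0) at_top"
    by (rule tendsto_power_div_exp_0)
  then have "((\<lambda>t::real. inverse t ^ n / exp (inverse t)) \<longlongrightarrow> 0) (at_right 0)"
    using filterlim_compose filterlim_inverse_at_top_right by blast
  then show ?thesis
    by (rule Lim_transform_eventually)
      (auto simp: eventually_at_filter flat_exp_def exp_minus field_simps inverse_eq_divide)
qed

lemma flat_exp_has_derivative:
  "(flat_exp n has_real_derivative flat_exp (n + 2) t - real n * flat_exp (n + 1) t) (at t)"
proof -
  consider "t > 0" | "t < 0" | "t = 0" by linarith
  then show ?thesis
  proof cases
    case 1
    have "((\<lambda>t. exp (- (1 / t)) / t ^ n) has_real_derivative flat_exp (n + 2) t - real n * flat_exp (n + 1) t) (at t)"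
      using 1 apply (auto intro!: derivative_eq_intros simp: flat_exp_def)
      apply (cases n)
      apply (auto simp: field_simps power2_eq_square)
      done
    then show ?thesis
      by (rule has_field_derivative_transform_within_open[where S="{0<..}"]) (use 1 in \<open>auto simp: flat_exp_def\<close>)
  next
    case 2
    have "((\<lambda>t. 0) has_real_derivative 0) (at t)" by simp
    then have "(flat_exp n has_real_derivative 0) (at t)"
      by (rule has_field_derivative_transform_within_open[where S="{..<0}"]) (use 2 in \<open>auto simp: flat_exp_def\<close>)
    then show ?thesis using 2 by (simp add: flat_exp_def)
  next
    case 3
    have "((\<lambda>h. flat_exp n h / h) \<longlongrightarrow> 0) (at_right 0)"
      by (rule Lim_transform_eventually[OF flat_exp_tendsto_0[of "Suc n"]])
        (auto simp: eventually_at_filter flat_exp_def)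
    moreover have "((\<lambda>h. flat_exp n h / h) \<longlongrightarrow> 0) (at_left 0)"
      by (rule Lim_transform_eventually[OF tendsto_const])
        (auto simp: eventually_at_filter flat_exp_def)
    ultimately have "((\<lambda>h. flat_exp n h / h) \<longlongrightarrow> 0) (at 0)"
      by (simp add: filterlim_split_at)
    then show ?thesis using 3 unfolding DERIV_def by (simp add: flat_exp_def)
  qed
qed

lemma Ck_on_flat_exp_comp:
  assumes "open S" "\<And>k. Ck_on k S f"
  shows "Ck_on k S (\<lambda>x. flat_exp n (f x))"
proof (induction k arbitrary: n)
  case 0
  have "continuous_on UNIV (flat_exp n)"
    using flat_exp_has_derivative DERIV_continuous continuous_at_imp_continuous_on by blast
  then show ?case using assms(2)[of 0]
    by (auto intro: continuous_on_compose2[of UNIV "flat_exp n"])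
next
  case (Suc k)
  show ?case
  proof (rule Ck_on_Suc_I[OF assms(1)])
    show "((\<lambda>x. flat_exp n (f x)) has_derivative
      (\<lambda>v. frechet_derivative f (at x) v * (flat_exp (n + 2) (f x) - real n * flat_exp (n + 1) (f x)))) (at x)"
      if "x \<in> S" for x
      using has_derivative_compose[OF Ck_on_Suc_derivative[OF assms(2) that],
          of "flat_exp n" "\<lambda>h. h * (flat_exp (n + 2) (f x) - real n * flat_exp (n + 1) (f x))"]
        flat_exp_has_derivative[of n "f x"]
      by (simp add: has_field_derivative_def mult_commute_abs)
    show "Ck_on k S (\<lambda>x. frechet_derivative f (at x) v * (flat_exp (n + 2) (f x) - real n * flat_exp (n + 1) (f x)))" for v
      using assms(2)[of "Suc k"] by (intro Ck_on_mult Ck_on_diff Ck_on_cmult assms(1) Suc) auto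
  qed
qed

definition bump :: "real \<Rightarrow> 'a::euclidean_space \<Rightarrow> real" where
  "bump \<epsilon> x = flat_exp 0 (1 - (x \<bullet> x) / \<epsilon>\<^sup>2)"

lemma smooth_on_bump: "smooth_on UNIV (bump \<epsilon> :: 'a::euclidean_space \<Rightarrow> real)"
proof -
  have eq: "(\<lambda>x::'a. 1 - (x \<bullet> x) / \<epsilon>\<^sup>2) = (\<lambda>x. 1 - (1 / \<epsilon>\<^sup>2) * (\<Sum>i\<in>Basis. (x \<bullet> i) * (x \<bullet> i)))"
    by (subst euclidean_inner) simp
  have "Ck_on k UNIV (\<lambda>x::'a. 1 - (x \<bullet> x) / \<epsilon>\<^sup>2)" for k
    unfolding eq by (intro Ck_on_diff Ck_on_const Ck_on_cmult Ck_on_sum Ck_on_mult Ck_on_inner_left) auto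
  then show ?thesis
    unfolding smooth_on_def bump_def by (intro allI Ck_on_flat_exp_comp) auto
qed

lemma bump_nonneg: "0 \<le> bump \<epsilon> x"
  by (simp add: bump_def flat_exp_def)

lemma bump_le_1: "bump \<epsilon> x \<le> 1"
  by (simp add: bump_def flat_exp_def)

lemma bump_eq_0: "0 < \<epsilon> \<Longrightarrow> \<epsilon> \<le> norm x \<Longrightarrow> bump \<epsilon> x = 0"
proof -
  assume "0 < \<epsilon>" "\<epsilon> \<le> norm x"
  then have "\<epsilon>\<^sup>2 \<le> x \<bullet> x"
    by (metis norm_ge_zero power2_norm_eq_inner power_mono less_imp_le)
  then show ?thesis using \<open>0 < \<epsilon>\<close> by (simp add: bump_def flat_exp_def)
qed

lemma bump_ge:
  assumes "0 < \<epsilon>" "norm x \<le> \<epsilon> / 2"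
  shows "exp (-2) \<le> bump \<epsilon> x"
proof -
  have "x \<bullet> x \<le> (\<epsilon> / 2)\<^sup>2"
    by (metis assms(2) norm_ge_zero power2_norm_eq_inner power_mono)
  then have "x \<bullet> x \<le> \<epsilon>\<^sup>2 / 4" by (simp add: power_divide)
  then have "(x \<bullet> x) * 2 \<le> \<epsilon>\<^sup>2"
    using inner_ge_zero[of x] by linarith
  then have *: "1 / 2 \<le> 1 - (x \<bullet> x) / \<epsilon>\<^sup>2"
    using assms(1) by (simp add: field_simps)
  then have "1 / (1 - (x \<bullet> x) / \<epsilon>\<^sup>2) \<le> 2"
    by (auto simp: divide_le_eq)
  moreover have "0 < 1 - (x \<bullet> x) / \<epsilon>\<^sup>2" using * by linarith
  ultimately show ?thesis by (simp add: bump_def flat_exp_def)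
qed

section \<open>Test functions, mollifiers and convolution\<close>

lemma test_fun_smooth: "test_fun \<Omega> \<eta> \<Longrightarrow> smooth_on UNIV \<eta>"
  by (simp add: test_fun_def)

lemma test_fun_mono: "test_fun \<Omega> \<eta> \<Longrightarrow> \<Omega> \<subseteq> \<Omega>' \<Longrightarrow> test_fun \<Omega>' \<eta>"
  by (auto simp: test_fun_def)

lemma test_fun_has_derivative:
  "test_fun \<Omega> \<eta> \<Longrightarrow> (\<eta> has_derivative frechet_derivative \<eta> (at x)) (at x)"
  using smooth_on_has_derivative test_fun_smooth by blast

lemma test_funI:
  assumes "smooth_on UNIV \<eta>" "compact K" "K \<subseteq> \<Omega>" "\<And>x. \<eta> x \<noteq> 0 \<Longrightarrow> x \<in> K"
  shows "test_fun \<Omega> \<eta>"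
proof -
  have "closure {x. \<eta> x \<noteq> 0} \<subseteq> K"
    using assms by (intro closure_minimal) (auto intro: compact_imp_closed)
  moreover from this have "compact (closure {x. \<eta> x \<noteq> 0})"
    using compact_Int_closed[OF assms(2) closed_closure] by (metis inf.absorb_iff2)
  ultimately show ?thesis
    using assms by (auto simp: test_fun_def)
qed

lemma test_fun_support:
  assumes "test_fun \<Omega> \<eta>"
  obtains K where "compact K" "K \<subseteq> \<Omega>" "\<And>x. x \<notin> K \<Longrightarrow> \<eta> x = 0"
    "\<And>x v. x \<notin> K \<Longrightarrow> frechet_derivative \<eta> (at x) v = 0"
proof
  define K where "K = closure {x. \<eta> x \<noteq> 0}"
  show K: "compact K" "K \<subseteq> \<Omega>" using assms by (simp_all add: test_fun_def K_def)
  show 0: "\<eta> x = 0" if "x \<notin> K" for x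
    using that closure_subset[of "{x. \<eta> x \<noteq> 0}"] unfolding K_def by auto
  show "frechet_derivative \<eta> (at x) v = 0" if "x \<notin> K" for x v
  proof -
    have "open (- K)" using K(1) by (simp add: compact_imp_closed open_Compl)
    then have "((\<lambda>x. 0) has_derivative frechet_derivative \<eta> (at x)) (at x)"
      by (rule has_derivative_transform_within_open[OF test_fun_has_derivative[OF assms]])
        (simp_all add: that 0)
    then have "frechet_derivative \<eta> (at x) = (\<lambda>h. 0)"
      by (rule has_derivative_unique[OF _ has_derivative_const])
    then show ?thesis by simp
  qed
qed

lemma test_fun_derivative:
  assumes "test_fun \<Omega> \<eta>"
  shows "test_fun \<Omega> (\<lambda>x. frechet_derivative \<eta> (at x) v)"
proof -
  obtain K where "compact K" "K \<subseteq> \<Omega>" "\<And>x v. x \<notin> K \<Longrightarrow> frechet_derivative \<eta> (at x) v = 0"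
    using test_fun_support[OF assms] by metis
  then show ?thesis
    using smooth_on_derivative[OF test_fun_smooth[OF assms]] by (intro test_funI[of _ K]) auto
qed

lemma test_fun_mult:
  assumes "test_fun \<Omega> \<eta>" "smooth_on UNIV \<zeta>"
  shows "test_fun \<Omega> (\<lambda>x. \<zeta> x * \<eta> x)"
proof -
  obtain K where "compact K" "K \<subseteq> \<Omega>" "\<And>x. x \<notin> K \<Longrightarrow> \<eta> x = 0"
    using test_fun_support[OF assms(1)] by metis
  then show ?thesis
    using smooth_on_mult[OF open_UNIV assms(2) test_fun_smooth[OF assms(1)]] by (intro test_funI[of _ K]) auto
qed

lemma test_fun_diff:
  assumes "test_fun \<Omega> \<eta>" "test_fun \<Omega> \<zeta>"
  shows "test_fun \<Omega> (\<lambda>x. \<zeta> x - \<eta> x)"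
proof -
  obtain K where K: "compact K" "K \<subseteq> \<Omega>" "\<And>x. x \<notin> K \<Longrightarrow> \<eta> x = 0"
    using test_fun_support[OF assms(1)] by metis
  obtain K' where K': "compact K'" "K' \<subseteq> \<Omega>" "\<And>x. x \<notin> K' \<Longrightarrow> \<zeta> x = 0"
    using test_fun_support[OF assms(2)] by metis
  show ?thesis
    using smooth_on_diff[OF open_UNIV test_fun_smooth[OF assms(2)] test_fun_smooth[OF assms(1)]] K K'
    by (intro test_funI[of _ "K \<union> K'"]) (auto, metis)
qed

lemma test_fun_continuous: "test_fun \<Omega> \<eta> \<Longrightarrow> continuous_on S \<eta>"
  using smooth_on_continuous test_fun_smooth continuous_on_subset by (metis subset_UNIV)

lemma test_fun_measurable: "test_fun \<Omega> \<eta> \<Longrightarrow> \<eta> \<in> borel_measurable borel"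
  by (simp add: test_fun_continuous borel_measurable_continuous_onI)

lemma test_fun_bounded:
  assumes "test_fun \<Omega> \<eta>"
  obtains B where "0 \<le> B" "\<And>x. \<bar>\<eta> x\<bar> \<le> B"
proof -
  obtain K where K: "compact K" "\<And>x. x \<notin> K \<Longrightarrow> \<eta> x = 0"
    using test_fun_support[OF assms] by metis
  have "bounded (\<eta> ` K)"
    using K(1) test_fun_continuous[OF assms] compact_continuous_image compact_imp_bounded by blast
  then obtain B where "\<And>x. x \<in> K \<Longrightarrow> \<bar>\<eta> x\<bar> \<le> B" by (auto simp: bounded_iff)
  then have "\<bar>\<eta> x\<bar> \<le> max B 0" for x using K(2)[of x] by (cases "x \<in> K") force+
  then show thesis using that[of "max B 0"] by simp
qed

lemma test_fun_derivative_bounded: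
  assumes "test_fun \<Omega> \<eta>"
  obtains B where "0 \<le> B" "\<And>x v. \<bar>frechet_derivative \<eta> (at x) v\<bar> \<le> B * norm v"
    "\<And>x y. \<bar>\<eta> x - \<eta> y\<bar> \<le> B * norm (x - y)"
proof -
  have "\<exists>B\<ge>0. \<forall>x. \<bar>frechet_derivative \<eta> (at x) i\<bar> \<le> B" for i
    using test_fun_bounded[OF test_fun_derivative[OF assms]] by metis
  then obtain B where B: "\<And>i. B i \<ge> 0" "\<And>i x. \<bar>frechet_derivative \<eta> (at x) i\<bar> \<le> B i" by metis
  define C where "C = (\<Sum>i\<in>Basis. B i)"
  have C0: "0 \<le> C" by (auto simp: C_def intro: sum_nonneg B)
  have *: "\<bar>frechet_derivative \<eta> (at x) v\<bar> \<le> C * norm v" for x v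
  proof -
    have lin: "linear (frechet_derivative \<eta> (at x))"
      using test_fun_has_derivative[OF assms] has_derivative_linear by blast
    have "frechet_derivative \<eta> (at x) v = frechet_derivative \<eta> (at x) (\<Sum>i\<in>Basis. (v \<bullet> i) *\<^sub>R i)"
      by (simp add: euclidean_representation)
    also have "\<dots> = (\<Sum>i\<in>Basis. (v \<bullet> i) * frechet_derivative \<eta> (at x) i)"
      by (simp add: linear_sum[OF lin] linear_scale[OF lin])
    also have "\<bar>\<dots>\<bar> \<le> (\<Sum>i\<in>Basis. \<bar>(v \<bullet> i) * frechet_derivative \<eta> (at x) i\<bar>)" by (rule sum_abs)
    also have "\<dots> \<le> (\<Sum>i\<in>Basis. norm v * B i)"
      by (intro sum_mono) (auto simp: abs_mult intro!: mult_mono B Basis_le_norm)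
    finally show ?thesis by (simp add: C_def sum_distrib_left mult.commute)
  qed
  have "\<bar>\<eta> x - \<eta> y\<bar> \<le> C * norm (x - y)" for x y
    using differentiable_bound[of UNIV \<eta> "\<lambda>x. frechet_derivative \<eta> (at x)" C x y]
      test_fun_has_derivative[OF assms] * onorm_le[of "frechet_derivative \<eta> (at z)" C for z]
    by (auto simp: real_norm_def)
  then show thesis using * C0 that by blast
qed

text \<open>The function may be vector valued, so that a function and its gradient can be mollified as one pair.\<close>

definition conv :: "('a::euclidean_space \<Rightarrow> real) \<Rightarrow> ('a \<Rightarrow> 'b::euclidean_space) \<Rightarrow> 'a \<Rightarrow> 'b" where
  "conv k f x = (\<integral>y. k (x - y) *\<^sub>R f y \<partial>lborel)"

lemma conv_integrable:
  fixes f :: "'a::euclidean_space \<Rightarrow> 'b::euclidean_space"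
  assumes k: "test_fun \<Omega> k" and f: "integrable lborel f"
  shows "integrable lborel (\<lambda>y. k (x - y) *\<^sub>R f y)"
proof -
  obtain B where "0 \<le> B" "\<And>x. \<bar>k x\<bar> \<le> B" using test_fun_bounded[OF k] by metis
  then have "norm (k (x - y) *\<^sub>R f y) \<le> norm (B * norm (f y))" for y
    using mult_right_mono[of "\<bar>k (x - y)\<bar>" B "norm (f y)"] by simp
  moreover have "integrable lborel (\<lambda>y. B * norm (f y))" using f by simp
  moreover have "(\<lambda>y. k (x - y) *\<^sub>R f y) \<in> borel_measurable lborel"
    using test_fun_measurable[OF k] f by measurable
  ultimately show ?thesis
    by (blast intro: Bochner_Integration.integrable_bound AE_I2)
qed

lemma conv_eq_0: "(\<And>y. f y \<noteq> 0 \<Longrightarrow> k (x - y) = 0) \<Longrightarrow> conv k f x = 0"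
  unfolding conv_def by (rule integral_eq_zero_AE) auto

text \<open>Differentiation under the integral sign: the difference quotients of the kernel are bounded by twice its Lipschitz
constant, so dominated convergence applies along every sequence that tends to \<open>x\<close>.\<close>

lemma conv_has_derivative:
  fixes f :: "'a::euclidean_space \<Rightarrow> real"
  assumes k: "test_fun \<Omega> k" and f: "integrable lborel f"
  shows "(conv k f has_derivative (\<lambda>h. conv (\<lambda>z. frechet_derivative k (at z) h) f x)) (at x)"
proof -
  let ?D = "\<lambda>z. frechet_derivative k (at z)"
  obtain B where B: "0 \<le> B" "\<And>x v. \<bar>?D x v\<bar> \<le> B * norm v" "\<And>x y. \<bar>k x - k y\<bar> \<le> B * norm (x - y)"
    using test_fun_derivative_bounded[OF k] by metis
  note [measurable] = test_fun_measurable[OF k] test_fun_measurable[OF test_fun_derivative[OF k]]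
  have [measurable]: "f \<in> borel_measurable borel" using f by auto
  have lin: "linear (?D z)" for z
    using test_fun_has_derivative[OF k] has_derivative_linear by blast
  have int: "integrable lborel (\<lambda>y. ?D (x - y) h * f y)" for h
    using conv_integrable[OF test_fun_derivative[OF k] f] by simp
  have intk: "integrable lborel (\<lambda>y. k (x - y) * f y)" for x
    using conv_integrable[OF k f] by simp
  have "linear (\<lambda>h. conv (\<lambda>z. ?D z h) f x)"
  proof
    fix a b show "conv (\<lambda>z. ?D z (a + b)) f x = conv (\<lambda>z. ?D z a) f x + conv (\<lambda>z. ?D z b) f x"
      using int by (simp add: conv_def linear_add[OF lin] distrib_right)
  next
    fix r a show "conv (\<lambda>z. ?D z (r *\<^sub>R a)) f x = r *\<^sub>R conv (\<lambda>z. ?D z a) f x"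
      using int by (simp add: conv_def linear_scale[OF lin] mult.assoc)
  qed
  then have bl: "bounded_linear (\<lambda>h. conv (\<lambda>z. ?D z h) f x)"
    by (simp add: linear_conv_bounded_linear)
  have "((\<lambda>y. norm (conv k f y - conv k f x - conv (\<lambda>z. ?D z (y - x)) f x) / norm (y - x)) \<longlongrightarrow> 0) (at x)"
    unfolding tendsto_at_iff_sequentially
  proof (intro allI impI)
    fix X assume X: "\<forall>i. X i \<in> UNIV - {x}" "X \<longlonglongrightarrow> x"
    let ?R = "\<lambda>i y. (k (X i - y) - k (x - y) - ?D (x - y) (X i - x)) / norm (X i - x)"
    have "(\<lambda>i. \<integral>y. ?R i y * f y \<partial>lborel) \<longlonglongrightarrow> (\<integral>(y::'a). 0 \<partial>lborel)"
    proof (rule integral_dominated_convergence[where w="\<lambda>y. 2 * B * \<bar>f y\<bar>"])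
      show "integrable lborel (\<lambda>y. 2 * B * \<bar>f y\<bar>)" using f by simp
      show "AE y in lborel. (\<lambda>i. ?R i y * f y) \<longlonglongrightarrow> 0"
      proof (rule AE_I2)
        fix y
        have "((\<lambda>z. (k (z - y))) has_derivative ?D (x - y)) (at x)"
          by (rule has_derivative_eq_rhs[OF has_derivative_compose[of "\<lambda>z. z - y" "\<lambda>h. h"]])
            (auto intro!: derivative_eq_intros test_fun_has_derivative[OF k])
        then have "((\<lambda>z. norm (k (z - y) - k (x - y) - ?D (x - y) (z - x)) / norm (z - x)) \<longlongrightarrow> 0) (at x)"
          by (simp add: has_derivative_iff_norm)
        then have "(\<lambda>i. norm (k (X i - y) - k (x - y) - ?D (x - y) (X i - x)) / norm (X i - x)) \<longlonglongrightarrow> 0"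
          using X unfolding tendsto_at_iff_sequentially o_def by blast
        then have "(\<lambda>i. norm (?R i y)) \<longlonglongrightarrow> 0" by (simp only: norm_divide real_norm_def abs_norm_cancel abs_divide)
        then have "(\<lambda>i. ?R i y) \<longlonglongrightarrow> 0" by (rule tendsto_norm_zero_cancel)
        then show "(\<lambda>i. ?R i y * f y) \<longlonglongrightarrow> 0" by (rule tendsto_mult_left_zero)
      qed
      show "AE y in lborel. norm (?R i y * f y) \<le> 2 * B * \<bar>f y\<bar>" for i
      proof (rule AE_I2)
        fix y
        have "norm (X i - x) > 0" using X by auto
        moreover have "\<bar>k (X i - y) - k (x - y) - ?D (x - y) (X i - x)\<bar> \<le> 2 * B * norm (X i - x)"
          using B(2)[of "x - y" "X i - x"] B(3)[of "X i - y" "x - y"] by simp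
        ultimately have "\<bar>?R i y\<bar> \<le> 2 * B" by (simp add: divide_le_eq)
        then show "norm (?R i y * f y) \<le> 2 * B * \<bar>f y\<bar>"
          unfolding real_norm_def abs_mult by (intro mult_right_mono) auto
      qed
    qed measurable
    then have "(\<lambda>i. \<integral>y. ?R i y * f y \<partial>lborel) \<longlonglongrightarrow> 0"
      by (simp only: Bochner_Integration.integral_zero)
    then have "(\<lambda>i. norm (\<integral>y. ?R i y * f y \<partial>lborel)) \<longlonglongrightarrow> 0"
      by (rule tendsto_norm_zero)
    moreover have "norm (conv k f (X i) - conv k f x - conv (\<lambda>z. ?D z (X i - x)) f x) / norm (X i - x)
      = norm (\<integral>y. ?R i y * f y \<partial>lborel)" for i
    proof -
      have "(\<integral>y. ?R i y * f y \<partial>lborel) = (\<integral>y. (k (X i - y) * f y - k (x - y) * f y - ?D (x - y) (X i - x) * f y) / norm (X i - x) \<partial>lborel)"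
        by (intro Bochner_Integration.integral_cong) (auto simp: algebra_simps)
      also have "\<dots> = (conv k f (X i) - conv k f x - conv (\<lambda>z. ?D z (X i - x)) f x) / norm (X i - x)"
        using int intk by (simp add: conv_def)
      finally show ?thesis by (simp only: norm_divide real_norm_def abs_norm_cancel abs_divide)
    qed
    ultimately show "((\<lambda>y. norm (conv k f y - conv k f x - conv (\<lambda>z. ?D z (y - x)) f x) / norm (y - x)) \<circ> X) \<longlonglongrightarrow> 0"
      by (simp only: o_def)
  qed
  with bl show ?thesis by (simp add: has_derivative_iff_norm)
qed

lemma conv_smooth:
  fixes f :: "'a::euclidean_space \<Rightarrow> real"
  assumes k: "test_fun \<Omega> k" and f: "integrable lborel f"
  shows "smooth_on UNIV (conv k f)"
proof -
  have "Ck_on n UNIV (conv k f)" for n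
    using k
  proof (induction n arbitrary: k)
    case 0
    then show ?case using conv_has_derivative[OF 0 f]
      by (auto intro!: continuous_at_imp_continuous_on has_derivative_continuous)
  next
    case (Suc n)
    show ?case
      by (rule Ck_on_Suc_I[OF open_UNIV conv_has_derivative[OF Suc.prems f]])
        (intro Suc.IH test_fun_derivative Suc.prems)
  qed
  then show ?thesis by (simp add: smooth_on_def)
qed

subsection \<open>The standard mollifier\<close>

lemma lborel_distr_reflect: "distr lborel borel (\<lambda>y. x - y) = (lborel :: 'a::euclidean_space measure)"
  using lborel_affine[of "-1" x] by (simp add: density_1)

lemma nn_integral_reflect:
  fixes f :: "'a::euclidean_space \<Rightarrow> ennreal"
  assumes "f \<in> borel_measurable borel"
  shows "(\<integral>\<^sup>+y. f (x - y) \<partial>lborel) = (\<integral>\<^sup>+y. f y \<partial>lborel)"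
  by (subst (2) lborel_distr_reflect[of x, symmetric], subst nn_integral_distr) (use assms in auto)

lemma nn_integral_translate:
  fixes f :: "'a::euclidean_space \<Rightarrow> ennreal"
  assumes "f \<in> borel_measurable borel"
  shows "(\<integral>\<^sup>+y. f (y - x) \<partial>lborel) = (\<integral>\<^sup>+y. f y \<partial>lborel)"
  by (subst (2) lborel_distr_plus[of "- x", symmetric], subst nn_integral_distr) (use assms in auto)

lemma integral_reflect:
  fixes f :: "'a::euclidean_space \<Rightarrow> 'b::euclidean_space"
  assumes "f \<in> borel_measurable borel"
  shows "(\<integral>y. f (x - y) \<partial>lborel) = (\<integral>y. f y \<partial>lborel)"
  by (subst (2) lborel_distr_reflect[of x, symmetric], subst integral_distr) (use assms in auto)

lemma bump_test_fun: "0 < \<epsilon> \<Longrightarrow> test_fun UNIV (bump \<epsilon>)"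
  using bump_eq_0[of \<epsilon>] by (intro test_funI[of _ "cball 0 \<epsilon>"] smooth_on_bump) (force simp: dist_norm)+

lemma bump_integrable:
  assumes "0 < \<epsilon>" shows "integrable lborel (bump \<epsilon> :: 'a::euclidean_space \<Rightarrow> real)"
proof -
  have "integrable lborel (indicator (cball 0 \<epsilon>) :: 'a \<Rightarrow> real)"
    using emeasure_lborel_cball_finite by (intro integrable_real_indicator) auto
  moreover have "(bump \<epsilon> :: 'a \<Rightarrow> real) \<in> borel_measurable lborel"
    using test_fun_measurable[OF bump_test_fun[OF assms]] by simp
  moreover have "norm (bump \<epsilon> x) \<le> norm (indicator (cball 0 \<epsilon>) x :: real)" for x :: 'a
    using bump_eq_0[OF assms, of x] bump_nonneg[of \<epsilon> x] bump_le_1[of \<epsilon> x]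
    by (cases "norm x \<le> \<epsilon>") auto
  ultimately show ?thesis
    by (blast intro: Bochner_Integration.integrable_bound AE_I2)
qed

definition moll :: "real \<Rightarrow> 'a::euclidean_space \<Rightarrow> real" where
  "moll \<epsilon> z = bump \<epsilon> z / (\<integral>y. bump \<epsilon> (y::'a) \<partial>lborel)"

text \<open>The bump function is at least \<open>exp (-2)\<close> on the ball of half the radius. This bounds its integral from below, and
hence the height of the mollifier from above by this constant over \<open>\<epsilon>\<close> to the power of the dimension.\<close>

definition moll_const :: "'a::euclidean_space itself \<Rightarrow> real" where
  "moll_const _ = exp 2 * 2 ^ DIM('a) / unit_ball_vol (real DIM('a))"

lemma moll_const_pos: "0 < moll_const TYPE('a::euclidean_space)"
  by (simp add: moll_const_def)

lemma bump_integral_ge: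
  assumes "0 < \<epsilon>"
  shows "\<epsilon> ^ DIM('a) / moll_const TYPE('a) \<le> (\<integral>y. bump \<epsilon> (y::'a::euclidean_space) \<partial>lborel)"
proof -
  have fin: "emeasure lborel (cball (0::'a) (\<epsilon>/2)) < \<infinity>" by (rule emeasure_lborel_cball_finite)
  have "\<epsilon> ^ DIM('a) / moll_const TYPE('a) = exp (-2) * measure lborel (cball (0::'a) (\<epsilon>/2))"
    using assms by (simp add: content_cball moll_const_def exp_minus field_simps)
  also have "\<dots> = (\<integral>y. exp (-2) * indicator (cball (0::'a) (\<epsilon>/2)) y \<partial>lborel)"
    by simp
  also have "\<dots> \<le> (\<integral>y. bump \<epsilon> (y::'a) \<partial>lborel)"
    using bump_ge[OF assms] fin
    by (intro integral_mono bump_integrable assms integrable_mult_right integrable_real_indicator)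
      (auto simp: indicator_def bump_nonneg)
  finally show ?thesis .
qed

lemma bump_integral_pos:
  assumes "0 < \<epsilon>" shows "0 < (\<integral>y. bump \<epsilon> (y::'a::euclidean_space) \<partial>lborel)"
proof -
  have "0 < \<epsilon> ^ DIM('a) / moll_const TYPE('a)" using assms moll_const_pos by (intro divide_pos_pos) auto
  then show ?thesis using bump_integral_ge[OF assms] by (rule less_le_trans)
qed

lemma moll_nonneg: "0 < \<epsilon> \<Longrightarrow> 0 \<le> moll \<epsilon> z"
  unfolding moll_def using bump_integral_pos by (intro divide_nonneg_pos bump_nonneg) auto

lemma moll_eq_0: "0 < \<epsilon> \<Longrightarrow> \<epsilon> \<le> norm z \<Longrightarrow> moll \<epsilon> z = 0"
  by (simp add: moll_def bump_eq_0)

lemma moll_le: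
  assumes "0 < \<epsilon>"
  shows "moll \<epsilon> (z::'a::euclidean_space) \<le> moll_const TYPE('a) / \<epsilon> ^ DIM('a)"
proof -
  have "moll \<epsilon> z \<le> 1 / (\<epsilon> ^ DIM('a) / moll_const TYPE('a))"
    unfolding moll_def using bump_integral_ge[OF assms] assms moll_const_pos[where 'a='a]
    by (intro frac_le bump_le_1) auto
  then show ?thesis by simp
qed

lemma moll_test_fun:
  assumes "0 < \<epsilon>" shows "test_fun UNIV (moll \<epsilon> :: 'a::euclidean_space \<Rightarrow> real)"
proof -
  have "test_fun UNIV (\<lambda>z::'a. inverse (\<integral>y. bump \<epsilon> (y::'a) \<partial>lborel) * bump \<epsilon> z)"
    by (rule test_fun_mult[OF bump_test_fun[OF assms]]) (simp add: smooth_on_def Ck_on_const)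
  then show ?thesis by (simp add: moll_def[abs_def] divide_inverse mult.commute)
qed

lemma moll_measurable: "0 < \<epsilon> \<Longrightarrow> (moll \<epsilon> :: 'a::euclidean_space \<Rightarrow> real) \<in> borel_measurable borel"
  by (rule test_fun_measurable[OF moll_test_fun])

lemma moll_integral:
  assumes "0 < \<epsilon>"
  shows "integrable lborel (moll \<epsilon> :: 'a::euclidean_space \<Rightarrow> real)" "(\<integral>y. moll \<epsilon> (y::'a) \<partial>lborel) = 1"
    "(\<integral>\<^sup>+y. ennreal (moll \<epsilon> (y::'a)) \<partial>lborel) = 1"
proof -
  show 1: "integrable lborel (moll \<epsilon> :: 'a \<Rightarrow> real)"
    unfolding moll_def using bump_integrable[OF assms] by (intro integrable_divide) auto
  show 2: "(\<integral>y. moll \<epsilon> (y::'a) \<partial>lborel) = 1"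
    using bump_integral_pos[OF assms, where 'a='a] by (simp add: moll_def[abs_def])
  show "(\<integral>\<^sup>+y. ennreal (moll \<epsilon> (y::'a)) \<partial>lborel) = 1"
    by (subst nn_integral_eq_integral[OF 1]) (simp_all add: 2 moll_nonneg[OF assms])
qed

lemma moll_conv_minus:
  fixes f :: "'a::euclidean_space \<Rightarrow> 'b::euclidean_space"
  assumes \<epsilon>: "0 < \<epsilon>" and f: "integrable lborel f"
  shows "ennreal (norm (conv (moll \<epsilon>) f x - f x)) \<le> (\<integral>\<^sup>+y. ennreal (moll \<epsilon> y * norm (f (x - y) - f x)) \<partial>lborel)"
proof -
  note [measurable] = moll_measurable[OF \<epsilon>]
  have [measurable]: "f \<in> borel_measurable borel" using f by auto
  have "(\<integral>y. moll \<epsilon> (x - y) \<partial>lborel) = 1"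
    by (subst integral_reflect) (simp_all add: moll_integral[OF \<epsilon>])
  moreover have i1: "integrable lborel (\<lambda>y. moll \<epsilon> (x - y))"
  proof (rule ccontr)
    assume "\<not> ?thesis"
    then show False using \<open>(\<integral>y. moll \<epsilon> (x - y) \<partial>lborel) = 1\<close> not_integrable_integral_eq by fastforce
  qed
  ultimately have "conv (moll \<epsilon>) f x - f x = (\<integral>y. moll \<epsilon> (x - y) *\<^sub>R (f y - f x) \<partial>lborel)"
    using conv_integrable[OF moll_test_fun[OF \<epsilon>] f] by (simp add: conv_def scaleR_diff_right)
  also have "ennreal (norm \<dots>) \<le> (\<integral>\<^sup>+y. ennreal (norm (moll \<epsilon> (x - y) *\<^sub>R (f y - f x))) \<partial>lborel)"
    using conv_integrable[OF moll_test_fun[OF \<epsilon>] f] i1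
    by (intro integral_norm_bound_ennreal) (auto simp: scaleR_diff_right)
  also have "\<dots> = (\<integral>\<^sup>+y. ennreal (moll \<epsilon> (x - y) * norm (f y - f x)) \<partial>lborel)"
    by (simp add: moll_nonneg[OF \<epsilon>])
  also have "\<dots> = (\<integral>\<^sup>+y. ennreal (moll \<epsilon> y * norm (f (x - y) - f x)) \<partial>lborel)"
    using nn_integral_reflect[of "\<lambda>y. ennreal (moll \<epsilon> (x - y) * norm (f y - f x))" x] by simp
  finally show ?thesis .
qed

subsection \<open>Convergence in the mean\<close>

text \<open>Outer regularity is applied to the set and to its complement; intersecting with a large ball makes the inner
closed set compact.\<close>

lemma compact_between:
  fixes A :: "'a::euclidean_space set"
  assumes A: "A \<in> sets borel" "emeasure lborel A < \<infinity>" and "0 < (\<delta>::real)"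
  obtains K U where "compact K" "open U" "K \<subseteq> A" "A \<subseteq> U" "emeasure lborel (U - K) \<le> ennreal \<delta>"
proof -
  have d: "0 < \<delta> / 3" using \<open>0 < \<delta>\<close> by simp
  obtain U where U: "open U" "A \<subseteq> U" "emeasure lborel (U - A) < ennreal (\<delta> / 3)"
    using outer_regular_lborel[OF A(1) d] by metis
  have "- A \<in> sets borel" using A(1) by (metis borel_comp)
  then obtain V where V: "open V" "- A \<subseteq> V" "emeasure lborel (V - - A) < ennreal (\<delta> / 3)"
    using outer_regular_lborel[OF _ d] by metis
  have "(\<lambda>n. emeasure lborel (A - cball 0 (real n))) \<longlonglongrightarrow> emeasure lborel (\<Inter>n. A - cball 0 (real n))"
  proof (rule Lim_emeasure_decseq)
    show "range (\<lambda>n. A - cball 0 (real n)) \<subseteq> sets lborel" using A by auto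
    show "decseq (\<lambda>n. A - cball 0 (real n))" by (auto simp: decseq_def)
    show "emeasure lborel (A - cball 0 (real i)) \<noteq> \<infinity>" for i
      using emeasure_mono[of "A - cball 0 (real i)" A lborel] A by (auto simp: top_unique)
  qed
  moreover have "(\<Inter>n. A - cball 0 (real n)) = {}"
    by (auto simp: not_le) (meson real_arch_simple)
  ultimately have "(\<lambda>n. emeasure lborel (A - cball 0 (real n))) \<longlonglongrightarrow> 0"
    by (simp only: emeasure_empty)
  then have "eventually (\<lambda>n. emeasure lborel (A - cball 0 (real n)) < ennreal (\<delta> / 3)) sequentially"
    by (rule order_tendstoD) (use d in simp)
  then obtain n where n: "emeasure lborel (A - cball 0 (real n)) < ennreal (\<delta> / 3)"
    by (auto simp: eventually_sequentially)
  define K where "K = cball 0 (real n) \<inter> (- V)"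
  have "compact K" unfolding K_def by (rule compact_Int_closed) (use V in auto)
  moreover have "K \<subseteq> A" using V by (auto simp: K_def)
  moreover have "emeasure lborel (U - K) \<le> ennreal \<delta>"
  proof -
    have sub: "U - K \<subseteq> (U - A) \<union> ((V - - A) \<union> (A - cball 0 (real n)))" by (auto simp: K_def)
    have m: "U - A \<in> sets lborel" "V - - A \<in> sets lborel" "A - cball 0 (real n) \<in> sets lborel"
      using A U V by auto
    have "emeasure lborel (U - K) \<le> emeasure lborel (U - A) + (emeasure lborel (V - - A) + emeasure lborel (A - cball 0 (real n)))"
      by (rule order_trans[OF emeasure_mono[OF sub]])
        (use m in \<open>auto intro!: order_trans[OF emeasure_subadditive] add_mono\<close>)
    also have "\<dots> \<le> ennreal (\<delta> / 3) + (ennreal (\<delta> / 3) + ennreal (\<delta> / 3))"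
      using U V n by (intro add_mono) auto
    also have "\<dots> = ennreal \<delta>" using d by (simp flip: ennreal_plus)
    finally show ?thesis .
  qed
  ultimately show thesis using that U by blast
qed

text \<open>For the indicator of a set squeezed between a compact \<open>K\<close> and an open \<open>U\<close>, a small translation changes
the value only at points that lie in \<open>U - K\<close> before or after the translation. Integrable functions are
limits of combinations of such indicators.\<close>

lemma translation_continuous_L1:
  fixes f :: "'a::euclidean_space \<Rightarrow> 'b::euclidean_space"
  assumes "integrable lborel f" "0 < (\<delta>::real)"
  shows "\<exists>r>0. \<forall>h. norm h < r \<longrightarrow> (\<integral>\<^sup>+x. ennreal (norm (f (x - h) - f x)) \<partial>lborel) \<le> ennreal \<delta>"
  using assms
proof (induction f arbitrary: \<delta> rule: integrable_induct)
  case (base A c)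
  have A: "A \<in> sets borel" "emeasure lborel A < \<infinity>" using base by auto
  define d where "d = \<delta> / (2 * (norm c + 1))"
  have d: "0 < d" using base by (simp add: d_def add_nonneg_pos)
  obtain K U where K: "compact K" "open U" "K \<subseteq> A" "A \<subseteq> U" "emeasure lborel (U - K) \<le> ennreal d"
    using compact_between[OF A d] by metis
  have meas: "U - K \<in> sets borel" using K by (simp add: borel_open borel_compact sets.Diff)
  obtain r where r: "r > 0" "\<And>x y. x \<in> K \<Longrightarrow> dist x y < r \<Longrightarrow> y \<in> U"
  proof -
    have "K \<subseteq> U" using K(3,4) by (rule order_trans)
    from compact_subset_open_imp_ball_epsilon_subset[OF K(1,2) this]
    obtain r where "r > 0" "(\<Union>x\<in>K. ball x r) \<subseteq> U" .
    then show thesis using that[of r] by (auto simp: subset_iff)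
  qed
  show ?case
  proof (intro exI[of _ r] conjI r(1) allI impI)
    fix h :: 'a assume h: "norm h < r"
    have pt: "ennreal (norm (indicator A (x - h) *\<^sub>R c - indicator A x *\<^sub>R c))
        \<le> ennreal (norm c) * (indicator (U - K) (x - h) + indicator (U - K) x)" for x
    proof -
      have "x \<in> K \<Longrightarrow> x - h \<in> U" "x - h \<in> K \<Longrightarrow> x \<in> U"
        using r(2)[of x "x - h"] r(2)[of "x - h" x] h by (auto simp: dist_norm)
      then have "1 \<le> (indicator (U - K) (x - h) + indicator (U - K) x :: ennreal)"
        if "(x \<in> A) \<noteq> (x - h \<in> A)"
        using that K(3,4) by (cases "x \<in> A"; cases "x \<in> K"; cases "x - h \<in> K") (auto simp: subset_iff)
      note mult_left_mono[OF this, of "ennreal (norm c)"]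
      then show ?thesis by (cases "x \<in> A"; cases "x - h \<in> A") simp_all
    qed
    have "(\<integral>\<^sup>+x. ennreal (norm (indicator A (x - h) *\<^sub>R c - indicator A x *\<^sub>R c)) \<partial>lborel)
      \<le> (\<integral>\<^sup>+x. ennreal (norm c) * (indicator (U - K) (x - h) + indicator (U - K) x) \<partial>lborel)"
      by (intro nn_integral_mono pt)
    also have "\<dots> = ennreal (norm c) * ((\<integral>\<^sup>+x. indicator (U - K) (x - h) \<partial>lborel) + emeasure lborel (U - K))"
      using meas by (simp add: nn_integral_cmult nn_integral_add)
    also have "(\<integral>\<^sup>+x. indicator (U - K) (x - h) \<partial>lborel) = emeasure lborel (U - K)"
      using meas by (subst nn_integral_translate) auto
    also have "ennreal (norm c) * (emeasure lborel (U - K) + emeasure lborel (U - K)) \<le> ennreal (norm c) * (ennreal d + ennreal d)"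
      by (intro mult_left_mono add_mono K(5)) auto
    also have "\<dots> = ennreal (norm c * (2 * d))" using d by (simp flip: ennreal_plus ennreal_mult)
    also have "\<dots> \<le> ennreal \<delta>"
    proof (rule ennreal_leI)
    have "norm c * (2 * d) \<le> (norm c + 1) * (2 * d)"
      using d by (intro mult_right_mono) auto
    also have "(norm c + 1) * (2 * d) = \<delta>"
    proof -
      have "norm c + 1 \<noteq> 0" using norm_ge_zero[of c] by linarith
      moreover have "N * (2 * (\<delta> / (2 * N))) = \<delta>" if "N \<noteq> 0" for N :: real using that by simp
      ultimately show ?thesis unfolding d_def by blast
    qed
    finally show "norm c * (2 * d) \<le> \<delta>" .
    qed
    finally show "(\<integral>\<^sup>+x. ennreal (norm (indicator A (x - h) *\<^sub>R c - indicator A x *\<^sub>R c)) \<partial>lborel) \<le> ennreal \<delta>" .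
  qed
next
  case (add f g)
  have [measurable]: "f \<in> borel_measurable borel" "g \<in> borel_measurable borel" using add.hyps by auto
  obtain r s where rs: "r > 0" "s > 0"
    "\<And>h. norm h < r \<Longrightarrow> (\<integral>\<^sup>+x. ennreal (norm (f (x - h) - f x)) \<partial>lborel) \<le> ennreal (\<delta> / 2)"
    "\<And>h. norm h < s \<Longrightarrow> (\<integral>\<^sup>+x. ennreal (norm (g (x - h) - g x)) \<partial>lborel) \<le> ennreal (\<delta> / 2)"
    using add.IH(1)[of "\<delta> / 2"] add.IH(2)[of "\<delta> / 2"] add.prems by auto
  show ?case
  proof (intro exI[of _ "min r s"] conjI allI impI)
    fix h :: 'a assume h: "norm h < min r s"
    have "(\<integral>\<^sup>+x. ennreal (norm (f (x - h) + g (x - h) - (f x + g x))) \<partial>lborel)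
      \<le> (\<integral>\<^sup>+x. ennreal (norm (f (x - h) - f x)) + ennreal (norm (g (x - h) - g x)) \<partial>lborel)"
      by (intro nn_integral_mono) (auto simp flip: ennreal_plus intro!: ennreal_leI norm_diff_triangle_ineq)
    also have "\<dots> = (\<integral>\<^sup>+x. ennreal (norm (f (x - h) - f x)) \<partial>lborel) + (\<integral>\<^sup>+x. ennreal (norm (g (x - h) - g x)) \<partial>lborel)"
      by (rule nn_integral_add) measurable
    also have "\<dots> \<le> ennreal (\<delta> / 2) + ennreal (\<delta> / 2)"
      using h rs by (intro add_mono) auto
    finally show "(\<integral>\<^sup>+x. ennreal (norm (f (x - h) + g (x - h) - (f x + g x))) \<partial>lborel) \<le> ennreal \<delta>"
      using add.prems by (simp flip: ennreal_plus)
  qed (use rs in auto)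
next
  case (lim f s)
  have [measurable]: "f \<in> borel_measurable borel" "s i \<in> borel_measurable borel" for i using lim.hyps by auto
  have "(\<lambda>i. \<integral>\<^sup>+x. ennreal (norm (f x - s i x)) \<partial>lborel) \<longlonglongrightarrow> 0"
  proof (rule nn_integral_dominated_convergence_norm[where w="\<lambda>x. 2 * norm (f x)"])
    show "(\<integral>\<^sup>+x. ennreal (2 * norm (f x)) \<partial>lborel) < \<infinity>"
      using \<open>integrable lborel f\<close> by (simp add: integrable_iff_bounded ennreal_mult nn_integral_cmult ennreal_mult_less_top)
  qed (use lim.hyps in \<open>auto intro!: AE_I2 ennreal_leI\<close>)
  then have "eventually (\<lambda>i. (\<integral>\<^sup>+x. ennreal (norm (f x - s i x)) \<partial>lborel) < ennreal (\<delta> / 3)) sequentially"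
    by (rule order_tendstoD) (use lim.prems in simp)
  then obtain i where i: "(\<integral>\<^sup>+x. ennreal (norm (f x - s i x)) \<partial>lborel) < ennreal (\<delta> / 3)"
    by (auto simp: eventually_sequentially)
  obtain r where r: "r > 0"
    "\<And>h. norm h < r \<Longrightarrow> (\<integral>\<^sup>+x. ennreal (norm (s i (x - h) - s i x)) \<partial>lborel) \<le> ennreal (\<delta> / 3)"
    using lim.IH[of "\<delta> / 3" i] lim.prems by auto
  show ?case
  proof (intro exI[of _ r] conjI r(1) allI impI)
    fix h :: 'a assume h: "norm h < r"
    have "(\<integral>\<^sup>+x. ennreal (norm (f (x - h) - f x)) \<partial>lborel)
      \<le> (\<integral>\<^sup>+x. ennreal (norm (f (x - h) - s i (x - h))) + (ennreal (norm (s i (x - h) - s i x)) + ennreal (norm (f x - s i x))) \<partial>lborel)"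
    proof (intro nn_integral_mono)
      fix x
      have tri: "norm (a + (b + c)) \<le> norm a + (norm b + norm c)" for a b c :: 'b
        by (meson add_left_mono norm_triangle_ineq order_trans)
      have "norm (f (x - h) - f x) \<le> norm (f (x - h) - s i (x - h)) + (norm (s i (x - h) - s i x) + norm (f x - s i x))"
        using tri[of "f (x - h) - s i (x - h)" "s i (x - h) - s i x" "s i x - f x"]
        by (simp add: norm_minus_commute)
      then show "ennreal (norm (f (x - h) - f x))
        \<le> ennreal (norm (f (x - h) - s i (x - h))) + (ennreal (norm (s i (x - h) - s i x)) + ennreal (norm (f x - s i x)))"
        by (simp flip: ennreal_plus)
    qed
    also have "\<dots> = (\<integral>\<^sup>+x. ennreal (norm (f (x - h) - s i (x - h))) \<partial>lborel) +
      ((\<integral>\<^sup>+x. ennreal (norm (s i (x - h) - s i x)) \<partial>lborel) + (\<integral>\<^sup>+x. ennreal (norm (f x - s i x)) \<partial>lborel))"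
      by (subst nn_integral_add, measurable, subst nn_integral_add, measurable)
    also have "(\<integral>\<^sup>+x. ennreal (norm (f (x - h) - s i (x - h))) \<partial>lborel) = (\<integral>\<^sup>+x. ennreal (norm (f x - s i x)) \<partial>lborel)"
      by (rule nn_integral_translate) measurable
    also have "\<dots> + ((\<integral>\<^sup>+x. ennreal (norm (s i (x - h) - s i x)) \<partial>lborel) + \<dots>) \<le> ennreal (\<delta> / 3) + (ennreal (\<delta> / 3) + ennreal (\<delta> / 3))"
      by (intro add_mono r(2) h less_imp_le[OF i])
    finally show "(\<integral>\<^sup>+x. ennreal (norm (f (x - h) - f x)) \<partial>lborel) \<le> ennreal \<delta>"
      using lim.prems by (simp flip: ennreal_plus)
  qed
qed

text \<open>By Tonelli the error is an average, with the mollifier as weight, of the errors of translation by vectors that are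
shorter than \<open>\<epsilon>\<close>.\<close>

proposition moll_conv_tendsto_L1:
  fixes f :: "'a::euclidean_space \<Rightarrow> 'b::euclidean_space"
  assumes f: "integrable lborel f" and "0 < (\<delta>::real)"
  shows "\<exists>r>0. \<forall>\<epsilon>. 0 < \<epsilon> \<and> \<epsilon> < r \<longrightarrow> (\<integral>\<^sup>+x. ennreal (norm (conv (moll \<epsilon>) f x - f x)) \<partial>lborel) \<le> ennreal \<delta>"
proof -
  have [measurable]: "f \<in> borel_measurable borel" using f by auto
  obtain r where r: "r > 0"
    "\<And>h. norm h < r \<Longrightarrow> (\<integral>\<^sup>+x. ennreal (norm (f (x - h) - f x)) \<partial>lborel) \<le> ennreal \<delta>"
    using translation_continuous_L1[OF assms] by metis
  show ?thesis
  proof (intro exI[of _ r] conjI r(1) allI impI)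
    fix \<epsilon> assume \<epsilon>: "0 < \<epsilon> \<and> \<epsilon> < r"
    note [measurable] = moll_measurable[of \<epsilon>, where 'a='a]
    have [measurable]: "(moll \<epsilon> :: 'a \<Rightarrow> real) \<in> borel_measurable borel" using \<epsilon> by simp
    have "(\<integral>\<^sup>+x. ennreal (norm (conv (moll \<epsilon>) f x - f x)) \<partial>lborel)
      \<le> (\<integral>\<^sup>+x. \<integral>\<^sup>+y. ennreal (moll \<epsilon> y * norm (f (x - y) - f x)) \<partial>lborel \<partial>lborel)"
      by (intro nn_integral_mono moll_conv_minus f) (use \<epsilon> in simp)
    also have "\<dots> = (\<integral>\<^sup>+y. \<integral>\<^sup>+x. ennreal (moll \<epsilon> y * norm (f (x - y) - f x)) \<partial>lborel \<partial>lborel)"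
      by (rule lborel_pair.Fubini') measurable
    also have "\<dots> \<le> (\<integral>\<^sup>+(y::'a). ennreal (moll \<epsilon> y) * ennreal \<delta> \<partial>lborel)"
    proof (intro nn_integral_mono)
      fix y :: 'a
      have "(\<integral>\<^sup>+x. ennreal (moll \<epsilon> y * norm (f (x - y) - f x)) \<partial>lborel) = ennreal (moll \<epsilon> y) * (\<integral>\<^sup>+x. ennreal (norm (f (x - y) - f x)) \<partial>lborel)"
        using \<epsilon> by (simp add: ennreal_mult moll_nonneg nn_integral_cmult)
      also have "\<dots> \<le> ennreal (moll \<epsilon> y) * ennreal \<delta>"
        using \<epsilon> r(2)[of y] moll_eq_0[of \<epsilon> y] by (cases "norm y < \<epsilon>") (auto intro!: mult_left_mono)
      finally show "(\<integral>\<^sup>+x. ennreal (moll \<epsilon> y * norm (f (x - y) - f x)) \<partial>lborel) \<le> ennreal (moll \<epsilon> y) * ennreal \<delta>" .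
    qed
    also have "\<dots> = ennreal \<delta>"
      using \<epsilon> by (simp add: nn_integral_multc moll_integral)
    finally show "(\<integral>\<^sup>+x. ennreal (norm (conv (moll \<epsilon>) f x - f x)) \<partial>lborel) \<le> ennreal \<delta>" .
  qed
qed

section \<open>Exhaustion and cut-off functions\<close>

text \<open>The shift of the radius by one makes the first set empty, so that a partition of unity made of differences
of consecutive cut-off functions can start from the zero function.\<close>

definition exhaust :: "'a::euclidean_space set \<Rightarrow> nat \<Rightarrow> 'a set" where
  "exhaust \<Omega> n = {x. norm x \<le> real n - 1 \<and> (\<forall>y\<in>-\<Omega>. 1 / real (n + 1) \<le> dist x y)}"

lemma exhaust_compact: "compact (exhaust \<Omega> n)"
proof -
  have "exhaust \<Omega> n = cball 0 (real n - 1) \<inter> (\<Inter>y\<in>-\<Omega>. {x. 1 / real (n + 1) \<le> dist x y})"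
    by (auto simp: exhaust_def)
  moreover have "closed (\<Inter>y\<in>-\<Omega>. {x. 1 / real (n + 1) \<le> dist x y})"
    by (intro closed_INT ballI closed_Collect_le continuous_intros)
  ultimately show ?thesis by (simp add: compact_Int_closed)
qed

lemma exhaust_0: "exhaust \<Omega> 0 = {}"
proof -
  have "\<not> norm x \<le> real 0 - 1" for x :: 'a using norm_ge_zero[of x] by linarith
  then show ?thesis unfolding exhaust_def by blast
qed

lemma exhaust_subset: "exhaust \<Omega> n \<subseteq> \<Omega>"
  by (force simp: exhaust_def)

text \<open>The distance of the \<open>n\<close>-th set from the complement of the next one is at least \<open>1/(n+1) - 1/(n+2)\<close>.\<close>

definition exhaust_gap :: "nat \<Rightarrow> real" where
  "exhaust_gap n = 1 / (real (n + 1) * real (n + 2))"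

lemma exhaust_gap_pos: "0 < exhaust_gap n"
  by (simp add: exhaust_gap_def)

lemma exhaust_gap:
  assumes "x \<in> exhaust \<Omega> n" "dist x x' \<le> exhaust_gap n"
  shows "x' \<in> exhaust \<Omega> (Suc n)"
proof -
  have "exhaust_gap n \<le> 1" by (simp add: exhaust_gap_def divide_le_eq algebra_simps)
  then have "norm x' \<le> norm x + 1"
    using assms(2) norm_triangle_sub[of x' x] by (simp add: dist_norm norm_minus_commute)
  then have "norm x' \<le> real (Suc n) - 1" using assms(1) by (auto simp: exhaust_def)
  moreover have "1 / real (Suc n + 1) \<le> dist x' y" if "y \<in> - \<Omega>" for y
  proof -
    have "1 / real (n + 1) \<le> dist x y" using assms(1) that by (auto simp: exhaust_def)
    moreover have "dist x y \<le> dist x x' + dist x' y" by (rule dist_triangle)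
    moreover have "1 / real (n + 1) - exhaust_gap n = 1 / real (Suc n + 1)"
      by (simp add: exhaust_gap_def divide_simps)
    ultimately show ?thesis using assms(2) by linarith
  qed
  ultimately show ?thesis by (simp add: exhaust_def)
qed

lemma exhaust_mono: "m \<le> n \<Longrightarrow> exhaust \<Omega> m \<subseteq> exhaust \<Omega> n"
proof (induction rule: dec_induct)
  case (step k)
  moreover have "exhaust \<Omega> k \<subseteq> exhaust \<Omega> (Suc k)"
    using exhaust_gap[of _ \<Omega> k] less_imp_le[OF exhaust_gap_pos[of k]] by (metis dist_self subsetI)
  ultimately show ?case by blast
qed simp

lemma exhaust_covers:
  assumes "open \<Omega>" "x \<in> \<Omega>"
  obtains n where "x \<in> exhaust \<Omega> n"
proof -
  obtain e where e: "e > 0" "ball x e \<subseteq> \<Omega>" using assms openE by blast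
  obtain n1 where n1: "1 / e \<le> real n1" using real_arch_simple by blast
  obtain n2 where n2: "norm x + 1 \<le> real n2" using real_arch_simple by blast
  define n where "n = max n1 n2"
  have "1 / e \<le> real n" using n1 unfolding n_def by linarith
  then have "1 / e \<le> real (n + 1)" by simp
  then have "1 / real (n + 1) \<le> e" using e by (simp add: field_simps)
  moreover have "e \<le> dist x y" if "y \<in> - \<Omega>" for y using e that by (force simp: subset_iff)
  ultimately have "1 / real (n + 1) \<le> dist x y" if "y \<in> - \<Omega>" for y using that by (meson order_trans)
  moreover have "norm x \<le> real n - 1" using n2 unfolding n_def by linarith
  ultimately have "x \<in> exhaust \<Omega> n" by (simp add: exhaust_def)
  then show thesis by (rule that)
qed

lemma exhaust_nhd:
  assumes "open \<Omega>" "x \<in> \<Omega>"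
  obtains n where "x \<in> interior (exhaust \<Omega> n)"
proof -
  obtain n where n: "x \<in> exhaust \<Omega> n" using exhaust_covers[OF assms] by metis
  have "ball x (exhaust_gap n) \<subseteq> exhaust \<Omega> (Suc n)"
    using exhaust_gap[OF n] by auto
  then have "x \<in> interior (exhaust \<Omega> (Suc n))"
    using exhaust_gap_pos mem_interior by blast
  then show thesis by (rule that)
qed

text \<open>The mollified indicator of the \<open>\<delta>\<close>-neighbourhood of \<open>K\<close>.\<close>

lemma smooth_cutoff:
  fixes K :: "'a::euclidean_space set"
  assumes "compact K" "0 < \<delta>"
  obtains \<theta> where "smooth_on UNIV \<theta>" "\<And>x. x \<in> K \<Longrightarrow> \<theta> x = 1"
    "\<And>x. \<theta> x \<noteq> 0 \<Longrightarrow> \<exists>y\<in>K. dist y x < 2 * \<delta>"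
proof -
  define S where "S = (\<Union>z\<in>K. ball z \<delta>)"
  obtain R where R: "\<And>x. x \<in> K \<Longrightarrow> norm x \<le> R"
    using compact_imp_bounded[OF assms(1)] by (auto simp: bounded_iff)
  have "norm x \<le> R + \<delta>" if "x \<in> S" for x
  proof -
    obtain z where "z \<in> K" "dist z x < \<delta>" using \<open>x \<in> S\<close> by (auto simp: S_def)
    then show ?thesis using R[of z] norm_triangle_ineq2[of x z] by (simp add: dist_norm norm_minus_commute)
  qed
  then have S: "bounded S" "open S"
    by (blast intro: boundedI, auto simp: S_def)
  define f :: "'a \<Rightarrow> real" where "f = indicator S"
  have f: "integrable lborel f"
    unfolding f_def using S by (intro integrable_real_indicator emeasure_bounded_finite) auto
  show thesis
  proof
    show "smooth_on UNIV (conv (moll \<delta>) f)"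
      by (rule conv_smooth[OF moll_test_fun f]) (rule assms)
    show "conv (moll \<delta>) f x = 1" if "x \<in> K" for x
    proof -
      have "moll \<delta> (x - y) *\<^sub>R f y = moll \<delta> (x - y)" for y
      proof (cases "norm (x - y) < \<delta>")
        case True
        then have "y \<in> S" using that by (auto simp: S_def dist_norm)
        then show ?thesis by (simp add: f_def)
      qed (use moll_eq_0[OF assms(2), of "x - y"] in simp)
      then have "conv (moll \<delta>) f x = (\<integral>y. moll \<delta> (x - y) \<partial>lborel)"
        unfolding conv_def by (rule Bochner_Integration.integral_cong[OF refl])
      also have "\<dots> = 1"
        by (subst integral_reflect) (use assms in \<open>auto simp: moll_integral moll_measurable\<close>)
      finally show ?thesis .
    qed
    show "\<exists>y\<in>K. dist y x < 2 * \<delta>" if "conv (moll \<delta>) f x \<noteq> 0" for x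
    proof -
      have "\<exists>y. f y \<noteq> 0 \<and> moll \<delta> (x - y) \<noteq> 0"
      proof (rule ccontr)
        assume "\<nexists>y. f y \<noteq> 0 \<and> moll \<delta> (x - y) \<noteq> 0"
        then have "conv (moll \<delta>) f x = 0" by (intro conv_eq_0) blast
        then show False using that by simp
      qed
      then obtain y where "f y \<noteq> 0" "moll \<delta> (x - y) \<noteq> 0" by metis
      then obtain z where z: "z \<in> K" "dist z y < \<delta>" by (auto simp: f_def S_def indicator_def split: if_splits)
      moreover have "dist y x < \<delta>" using moll_eq_0[OF assms(2), of "x - y"] \<open>moll \<delta> (x - y) \<noteq> 0\<close>
        by (auto simp: dist_norm norm_minus_commute not_le[symmetric])
      ultimately show ?thesis using dist_triangle[of z x y] by force
    qed
  qed
qed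

lemma exhausting_cutoffs:
  fixes \<Omega> :: "'a::euclidean_space set"
  obtains \<theta> :: "nat \<Rightarrow> 'a \<Rightarrow> real" where "\<And>n. smooth_on UNIV (\<theta> n)"
    "\<And>n x. x \<in> exhaust \<Omega> n \<Longrightarrow> \<theta> n x = 1" "\<And>n x. x \<notin> exhaust \<Omega> (Suc n) \<Longrightarrow> \<theta> n x = 0"
    "\<And>x. \<theta> 0 x = 0"
proof -
  have "\<exists>\<theta>. smooth_on UNIV \<theta> \<and> (\<forall>x\<in>exhaust \<Omega> n. \<theta> x = 1) \<and> (\<forall>x. x \<notin> exhaust \<Omega> (Suc n) \<longrightarrow> \<theta> x = 0)
      \<and> (n = 0 \<longrightarrow> (\<forall>x. \<theta> x = 0))" for n
  proof (cases n)
    case 0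
    then show ?thesis by (intro exI[of _ "\<lambda>x. 0"]) (auto simp: smooth_on_def Ck_on_const exhaust_0)
  next
    case (Suc m)
    obtain \<theta> where \<theta>: "smooth_on UNIV \<theta>" "\<And>x. x \<in> exhaust \<Omega> n \<Longrightarrow> \<theta> x = 1"
      "\<And>x. \<theta> x \<noteq> 0 \<Longrightarrow> \<exists>y\<in>exhaust \<Omega> n. dist y x < 2 * (exhaust_gap n / 2)"
      using smooth_cutoff[OF exhaust_compact[of \<Omega> n], of "exhaust_gap n / 2"] exhaust_gap_pos[of n] by auto
    have "\<theta> x = 0" if "x \<notin> exhaust \<Omega> (Suc n)" for x
    proof (rule ccontr)
      assume "\<theta> x \<noteq> 0"
      then obtain y where "y \<in> exhaust \<Omega> n" "dist y x < exhaust_gap n" using \<theta>(3)[of x] by auto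
      then show False using exhaust_gap[of y \<Omega> n x] that by simp
    qed
    then show ?thesis using \<theta>(1,2) Suc by auto
  qed
  then obtain \<theta> where "\<forall>n. smooth_on UNIV (\<theta> n) \<and> (\<forall>x\<in>exhaust \<Omega> n. \<theta> n x = 1)
     \<and> (\<forall>x. x \<notin> exhaust \<Omega> (Suc n) \<longrightarrow> \<theta> n x = 0) \<and> (n = 0 \<longrightarrow> (\<forall>x. \<theta> n x = 0))"
    by metis
  then show thesis using that[of \<theta>] by auto
qed

section \<open>Weak gradients\<close>

text \<open>Near the origin, the convolution of \<open>w\<close> with the indicator of a ball that is much larger than the support is the
constant \<open>\<integral>w\<close>; its derivative there is the integral of the derivative of \<open>w\<close>.\<close>

lemma test_fun_integral_derivative:
  fixes w :: "'a::euclidean_space \<Rightarrow> real"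
  assumes w: "test_fun \<Omega> w"
  shows "(\<integral>x. frechet_derivative w (at x) v \<partial>lborel) = 0"
proof -
  have w': "test_fun UNIV w" using test_fun_mono[OF w] by simp
  obtain K where K: "compact K" "\<And>x. x \<notin> K \<Longrightarrow> w x = 0" "\<And>x v. x \<notin> K \<Longrightarrow> frechet_derivative w (at x) v = 0"
    using test_fun_support[OF w] by metis
  obtain R where R: "\<And>x. x \<in> K \<Longrightarrow> norm x \<le> R"
    using compact_imp_bounded[OF K(1)] by (auto simp: bounded_iff)
  define f :: "'a \<Rightarrow> real" where "f = indicator (ball 0 (R + 1))"
  have f: "integrable lborel f"
    unfolding f_def by (intro integrable_real_indicator emeasure_bounded_finite) auto
  have f1: "k (x - y) * f y = k (x - y)" if "norm x < 1" "\<And>x. x \<notin> K \<Longrightarrow> k x = 0" for x y and k :: "'a \<Rightarrow> real"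
  proof (cases "x - y \<in> K")
    case True
    then have "norm y < R + 1"
      using R[OF True] that(1) norm_triangle_ineq2[of y x] by (simp add: norm_minus_commute)
    then show ?thesis by (simp add: f_def)
  qed (simp add: that(2))
  have "conv w f x = (\<integral>y. w y \<partial>lborel)" if "norm x < 1" for x
  proof -
    have "(\<lambda>y. w (x - y) * f y) = (\<lambda>y. w (x - y))"
      by (rule ext, rule f1[OF that, of w]) (rule K(2))
    then show ?thesis
      using integral_reflect[OF test_fun_measurable[OF w], of x] by (simp add: conv_def)
  qed
  then have "((\<lambda>x. (\<integral>y. w y \<partial>lborel)) has_derivative (\<lambda>h. conv (\<lambda>z. frechet_derivative w (at z) h) f 0)) (at 0)"
    using has_derivative_transform_within_open[OF conv_has_derivative[OF w' f, of 0], of "ball 0 1"] by simp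
  then have "(\<lambda>h. conv (\<lambda>z. frechet_derivative w (at z) h) f 0) = (\<lambda>h. 0)"
    by (rule has_derivative_unique[OF _ has_derivative_const])
  then have "0 = conv (\<lambda>z. frechet_derivative w (at z) v) f 0" by metis
  also have "\<dots> = (\<integral>x. frechet_derivative w (at x) v \<partial>lborel)"
  proof -
    have "(\<lambda>y. frechet_derivative w (at (0 - y)) v * f y) = (\<lambda>y. frechet_derivative w (at (0 - y)) v)"
      by (rule ext, rule f1[of 0 "\<lambda>z. frechet_derivative w (at z) v"]) (simp_all add: K(3))
    then show ?thesis
      unfolding conv_def real_scaleR_def
      using integral_reflect[OF test_fun_measurable[OF test_fun_derivative[OF w]], of 0 v] by simp
  qed
  finally show ?thesis by simp
qed

lemma smooth_on_mult_test_fun: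
  assumes "open \<Omega>" "smooth_on \<Omega> v" "test_fun \<Omega> \<eta>"
  shows "test_fun \<Omega> (\<lambda>x. v x * \<eta> x)"
proof -
  obtain K where K: "compact K" "K \<subseteq> \<Omega>" "\<And>x. x \<notin> K \<Longrightarrow> \<eta> x = 0"
    using test_fun_support[OF assms(3)] by metis
  have "smooth_on UNIV (\<lambda>x. v x * \<eta> x)"
  proof (rule smooth_on_local)
    fix x
    show "\<exists>T. open T \<and> x \<in> T \<and> smooth_on T (\<lambda>x. v x * \<eta> x)"
    proof (cases "x \<in> \<Omega>")
      case True
      have "smooth_on \<Omega> \<eta>" using test_fun_smooth[OF assms(3)] smooth_on_subset by blast
      then show ?thesis using True assms smooth_on_mult by blast
    next
      case False
      have "smooth_on (- K) (\<lambda>x. v x * \<eta> x) = smooth_on (- K) (\<lambda>x. 0)"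
        using K by (intro smooth_on_cong) (auto intro: compact_imp_closed)
      then show ?thesis using False K
        by (intro exI[of _ "- K"]) (auto simp: smooth_on_def Ck_on_const intro: compact_imp_closed)
    qed
  qed
  then show ?thesis using K by (intro test_funI[of _ K]) auto
qed

definition grad :: "('a::euclidean_space \<Rightarrow> real) \<Rightarrow> 'a \<Rightarrow> 'a" where
  "grad f x = (\<Sum>i\<in>Basis. frechet_derivative f (at x) i *\<^sub>R i)"

lemma grad_inner: "i \<in> Basis \<Longrightarrow> grad f x \<bullet> i = frechet_derivative f (at x) i"
  by (simp add: grad_def inner_sum_left inner_Basis if_distrib sum.delta cong: if_cong)

lemma smooth_on_reflect:
  assumes "smooth_on UNIV (k :: 'a::euclidean_space \<Rightarrow> real)"
  shows "smooth_on UNIV (\<lambda>y. k (x - y))" "frechet_derivative (\<lambda>y. k (x - y)) (at y) v = - frechet_derivative k (at (x - y)) v"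
proof -
  have D: "((\<lambda>y. k (x - y)) has_derivative (\<lambda>h. - frechet_derivative k (at (x - y)) h)) (at y)"
    if "smooth_on UNIV k" for k :: "'a \<Rightarrow> real" and y
  proof -
    have d: "(k has_derivative frechet_derivative k (at (x - y))) (at (x - y))"
      using smooth_on_has_derivative[OF that] by simp
    have "((\<lambda>y. k (x - y)) has_derivative (\<lambda>h. frechet_derivative k (at (x - y)) (- h))) (at y)"
      by (rule has_derivative_compose[of "\<lambda>y. x - y" "\<lambda>h. - h" y UNIV k, OF _ d])
        (auto intro!: derivative_eq_intros)
    then show ?thesis by (simp add: linear_neg[OF has_derivative_linear[OF d]])
  qed
  show "frechet_derivative (\<lambda>y. k (x - y)) (at y) v = - frechet_derivative k (at (x - y)) v"
    using frechet_derivative_at[OF D[OF assms, of y]] by metis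
  have "Ck_on n UNIV (\<lambda>y. k (x - y))" for n
    using assms
  proof (induction n arbitrary: k)
    case 0
    then show ?case
      using D[OF 0] by (auto intro!: continuous_at_imp_continuous_on has_derivative_continuous)
  next
    case (Suc n)
    show ?case
    proof (rule Ck_on_Suc_I[OF open_UNIV D[OF Suc.prems]])
      fix v
      have "Ck_on n UNIV (\<lambda>y. (-1) * frechet_derivative k (at (x - y)) v)"
        by (intro Ck_on_cmult Suc.IH smooth_on_derivative Suc.prems) auto
      then show "Ck_on n UNIV (\<lambda>y. - frechet_derivative k (at (x - y)) v)" by simp
    qed
  qed
  then show "smooth_on UNIV (\<lambda>y. k (x - y))" by (simp add: smooth_on_def)
qed

text \<open>On an open set all representatives of a weak gradient may be taken Borel measurable, and
  integration may be carried out over the whole space, because test functions vanish off the set.\<close>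

definition borel_weak_gradient ::
  "'a::euclidean_space set \<Rightarrow> ('a \<Rightarrow> real) \<Rightarrow> ('a \<Rightarrow> 'a) \<Rightarrow> bool" where
  "borel_weak_gradient \<Omega> u g \<longleftrightarrow>
     u \<in> borel_measurable borel \<and> g \<in> borel_measurable borel \<and>
     (\<forall>K. compact K \<and> K \<subseteq> \<Omega> \<longrightarrow> integrable lborel (\<lambda>x. indicator K x *\<^sub>R u x) \<and>
        integrable lborel (\<lambda>x. indicator K x *\<^sub>R g x)) \<and>
     (\<forall>\<eta> i. test_fun \<Omega> \<eta> \<longrightarrow> i \<in> Basis \<longrightarrow>
        (\<integral>x. u x * frechet_derivative \<eta> (at x) i \<partial>lborel) = - (\<integral>x. (g x \<bullet> i) * \<eta> x \<partial>lborel))"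

lemma borel_weak_gradient_parts:
  assumes "borel_weak_gradient \<Omega> u g" "test_fun \<Omega> \<eta>" "i \<in> Basis"
  shows "(\<integral>x. u x * frechet_derivative \<eta> (at x) i \<partial>lborel) = - (\<integral>x. (g x \<bullet> i) * \<eta> x \<partial>lborel)"
  using assms unfolding borel_weak_gradient_def by simp

lemma measurable_lebesgue_cong_AE:
  fixes f g :: "'a::euclidean_space \<Rightarrow> 'b::topological_space"
  assumes g: "g \<in> borel_measurable lebesgue" and ae: "AE x in lebesgue. f x = g x"
  shows "f \<in> borel_measurable lebesgue"
proof (rule measurableI)
  fix A :: "'b set" assume A: "A \<in> sets borel"
  show "f -` A \<inter> space lebesgue \<in> sets lebesgue"
  proof (rule completion.in_sets_AE)
    show "AE x in lebesgue. x \<in> g -` A \<inter> space lebesgue \<longleftrightarrow> x \<in> f -` A \<inter> space lebesgue"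
      using ae by eventually_elim auto
    show "g -` A \<inter> space lebesgue \<in> sets lebesgue" using g A by (rule measurable_sets)
  qed auto
qed auto

lemma integrable_cong_borel_AE:
  fixes f f' :: "'a::euclidean_space \<Rightarrow> 'b::euclidean_space"
  assumes "f' \<in> borel_measurable borel" "AE x in lborel. f x = f' x"
  shows "integrable lebesgue f \<longleftrightarrow> integrable lborel f'" "integral\<^sup>L lebesgue f = integral\<^sup>L lborel f'"
proof -
  have ae: "AE x in lebesgue. f x = f' x" using assms(2) by (simp add: AE_completion_iff)
  have f': "f' \<in> borel_measurable lebesgue"
    using assms(1) by (simp add: measurable_completion)
  have f: "f \<in> borel_measurable lebesgue"
    using f' ae by (rule measurable_lebesgue_cong_AE)
  show "integrable lebesgue f \<longleftrightarrow> integrable lborel f'" "integral\<^sup>L lebesgue f = integral\<^sup>L lborel f'"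
    using integrable_cong_AE[OF f f' ae] integral_cong_AE[OF f f' ae] assms(1)
    by (simp_all add: integrable_completion integral_completion)
qed

text \<open>Locally integrable functions are Lebesgue measurable only. Passing to Borel representatives makes
product measurability, and with it convolution, available.\<close>

lemma has_weak_gradient_iff_borel:
  fixes \<Omega> :: "'a::euclidean_space set"
  assumes \<Omega>: "open \<Omega>" and [measurable]: "u' \<in> borel_measurable borel" "g' \<in> borel_measurable borel"
    and ae: "AE x in lborel. x \<in> \<Omega> \<longrightarrow> u x = u' x \<and> g x = g' x"
  shows "has_weak_gradient \<Omega> u g \<longleftrightarrow> borel_weak_gradient \<Omega> u' g'"
proof -
  have K: "u absolutely_integrable_on K \<longleftrightarrow> integrable lborel (\<lambda>x. indicator K x *\<^sub>R u' x)"
    "g absolutely_integrable_on K \<longleftrightarrow> integrable lborel (\<lambda>x. indicator K x *\<^sub>R g' x)"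
    if "compact K" "K \<subseteq> \<Omega>" for K
  proof -
    have [measurable]: "K \<in> sets borel" using that by (simp add: borel_compact)
    show "u absolutely_integrable_on K \<longleftrightarrow> integrable lborel (\<lambda>x. indicator K x *\<^sub>R u' x)"
      unfolding set_integrable_def
      by (rule integrable_cong_borel_AE) (measurable, use ae that in \<open>auto simp: indicator_def\<close>)
    show "g absolutely_integrable_on K \<longleftrightarrow> integrable lborel (\<lambda>x. indicator K x *\<^sub>R g' x)"
      unfolding set_integrable_def
      by (rule integrable_cong_borel_AE) (measurable, use ae that in \<open>auto simp: indicator_def\<close>)
  qed
  have I: "(LINT x|lebesgue_on \<Omega>. u x * frechet_derivative \<eta> (at x) i) = (\<integral>x. u' x * frechet_derivative \<eta> (at x) i \<partial>lborel)"
    "(LINT x|lebesgue_on \<Omega>. (g x \<bullet> i) * \<eta> x) = (\<integral>x. (g' x \<bullet> i) * \<eta> x \<partial>lborel)"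
    if \<eta>: "test_fun \<Omega> \<eta>" for \<eta> i
  proof -
    note [measurable] = test_fun_measurable[OF \<eta>] test_fun_measurable[OF test_fun_derivative[OF \<eta>]]
    obtain K where K: "K \<subseteq> \<Omega>" "\<And>x. x \<notin> K \<Longrightarrow> \<eta> x = 0" "\<And>x v. x \<notin> K \<Longrightarrow> frechet_derivative \<eta> (at x) v = 0"
      using test_fun_support[OF \<eta>] by metis
    then have 0: "x \<notin> \<Omega> \<Longrightarrow> \<eta> x = 0 \<and> frechet_derivative \<eta> (at x) i = 0" for x by blast
    have ae1: "AE x in lborel. indicator \<Omega> x *\<^sub>R (u x * frechet_derivative \<eta> (at x) i) = u' x * frechet_derivative \<eta> (at x) i"
      using ae
    proof eventually_elim
      case (elim x)
      then show ?case using 0[of x] by (cases "x \<in> \<Omega>") auto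
    qed
    have ae2: "AE x in lborel. indicator \<Omega> x *\<^sub>R ((g x \<bullet> i) * \<eta> x) = (g' x \<bullet> i) * \<eta> x"
      using ae
    proof eventually_elim
      case (elim x)
      then show ?case using 0[of x] by (cases "x \<in> \<Omega>") auto
    qed
    show "(LINT x|lebesgue_on \<Omega>. u x * frechet_derivative \<eta> (at x) i) = (\<integral>x. u' x * frechet_derivative \<eta> (at x) i \<partial>lborel)"
      using \<Omega> by (subst integral_restrict_space, simp) (rule integrable_cong_borel_AE(2)[OF _ ae1], measurable)
    show "(LINT x|lebesgue_on \<Omega>. (g x \<bullet> i) * \<eta> x) = (\<integral>x. (g' x \<bullet> i) * \<eta> x \<partial>lborel)"
      using \<Omega> by (subst integral_restrict_space, simp) (rule integrable_cong_borel_AE(2)[OF _ ae2], measurable)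
  qed
  show ?thesis
    unfolding has_weak_gradient_def borel_weak_gradient_def locally_integrable_on_def
    using K I by (auto simp: Ball_def)
qed

lemma locally_integrable_borel_version:
  fixes f :: "'a::euclidean_space \<Rightarrow> 'b::euclidean_space"
  assumes \<Omega>: "open \<Omega>" and f: "locally_integrable_on f \<Omega>"
  obtains f' where "f' \<in> borel_measurable borel" "AE x in lborel. x \<in> \<Omega> \<longrightarrow> f x = f' x"
proof -
  let ?F = "\<lambda>x. indicator \<Omega> x *\<^sub>R f x"
  have "?F \<in> borel_measurable lebesgue"
  proof (rule borel_measurable_LIMSEQ_metric)
    show "(\<lambda>x. indicator (exhaust \<Omega> n) x *\<^sub>R f x) \<in> borel_measurable lebesgue" for n
    proof -
      have "f absolutely_integrable_on exhaust \<Omega> n"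
        using f exhaust_compact[of \<Omega> n] exhaust_subset[of \<Omega> n] by (simp add: locally_integrable_on_def)
      then show ?thesis unfolding set_integrable_def by (rule borel_measurable_integrable)
    qed
    show "(\<lambda>n. indicator (exhaust \<Omega> n) x *\<^sub>R f x) \<longlonglongrightarrow> ?F x" for x
    proof (cases "x \<in> \<Omega>")
      case True
      then obtain n where "x \<in> exhaust \<Omega> n" using exhaust_covers[OF \<Omega>] by metis
      then have "\<forall>m\<ge>n. indicator (exhaust \<Omega> m) x *\<^sub>R f x = ?F x"
        using True exhaust_mono[of n _ \<Omega>] by (auto simp: indicator_def subset_iff)
      then show ?thesis by (intro tendsto_eventually) (unfold eventually_sequentially, blast)
    next
      case False
      then have "x \<notin> exhaust \<Omega> n" for n using exhaust_subset by blast
      then show ?thesis using False by simp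
    qed
  qed
  then have "\<exists>h\<in>borel_measurable lborel. AE x in lborel. ?F x \<bullet> i = h x" for i
    by (intro completion_ex_borel_measurable_real borel_measurable_inner) auto
  then obtain h where h: "\<And>i. h i \<in> borel_measurable lborel" "\<And>i. AE x in lborel. ?F x \<bullet> i = h i x" by metis
  have "AE x in lborel. \<forall>i\<in>Basis. ?F x \<bullet> i = h i x"
    using h(2) by (intro AE_finite_allI) auto
  then have "AE x in lborel. x \<in> \<Omega> \<longrightarrow> f x = (\<Sum>i\<in>Basis. h i x *\<^sub>R i)"
  proof eventually_elim
    case (elim x)
    show ?case
    proof
      assume x: "x \<in> \<Omega>"
      then have "(\<Sum>i\<in>Basis. h i x *\<^sub>R i) = (\<Sum>i\<in>Basis. (f x \<bullet> i) *\<^sub>R i)"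
        using elim by (intro sum.cong) auto
      then show "f x = (\<Sum>i\<in>Basis. h i x *\<^sub>R i)" by (simp add: euclidean_representation)
    qed
  qed
  moreover have "(\<lambda>x. \<Sum>i\<in>Basis. h i x *\<^sub>R i) \<in> borel_measurable borel"
    using h(1) by (intro borel_measurable_sum borel_measurable_scaleR) auto
  ultimately show thesis using that by blast
qed

lemma integrable_bounded_scaleR:
  fixes f :: "'a \<Rightarrow> 'b::euclidean_space"
  assumes f: "integrable M f" and b: "b \<in> borel_measurable M" "\<And>x. \<bar>b x\<bar> \<le> B"
  shows "integrable M (\<lambda>x. b x *\<^sub>R f x)"
proof -
  have "norm (b x *\<^sub>R f x) \<le> norm (B * norm (f x))" for x
  proof -
    have "0 \<le> B" using b(2)[of x] by simp
    then show ?thesis using mult_right_mono[OF b(2), of "norm (f x)" x] by simp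
  qed
  moreover have "integrable M (\<lambda>x. B * norm (f x))" using f by simp
  moreover have "(\<lambda>x. b x *\<^sub>R f x) \<in> borel_measurable M" using f b by measurable
  ultimately show ?thesis
    by (blast intro: Bochner_Integration.integrable_bound AE_I2)
qed

lemma borel_weak_gradient_integrable:
  assumes w: "borel_weak_gradient \<Omega> u g" and \<tau>: "test_fun \<Omega> \<tau>"
  shows "integrable lborel (\<lambda>x. \<tau> x *\<^sub>R u x)" "integrable lborel (\<lambda>x. \<tau> x *\<^sub>R g x)"
proof -
  obtain K where K: "compact K" "K \<subseteq> \<Omega>" "\<And>x. x \<notin> K \<Longrightarrow> \<tau> x = 0"
    using test_fun_support[OF \<tau>] by metis
  obtain B where B: "\<And>x. \<bar>\<tau> x\<bar> \<le> B" using test_fun_bounded[OF \<tau>] by metis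
  have m: "\<tau> \<in> borel_measurable lborel" using test_fun_measurable[OF \<tau>] by simp
  have eq: "(\<lambda>x. \<tau> x *\<^sub>R f x) = (\<lambda>x. \<tau> x *\<^sub>R (indicator K x *\<^sub>R f x))" for f :: "'a \<Rightarrow> 'b::euclidean_space"
  proof
    show "\<tau> x *\<^sub>R f x = \<tau> x *\<^sub>R (indicator K x *\<^sub>R f x)" for x
      using K(3)[of x] by (cases "x \<in> K") simp_all
  qed
  have i: "integrable lborel (\<lambda>x. indicator K x *\<^sub>R u x)" "integrable lborel (\<lambda>x. indicator K x *\<^sub>R g x)"
    using w K(1,2) unfolding borel_weak_gradient_def by blast+
  show "integrable lborel (\<lambda>x. \<tau> x *\<^sub>R u x)" "integrable lborel (\<lambda>x. \<tau> x *\<^sub>R g x)"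
    by (subst eq, rule integrable_bounded_scaleR[OF i(1) m B])
      (subst eq, rule integrable_bounded_scaleR[OF i(2) m B])
qed

lemma test_fun_integrable:
  assumes "test_fun \<Omega> \<eta>"
  shows "integrable lborel \<eta>"
proof -
  obtain K where K: "compact K" "\<And>x. x \<notin> K \<Longrightarrow> \<eta> x = 0"
    using test_fun_support[OF assms] by metis
  have "indicator K x *\<^sub>R \<eta> x = \<eta> x" for x using K(2)[of x] by (cases "x \<in> K") simp_all
  then show ?thesis
    using borel_integrable_compact[OF K(1) test_fun_continuous[OF assms]] by (simp only:)
qed

text \<open>The product of \<open>v\<close> with a test function is again a test function on the whole space, whatever \<open>v\<close> does outside
the open set; its partial derivatives integrate to zero.\<close>

lemma smooth_borel_weak_gradient:
  fixes \<Omega> :: "'a::euclidean_space set"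
  assumes \<Omega>: "open \<Omega>" and v: "smooth_on \<Omega> v"
  shows "borel_weak_gradient \<Omega> (\<lambda>x. indicator \<Omega> x *\<^sub>R v x) (\<lambda>x. indicator \<Omega> x *\<^sub>R grad v x)"
proof -
  have c: "continuous_on \<Omega> v" "continuous_on \<Omega> (grad v)"
    unfolding grad_def using v smooth_on_derivative[OF v]
    by (auto intro!: smooth_on_continuous continuous_intros)
  have m: "(\<lambda>x. indicator \<Omega> x *\<^sub>R v x) \<in> borel_measurable borel" "(\<lambda>x. indicator \<Omega> x *\<^sub>R grad v x) \<in> borel_measurable borel"
    by (rule borel_measurable_continuous_on_indicator[OF borel_open[OF \<Omega>]], rule c)+
  have K: "integrable lborel (\<lambda>x. indicator K x *\<^sub>R indicator \<Omega> x *\<^sub>R f x)"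
    if "compact K" "K \<subseteq> \<Omega>" "continuous_on \<Omega> f" for K and f :: "'a \<Rightarrow> 'b::euclidean_space"
  proof -
    have "indicator K x *\<^sub>R indicator \<Omega> x *\<^sub>R f x = indicator K x *\<^sub>R f x" for x
      using that(2) by (cases "x \<in> K") auto
    then show ?thesis
      using borel_integrable_compact[OF that(1) continuous_on_subset[OF that(3,2)]] by (simp only:)
  qed
  have I: "(\<integral>x. (indicator \<Omega> x *\<^sub>R v x) * frechet_derivative \<eta> (at x) i \<partial>lborel) = - (\<integral>x. ((indicator \<Omega> x *\<^sub>R grad v x) \<bullet> i) * \<eta> x \<partial>lborel)"
    if \<eta>: "test_fun \<Omega> \<eta>" and i: "i \<in> Basis" for \<eta> i
  proof -
    obtain K where K: "K \<subseteq> \<Omega>" "\<And>x. x \<notin> K \<Longrightarrow> \<eta> x = 0" "\<And>x v. x \<notin> K \<Longrightarrow> frechet_derivative \<eta> (at x) v = 0"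
      using test_fun_support[OF \<eta>] by metis
    then have 0: "x \<notin> \<Omega> \<Longrightarrow> \<eta> x = 0 \<and> frechet_derivative \<eta> (at x) i = 0" for x by blast
    have w: "test_fun \<Omega> (\<lambda>x. v x * \<eta> x)" by (rule smooth_on_mult_test_fun[OF \<Omega> v \<eta>])
    have t: "test_fun \<Omega> (\<lambda>x. v x * frechet_derivative \<eta> (at x) i)" "test_fun \<Omega> (\<lambda>x. frechet_derivative v (at x) i * \<eta> x)"
      by (rule smooth_on_mult_test_fun[OF \<Omega> v test_fun_derivative[OF \<eta>]])
        (rule smooth_on_mult_test_fun[OF \<Omega> smooth_on_derivative[OF v] \<eta>])
    have "frechet_derivative (\<lambda>x. v x * \<eta> x) (at x) i = v x * frechet_derivative \<eta> (at x) i + frechet_derivative v (at x) i * \<eta> x" for x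
    proof (cases "x \<in> \<Omega>")
      case True
      show ?thesis
        using frechet_derivative_at[OF has_derivative_mult[OF smooth_on_has_derivative[OF v True] test_fun_has_derivative[OF \<eta>]]]
        by metis
    next
      case False
      obtain L where L: "L \<subseteq> \<Omega>" "\<And>x i. x \<notin> L \<Longrightarrow> frechet_derivative (\<lambda>x. v x * \<eta> x) (at x) i = 0"
        using test_fun_support[OF w] by metis
      then show ?thesis using False 0[OF False] by auto
    qed
    then have "0 = (\<integral>x. v x * frechet_derivative \<eta> (at x) i + frechet_derivative v (at x) i * \<eta> x \<partial>lborel)"
      using test_fun_integral_derivative[OF w, of i] by simp
    also have "\<dots> = (\<integral>x. v x * frechet_derivative \<eta> (at x) i \<partial>lborel) + (\<integral>x. frechet_derivative v (at x) i * \<eta> x \<partial>lborel)"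
      by (intro Bochner_Integration.integral_add test_fun_integrable[OF t(1)] test_fun_integrable[OF t(2)])
    also have "(\<lambda>x. v x * frechet_derivative \<eta> (at x) i) = (\<lambda>x. (indicator \<Omega> x *\<^sub>R v x) * frechet_derivative \<eta> (at x) i)"
      by (rule ext, rename_tac x, case_tac "x \<in> \<Omega>") (simp_all add: 0)
    also have "(\<lambda>x. frechet_derivative v (at x) i * \<eta> x) = (\<lambda>x. ((indicator \<Omega> x *\<^sub>R grad v x) \<bullet> i) * \<eta> x)"
      by (rule ext, rename_tac x, case_tac "x \<in> \<Omega>") (simp_all add: 0 grad_inner[OF i])
    finally show ?thesis by simp
  qed
  show ?thesis unfolding borel_weak_gradient_def
    using m K[OF _ _ c(1)] K[OF _ _ c(2)] I by blast
qed

text \<open>A piece of the partition of unity may be tested against every smooth function \<open>\<eta>\<close>, because \<open>\<eta> \<zeta>\<close> is a test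
function for \<open>u\<close>; the product rule produces the second term of \<open>G\<close>.\<close>

lemma borel_weak_gradient_cutoff:
  fixes \<Omega> :: "'a::euclidean_space set"
  assumes w: "borel_weak_gradient \<Omega> u g" and \<zeta>: "test_fun \<Omega> \<zeta>"
  defines "F \<equiv> \<lambda>x. \<zeta> x * u x" and "G \<equiv> \<lambda>x. \<zeta> x *\<^sub>R g x + u x *\<^sub>R grad \<zeta> x"
  shows "integrable lborel F" "integrable lborel G"
    "\<And>\<eta> i. smooth_on UNIV \<eta> \<Longrightarrow> i \<in> Basis \<Longrightarrow>
      (\<integral>x. F x * frechet_derivative \<eta> (at x) i \<partial>lborel) = - (\<integral>x. (G x \<bullet> i) * \<eta> x \<partial>lborel)"
proof -
  note int = borel_weak_gradient_integrable[OF w]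
  show "integrable lborel F" using int(1)[OF \<zeta>] by (simp add: F_def)
  have "integrable lborel (\<lambda>x. \<Sum>i\<in>Basis. (frechet_derivative \<zeta> (at x) i *\<^sub>R u x) *\<^sub>R i)"
    by (intro Bochner_Integration.integrable_sum integrable_scaleR_left int(1) test_fun_derivative \<zeta>)
  moreover have "(\<lambda>x. \<Sum>i\<in>Basis. (frechet_derivative \<zeta> (at x) i *\<^sub>R u x) *\<^sub>R i) = (\<lambda>x. u x *\<^sub>R grad \<zeta> x)"
    by (auto simp: grad_def scaleR_sum_right mult.commute)
  ultimately show "integrable lborel G"
    unfolding G_def using int(2)[OF \<zeta>] by simp
  fix \<eta> :: "'a \<Rightarrow> real" and i :: 'a assume \<eta>: "smooth_on UNIV \<eta>" and i: "i \<in> Basis"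
  note D\<eta> = smooth_on_derivative[OF \<eta>, of i] and D\<zeta> = test_fun_derivative[OF \<zeta>, of i]
  have t: "test_fun \<Omega> (\<lambda>x. \<eta> x * \<zeta> x)" by (rule test_fun_mult[OF \<zeta> \<eta>])
  have t1: "test_fun \<Omega> (\<lambda>x. frechet_derivative \<eta> (at x) i * \<zeta> x)" by (rule test_fun_mult[OF \<zeta> D\<eta>])
  have t2: "test_fun \<Omega> (\<lambda>x. \<eta> x * frechet_derivative \<zeta> (at x) i)" by (rule test_fun_mult[OF D\<zeta> \<eta>])
  have d: "frechet_derivative (\<lambda>x. \<eta> x * \<zeta> x) (at x) i = \<eta> x * frechet_derivative \<zeta> (at x) i + frechet_derivative \<eta> (at x) i * \<zeta> x" for x
    using frechet_derivative_at[OF has_derivative_mult[OF smooth_on_has_derivative[OF \<eta> UNIV_I] test_fun_has_derivative[OF \<zeta>]]]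
    by metis
  have "(\<integral>x. F x * frechet_derivative \<eta> (at x) i \<partial>lborel)
    = (\<integral>x. u x * frechet_derivative (\<lambda>x. \<eta> x * \<zeta> x) (at x) i - (\<eta> x * frechet_derivative \<zeta> (at x) i) *\<^sub>R u x \<partial>lborel)"
    unfolding d by (intro Bochner_Integration.integral_cong) (auto simp: F_def algebra_simps)
  also have "\<dots> = (\<integral>x. u x * frechet_derivative (\<lambda>x. \<eta> x * \<zeta> x) (at x) i \<partial>lborel) - (\<integral>x. (\<eta> x * frechet_derivative \<zeta> (at x) i) *\<^sub>R u x \<partial>lborel)"
    using int(1)[OF test_fun_derivative[OF t], of i]
    by (intro Bochner_Integration.integral_diff int(1) t2) (simp add: mult.commute)
  also have "(\<integral>x. u x * frechet_derivative (\<lambda>x. \<eta> x * \<zeta> x) (at x) i \<partial>lborel) = - (\<integral>x. (g x \<bullet> i) * (\<eta> x * \<zeta> x) \<partial>lborel)"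
    using w t i by (simp add: borel_weak_gradient_def)
  also have "- (\<integral>x. (g x \<bullet> i) * (\<eta> x * \<zeta> x) \<partial>lborel) - (\<integral>x. (\<eta> x * frechet_derivative \<zeta> (at x) i) *\<^sub>R u x \<partial>lborel)
    = - ((\<integral>x. ((\<eta> x * \<zeta> x) *\<^sub>R g x) \<bullet> i \<partial>lborel) + (\<integral>x. (\<eta> x * frechet_derivative \<zeta> (at x) i) *\<^sub>R u x \<partial>lborel))"
    by (simp add: mult.commute)
  also have "\<dots> = - (\<integral>x. ((\<eta> x * \<zeta> x) *\<^sub>R g x) \<bullet> i + (\<eta> x * frechet_derivative \<zeta> (at x) i) *\<^sub>R u x \<partial>lborel)"
    by (subst Bochner_Integration.integral_add[OF integrable_inner_left[OF int(2)[OF t]] int(1)[OF t2]]) simp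
  also have "\<dots> = - (\<integral>x. (G x \<bullet> i) * \<eta> x \<partial>lborel)"
    using i by (intro arg_cong[where f=uminus] Bochner_Integration.integral_cong)
      (auto simp: G_def inner_add_left grad_inner algebra_simps)
  finally show "(\<integral>x. F x * frechet_derivative \<eta> (at x) i \<partial>lborel) = - (\<integral>x. (G x \<bullet> i) * \<eta> x \<partial>lborel)" .
qed

text \<open>Testing with the reflected kernel \<open>y \<mapsto> k(x - y)\<close> moves the derivative from the kernel to \<open>F\<close>.\<close>

lemma grad_conv:
  fixes F :: "'a::euclidean_space \<Rightarrow> real"
  assumes k: "test_fun \<Omega> k" and F: "integrable lborel F" and G: "integrable lborel G"
    and parts: "\<And>\<eta> i. smooth_on UNIV \<eta> \<Longrightarrow> i \<in> Basis \<Longrightarrow>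
      (\<integral>x. F x * frechet_derivative \<eta> (at x) i \<partial>lborel) = - (\<integral>x. (G x \<bullet> i) * \<eta> x \<partial>lborel)"
  shows "grad (conv k F) x = conv k G x"
proof (rule euclidean_eqI)
  fix i :: 'a assume i: "i \<in> Basis"
  note r = smooth_on_reflect[OF test_fun_smooth[OF k], of x]
  have "grad (conv k F) x \<bullet> i = conv (\<lambda>z. frechet_derivative k (at z) i) F x"
    using frechet_derivative_at[OF conv_has_derivative[OF k F, of x]] grad_inner[OF i] by metis
  also have "\<dots> = - (\<integral>y. F y * frechet_derivative (\<lambda>y. k (x - y)) (at y) i \<partial>lborel)"
    by (simp add: conv_def r(2) mult.commute)
  also have "\<dots> = (\<integral>y. (G y \<bullet> i) * k (x - y) \<partial>lborel)"
    using parts[OF r(1) i] by simp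
  also have "\<dots> = (\<integral>y. (k (x - y) *\<^sub>R G y) \<bullet> i \<partial>lborel)" by (simp add: mult.commute)
  also have "\<dots> = conv k G x \<bullet> i"
    unfolding conv_def by (rule integral_inner_left[OF conv_integrable[OF k G]])
  finally show "grad (conv k F) x \<bullet> i = conv k G x \<bullet> i" .
qed

text \<open>The fundamental lemma of the calculus of variations: a locally integrable function that is
  orthogonal to all test functions has vanishing mollifications after cutting off.\<close>

lemma orthogonal_test_funs_imp_zero:
  fixes f :: "'a::euclidean_space \<Rightarrow> real"
  assumes \<Omega>: "open \<Omega>" and [measurable]: "f \<in> borel_measurable borel"
    and int: "\<And>\<eta>. test_fun \<Omega> \<eta> \<Longrightarrow> integrable lborel (\<lambda>x. \<eta> x * f x)"
    and 0: "\<And>\<eta>. test_fun \<Omega> \<eta> \<Longrightarrow> (\<integral>x. f x * \<eta> x \<partial>lborel) = 0"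
  shows "AE x in lborel. x \<in> \<Omega> \<longrightarrow> f x = 0"
proof -
  obtain \<theta> :: "nat \<Rightarrow> 'a \<Rightarrow> real" where \<theta>: "\<And>n. smooth_on UNIV (\<theta> n)"
    "\<And>n x. x \<in> exhaust \<Omega> n \<Longrightarrow> \<theta> n x = 1" "\<And>n x. x \<notin> exhaust \<Omega> (Suc n) \<Longrightarrow> \<theta> n x = 0"
    using exhausting_cutoffs[of \<Omega>] by metis
  have t: "test_fun \<Omega> (\<theta> n)" for n
    using \<theta>(1,3) by (intro test_funI[OF _ exhaust_compact[of \<Omega> "Suc n"] exhaust_subset]) auto
  have "AE x in lborel. \<theta> n x * f x = 0" for n
  proof -
    let ?h = "\<lambda>x. \<theta> n x * f x"
    have h: "integrable lborel ?h" by (rule int[OF t])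
    have [measurable]: "\<theta> n \<in> borel_measurable borel" by (rule test_fun_measurable[OF t])
    have z: "conv (moll \<epsilon>) ?h x = 0" if "0 < \<epsilon>" for \<epsilon> x
    proof -
      have "test_fun \<Omega> (\<lambda>y. moll \<epsilon> (x - y) * \<theta> n y)"
        by (intro test_fun_mult t smooth_on_reflect(1) test_fun_smooth[OF moll_test_fun[OF that]])
      from 0[OF this] show ?thesis by (simp add: conv_def mult_ac)
    qed
    have small: "(\<integral>\<^sup>+x. ennreal (norm (?h x)) \<partial>lborel) \<le> ennreal \<delta>" if \<delta>: "0 < \<delta>" for \<delta> :: real
    proof -
      obtain r where "r > 0" and r: "\<And>\<epsilon>. 0 < \<epsilon> \<and> \<epsilon> < r \<Longrightarrow> (\<integral>\<^sup>+x. ennreal (norm (conv (moll \<epsilon>) ?h x - ?h x)) \<partial>lborel) \<le> ennreal \<delta>"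
        using moll_conv_tendsto_L1[OF h \<delta>] by metis
      then show ?thesis using r[of "r / 2"] z[of "r / 2"] by simp
    qed
    have "(\<integral>\<^sup>+x. ennreal (norm (?h x)) \<partial>lborel) \<le> 0"
      by (rule ennreal_le_epsilon) (unfold add_0_left, rule small)
    then have "(\<integral>\<^sup>+x. ennreal (norm (?h x)) \<partial>lborel) = 0" by (rule antisym) (rule zero_le)
    then have "AE x in lborel. ennreal (norm (?h x)) = 0"
      by (subst (asm) nn_integral_0_iff_AE) auto
    then show ?thesis by eventually_elim simp
  qed
  then have "AE x in lborel. \<forall>n. \<theta> n x * f x = 0"
    by (subst AE_all_countable) (rule allI)
  then show ?thesis
  proof eventually_elim
    case (elim x)
    show ?case
    proof
      assume "x \<in> \<Omega>"
      then obtain n where "x \<in> exhaust \<Omega> n" using exhaust_covers[OF \<Omega>] by metis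
      then show "f x = 0" using elim[rule_format, of n] \<theta>(2) by simp
    qed
  qed
qed

lemma borel_weak_gradient_unique:
  fixes \<Omega> :: "'a::euclidean_space set"
  assumes \<Omega>: "open \<Omega>" and 1: "borel_weak_gradient \<Omega> u g" and 2: "borel_weak_gradient \<Omega> u g'"
  shows "AE x in lborel. x \<in> \<Omega> \<longrightarrow> g x = g' x"
proof -
  have [measurable]: "g \<in> borel_measurable borel" "g' \<in> borel_measurable borel"
    using 1 2 by (auto simp: borel_weak_gradient_def)
  have "AE x in lborel. x \<in> \<Omega> \<longrightarrow> (g x - g' x) \<bullet> i = 0" if i: "i \<in> Basis" for i
  proof (rule orthogonal_test_funs_imp_zero[OF \<Omega>])
    fix \<eta> assume \<eta>: "test_fun \<Omega> \<eta>"
    note int = borel_weak_gradient_integrable(2)[OF 1 \<eta>] borel_weak_gradient_integrable(2)[OF 2 \<eta>]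
    have e: "(\<lambda>x. \<eta> x * ((g x - g' x) \<bullet> i)) = (\<lambda>x. (\<eta> x *\<^sub>R g x) \<bullet> i - (\<eta> x *\<^sub>R g' x) \<bullet> i)"
      by (auto simp: inner_diff_left algebra_simps)
    show "integrable lborel (\<lambda>x. \<eta> x * ((g x - g' x) \<bullet> i))"
      unfolding e by (intro Bochner_Integration.integrable_diff integrable_inner_left int)
    have "(\<integral>x. (g x - g' x) \<bullet> i * \<eta> x \<partial>lborel) = (\<integral>x. (\<eta> x *\<^sub>R g x) \<bullet> i - (\<eta> x *\<^sub>R g' x) \<bullet> i \<partial>lborel)"
      using e by (simp only: mult.commute[of _ "\<eta> _"])
    also have "\<dots> = (\<integral>x. (\<eta> x *\<^sub>R g x) \<bullet> i \<partial>lborel) - (\<integral>x. (\<eta> x *\<^sub>R g' x) \<bullet> i \<partial>lborel)"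
      by (intro Bochner_Integration.integral_diff integrable_inner_left int)
    also have "\<dots> = (\<integral>x. (g x \<bullet> i) * \<eta> x \<partial>lborel) - (\<integral>x. (g' x \<bullet> i) * \<eta> x \<partial>lborel)"
      by (simp add: mult.commute)
    also have "\<dots> = 0"
    proof -
      have "(\<integral>x. u x * frechet_derivative \<eta> (at x) i \<partial>lborel) = - (\<integral>x. (g x \<bullet> i) * \<eta> x \<partial>lborel)"
        "(\<integral>x. u x * frechet_derivative \<eta> (at x) i \<partial>lborel) = - (\<integral>x. (g' x \<bullet> i) * \<eta> x \<partial>lborel)"
        by (rule borel_weak_gradient_parts[OF 1 \<eta> i], rule borel_weak_gradient_parts[OF 2 \<eta> i])
      then show ?thesis by linarith
    qed
    finally show "(\<integral>x. (g x - g' x) \<bullet> i * \<eta> x \<partial>lborel) = 0" .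
  qed measurable
  then have "AE x in lborel. \<forall>i\<in>Basis. x \<in> \<Omega> \<longrightarrow> (g x - g' x) \<bullet> i = 0"
    by (intro AE_finite_allI) auto
  then show ?thesis
  proof eventually_elim
    case (elim x)
    show ?case
    proof
      assume "x \<in> \<Omega>"
      then show "g x = g' x"
        using elim by (intro euclidean_eqI[where 'a='a]) (simp add: inner_diff_left)
    qed
  qed
qed

section \<open>Mollification in generalised Orlicz spaces\<close>

text \<open>The structural hypotheses on a generalised Young function \<open>\<Phi>\<close> that the density proof uses: \<open>contract\<close>
says that \<open>\<Phi>(x,t)/t\<close> is increasing and takes the place of convexity, \<open>dilate\<close> is the doubling condition, and
\<open>local_comparison\<close> is condition (A1) without inverses, in the one direction that is needed.\<close>

locale comparable_modular =
  fixes \<Omega> :: "'a::euclidean_space set" and \<Phi> :: "'a \<Rightarrow> real \<Rightarrow> real" and Q C D :: real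
  assumes open_dom: "open \<Omega>"
    and mono: "\<And>x s t. x \<in> \<Omega> \<Longrightarrow> 0 \<le> s \<Longrightarrow> s \<le> t \<Longrightarrow> \<Phi> x s \<le> \<Phi> x t"
    and zero: "\<And>x. x \<in> \<Omega> \<Longrightarrow> \<Phi> x 0 = 0"
    and contract: "\<And>x l t. x \<in> \<Omega> \<Longrightarrow> 0 \<le> l \<Longrightarrow> l \<le> 1 \<Longrightarrow> 0 \<le> t \<Longrightarrow> \<Phi> x (l * t) \<le> l * \<Phi> x t"
    and dilate: "\<And>x l t. x \<in> \<Omega> \<Longrightarrow> 1 \<le> l \<Longrightarrow> 0 \<le> t \<Longrightarrow> \<Phi> x (l * t) \<le> l powr Q * \<Phi> x t"
    and cont: "\<And>x. x \<in> \<Omega> \<Longrightarrow> continuous_on {0..} (\<Phi> x)"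
    and meas: "\<And>w. w \<in> borel_measurable borel \<Longrightarrow> (\<lambda>x. indicator \<Omega> x * \<Phi> x \<bar>w x\<bar>) \<in> borel_measurable borel"
    and bound_1: "\<And>x. x \<in> \<Omega> \<Longrightarrow> \<Phi> x 1 \<le> D"
    and Q_nonneg: "0 \<le> Q" and C_pos: "0 < C"
    and local_comparison: "\<And>x y s \<epsilon>. x \<in> \<Omega> \<Longrightarrow> y \<in> \<Omega> \<Longrightarrow> 0 < \<epsilon> \<Longrightarrow> \<epsilon> \<le> 1 \<Longrightarrow> dist x y < \<epsilon> \<Longrightarrow>
      1 \<le> s \<Longrightarrow> \<Phi> x s * \<epsilon> ^ DIM('a) \<le> 1 \<Longrightarrow> \<Phi> x s \<le> C * \<Phi> y s"
begin

lemma nonneg: "x \<in> \<Omega> \<Longrightarrow> 0 \<le> t \<Longrightarrow> 0 \<le> \<Phi> x t"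
  using mono[of x 0 t] zero by simp

lemma dilate_max:
  assumes "x \<in> \<Omega>" "0 \<le> l" "0 \<le> t"
  shows "\<Phi> x (l * t) \<le> max 1 l powr Q * \<Phi> x t"
proof -
  have "\<Phi> x (l * t) \<le> \<Phi> x (max 1 l * t)"
    using assms by (intro mono mult_right_mono) auto
  also have "\<dots> \<le> max 1 l powr Q * \<Phi> x t" using assms by (intro dilate) auto
  finally show ?thesis .
qed

lemma sum_le:
  assumes "x \<in> \<Omega>" "0 \<le> a" "0 \<le> b"
  shows "\<Phi> x (a + b) \<le> 2 powr Q * (\<Phi> x a + \<Phi> x b)"
proof -
  have "\<Phi> x (a + b) \<le> \<Phi> x (2 * max a b)" using assms by (intro mono) auto
  also have "\<dots> \<le> 2 powr Q * \<Phi> x (max a b)" using assms by (intro dilate) auto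
  also have "\<dots> \<le> 2 powr Q * (\<Phi> x a + \<Phi> x b)"
    using assms nonneg[of x a] nonneg[of x b] by (intro mult_left_mono) (auto simp: max_def)
  finally show ?thesis .
qed

definition modular_density :: "('a \<Rightarrow> 'b::real_normed_vector) \<Rightarrow> 'a \<Rightarrow> real" where
  "modular_density f x = indicator \<Omega> x * \<Phi> x (norm (f x))"

lemma modular_density_nonneg: "0 \<le> modular_density f x"
  by (cases "x \<in> \<Omega>") (simp_all add: modular_density_def nonneg)

lemma modular_density_measurable:
  fixes f :: "'a \<Rightarrow> 'b::{real_normed_vector, second_countable_topology}"
  assumes "f \<in> borel_measurable borel"
  shows "modular_density f \<in> borel_measurable borel"
  using meas[of "\<lambda>x. norm (f x)"] assms by (simp add: modular_density_def[abs_def])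

text \<open>Splitting the average at height \<open>s\<close>, half of the mean: the values below \<open>s\<close> contribute at most \<open>s\<close>, so the
values above \<open>s\<close> must contribute the other half. At such a value, monotonicity of \<open>\<Phi>(y,t)/t\<close>
and the comparison at height \<open>\<sigma> \<le> s\<close> give \<open>\<bar>f\<bar> \<le> \<sigma> C \<Phi>(y,\<bar>f\<bar>) / \<Phi>(x,\<sigma>)\<close>.\<close>

lemma averaged_bound:
  fixes f :: "'a \<Rightarrow> 'b::euclidean_space"
  assumes f: "integrable lborel f" and g: "integrable lborel (modular_density f)"
    and supp: "\<And>y. f y \<noteq> 0 \<Longrightarrow> y \<in> \<Omega>"
    and x: "x \<in> \<Omega>" and \<epsilon>: "0 < \<epsilon>" "\<epsilon> \<le> 1"
    and s: "norm (conv (moll \<epsilon>) f x) = 2 * s" "\<sigma> \<le> s" "1 \<le> \<sigma>"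
    and \<sigma>: "\<Phi> x \<sigma> * \<epsilon> ^ DIM('a) \<le> 1" "0 < \<Phi> x \<sigma>"
  shows "s \<le> \<sigma> * C / \<Phi> x \<sigma> * conv (moll \<epsilon>) (modular_density f) x"
proof -
  note k = moll_test_fun[OF \<epsilon>(1), where 'a='a]
  define c where "c = \<sigma> * C / \<Phi> x \<sigma>"
  have c: "0 \<le> c" using s \<sigma> C_pos by (simp add: c_def)
  have pt: "moll \<epsilon> (x - y) * norm (f y) \<le> moll \<epsilon> (x - y) * s + c * (moll \<epsilon> (x - y) * modular_density f y)" for y
  proof (cases "norm (f y) \<le> s \<or> moll \<epsilon> (x - y) = 0")
    case True
    then show ?thesis
    proof
      assume "norm (f y) \<le> s"
      then have "moll \<epsilon> (x - y) * norm (f y) \<le> moll \<epsilon> (x - y) * s"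
        by (rule mult_left_mono) (rule moll_nonneg[OF \<epsilon>(1)])
      moreover have "0 \<le> c * (moll \<epsilon> (x - y) * modular_density f y)"
        by (intro mult_nonneg_nonneg c moll_nonneg \<epsilon> modular_density_nonneg)
      ultimately show ?thesis by linarith
    qed simp
  next
    case False
    then have fy: "s < norm (f y)" "norm (x - y) < \<epsilon>"
      using moll_eq_0[OF \<epsilon>(1), of "x - y"] by (simp_all add: not_le[symmetric]) blast
    then have y: "y \<in> \<Omega>" using supp s by force
    have comp: "\<Phi> x \<sigma> \<le> C * \<Phi> y \<sigma>"
      by (rule local_comparison[OF x y \<epsilon>]) (use fy s \<sigma> in \<open>auto simp: dist_norm\<close>)
    have fpos: "0 < norm (f y)" "\<sigma> \<le> norm (f y)" using fy s by linarith+
    have "\<Phi> y ((\<sigma> / norm (f y)) * norm (f y)) \<le> (\<sigma> / norm (f y)) * \<Phi> y (norm (f y))"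
      using fpos s by (intro contract y) auto
    then have "\<Phi> y \<sigma> * norm (f y) \<le> \<sigma> * \<Phi> y (norm (f y))"
      using fpos by (simp add: field_simps)
    then have "C * (\<Phi> y \<sigma> * norm (f y)) \<le> C * (\<sigma> * \<Phi> y (norm (f y)))"
      using C_pos by (intro mult_left_mono) auto
    moreover have "\<Phi> x \<sigma> * norm (f y) \<le> (C * \<Phi> y \<sigma>) * norm (f y)"
      using comp by (intro mult_right_mono) auto
    ultimately have "\<Phi> x \<sigma> * norm (f y) \<le> \<sigma> * C * \<Phi> y (norm (f y))" by (simp add: mult_ac)
    then have "norm (f y) \<le> c * modular_density f y"
      using \<sigma>(2) y by (simp add: c_def modular_density_def field_simps)
    then have "moll \<epsilon> (x - y) * norm (f y) \<le> moll \<epsilon> (x - y) * (c * modular_density f y)"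
      by (rule mult_left_mono) (rule moll_nonneg[OF \<epsilon>(1)])
    moreover have "0 \<le> moll \<epsilon> (x - y) * s" using s by (intro mult_nonneg_nonneg moll_nonneg \<epsilon>) auto
    ultimately show ?thesis by (simp add: mult_ac)
  qed
  have i1: "integrable lborel (\<lambda>y. moll \<epsilon> (x - y))"
    using test_fun_integrable[OF test_funI[OF smooth_on_reflect(1)[OF test_fun_smooth[OF k], of x] compact_cball[of x \<epsilon>] subset_UNIV]]
      moll_eq_0[OF \<epsilon>(1), of "x - y" for y] by (force simp: dist_norm)
  have m1: "(\<integral>y. moll \<epsilon> (x - y) \<partial>lborel) = 1"
    by (subst integral_reflect) (simp_all add: moll_integral[OF \<epsilon>(1)] moll_measurable[OF \<epsilon>(1)])
  have i2: "integrable lborel (\<lambda>y. moll \<epsilon> (x - y) * modular_density f y)"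
    using conv_integrable[OF k g, of x] by simp
  have i0: "integrable lborel (\<lambda>y. moll \<epsilon> (x - y) * norm (f y))"
    using integrable_norm[OF conv_integrable[OF k f, of x]] by (simp add: moll_nonneg[OF \<epsilon>(1)])
  have "2 * s = norm (\<integral>y. moll \<epsilon> (x - y) *\<^sub>R f y \<partial>lborel)" using s by (simp add: conv_def)
  also have "\<dots> \<le> (\<integral>y. norm (moll \<epsilon> (x - y) *\<^sub>R f y) \<partial>lborel)" by (rule integral_norm_bound)
  also have "\<dots> \<le> (\<integral>y. moll \<epsilon> (x - y) * s + c * (moll \<epsilon> (x - y) * modular_density f y) \<partial>lborel)"
    using i0 i1 i2 pt
    by (intro integral_mono Bochner_Integration.integrable_add) (auto simp: moll_nonneg[OF \<epsilon>(1)])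
  also have "\<dots> = s + c * conv (moll \<epsilon>) (modular_density f) x"
    using i1 i2 m1 by (simp add: conv_def)
  finally show ?thesis by (simp add: c_def)
qed

text \<open>The comparison of \<open>\<Phi>(x,s)\<close> with \<open>\<Phi>(y,s)\<close> is available only while \<open>\<Phi>(x,s)\<close> is at most \<open>\<epsilon>\<close> to the power \<open>-N\<close>.
The smallness of the total modular guarantees this a priori: otherwise apply \<open>averaged_bound\<close> at
the height \<open>\<sigma> < s\<close> where \<open>\<Phi>(x,\<sigma>)\<close> equals that power; bounding the mollifier by its maximum then
yields \<open>s \<le> \<sigma>\<close>.\<close>

lemma moll_pointwise_bound:
  fixes f :: "'a \<Rightarrow> 'b::euclidean_space"
  assumes f: "integrable lborel f" and g: "integrable lborel (modular_density f)"
    and supp: "\<And>y. f y \<noteq> 0 \<Longrightarrow> y \<in> \<Omega>"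
    and x: "x \<in> \<Omega>" and \<epsilon>: "0 < \<epsilon>" "\<epsilon> \<le> 1" "D * \<epsilon> ^ DIM('a) \<le> 1"
    and small: "C * moll_const TYPE('a) * (\<integral>y. modular_density f y \<partial>lborel) \<le> 1"
  shows "\<Phi> x (norm (conv (moll \<epsilon>) f x)) \<le> 2 powr Q * (C * conv (moll \<epsilon>) (modular_density f) x + D)"
proof -
  define s where "s = norm (conv (moll \<epsilon>) f x) / 2"
  have s: "norm (conv (moll \<epsilon>) f x) = 2 * s" "0 \<le> s" by (auto simp: s_def)
  define c where "c = conv (moll \<epsilon>) (modular_density f) x"
  have eN: "0 < \<epsilon> ^ DIM('a)" using \<epsilon> by simp
  have c0: "0 \<le> c"
    unfolding c_def conv_def by (auto intro!: integral_nonneg_AE simp: moll_nonneg \<epsilon> modular_density_nonneg)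
  have D0: "0 \<le> D" using nonneg[OF x, of 1] bound_1[OF x] by simp
  have core: "s \<le> \<sigma> * C / \<Phi> x \<sigma> * c"
    if "\<sigma> \<le> s" "1 \<le> \<sigma>" "\<Phi> x \<sigma> * \<epsilon> ^ DIM('a) \<le> 1" "0 < \<Phi> x \<sigma>" for \<sigma>
    unfolding c_def by (rule averaged_bound[OF f g _ x \<epsilon>(1,2) s(1) that]) (rule supp)
  have "\<Phi> x s \<le> C * c + D"
  proof (cases "s < 1 \<or> \<Phi> x s \<le> 0")
    case True
    then have "\<Phi> x s \<le> D"
      using mono[OF x s(2), of 1] bound_1[OF x] D0 by auto
    then show ?thesis using c0 C_pos by (simp add: add_increasing)
  next
    case False
    then have s1: "1 \<le> s" "0 < \<Phi> x s" by auto
    show ?thesis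
    proof (cases "\<Phi> x s * \<epsilon> ^ DIM('a) \<le> 1")
      case True
      have "s \<le> s * C / \<Phi> x s * c" by (rule core[OF order_refl s1(1) True s1(2)])
      then have "\<Phi> x s \<le> C * c" using s1 by (simp add: field_simps)
      then show ?thesis using D0 by simp
    next
      case False
      have "\<Phi> x 1 * \<epsilon> ^ DIM('a) \<le> D * \<epsilon> ^ DIM('a)"
        using bound_1[OF x] eN by (intro mult_right_mono) auto
      then have "\<Phi> x 1 * \<epsilon> ^ DIM('a) \<le> 1" using \<epsilon>(3) by linarith
      then have "\<Phi> x 1 \<le> 1 / \<epsilon> ^ DIM('a)" by (simp only: pos_le_divide_eq[OF eN])
      moreover have "1 / \<epsilon> ^ DIM('a) \<le> \<Phi> x s" using False eN by (simp add: field_simps)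
      moreover have "continuous_on {1..s} (\<Phi> x)"
        by (rule continuous_on_subset[OF cont[OF x]]) auto
      \<comment> \<open>The height at which \<open>\<Phi>(x,\<sigma>)\<close> is exactly the critical value.\<close>
      ultimately obtain \<sigma> where \<sigma>: "1 \<le> \<sigma>" "\<sigma> \<le> s" "\<Phi> x \<sigma> = 1 / \<epsilon> ^ DIM('a)"
        using IVT'[of "\<Phi> x" 1 "1 / \<epsilon> ^ DIM('a)" s] s1 by metis
      have "c \<le> (\<integral>y. moll_const TYPE('a) / \<epsilon> ^ DIM('a) * modular_density f y \<partial>lborel)"
        unfolding c_def conv_def real_scaleR_def
        using conv_integrable[OF moll_test_fun[OF \<epsilon>(1)] g, of x] g
        by (intro integral_mono mult_right_mono moll_le \<epsilon> modular_density_nonneg) auto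
      also have "\<dots> = moll_const TYPE('a) / \<epsilon> ^ DIM('a) * (\<integral>y. modular_density f y \<partial>lborel)" by simp
      finally have c: "c * \<epsilon> ^ DIM('a) \<le> moll_const TYPE('a) * (\<integral>y. modular_density f y \<partial>lborel)"
        using eN by (simp add: field_simps)
      have "s \<le> \<sigma> * C / \<Phi> x \<sigma> * c"
        by (rule core) (use \<sigma> eN in auto)
      also have "\<dots> = \<sigma> * (C * (c * \<epsilon> ^ DIM('a)))" using \<sigma> eN by simp
      also have "\<dots> \<le> \<sigma> * (C * (moll_const TYPE('a) * (\<integral>y. modular_density f y \<partial>lborel)))"
        using \<sigma> C_pos c by (intro mult_left_mono) auto
      also have "\<dots> \<le> \<sigma> * 1" using small \<sigma> by (intro mult_left_mono) (auto simp: mult.assoc)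
      finally have "s = \<sigma>" using \<sigma> by simp
      then show ?thesis using \<sigma> False eN \<epsilon>(1) by simp
    qed
  qed
  then have "2 powr Q * \<Phi> x s \<le> 2 powr Q * (C * c + D)" by (intro mult_left_mono) auto
  moreover have "\<Phi> x (2 * s) \<le> 2 powr Q * \<Phi> x s" by (rule dilate[OF x _ s(2)]) simp
  ultimately show ?thesis unfolding s(1) c_def by (rule order_trans[rotated])
qed

text \<open>Along a subsequence of radii the mollifications converge almost everywhere, hence so does the modular density
\<open>E\<close> of the error to zero. By \<open>moll_pointwise_bound\<close>, \<open>E\<close> is bounded by a multiple of \<open>g + g\<^sub>n + 1\<^sub>B\<close>, where
\<open>g\<^sub>n\<close> are the mollifications of the modular density \<open>g\<close> of \<open>h\<close>. This bound moves with \<open>n\<close>; writing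
\<open>g\<^sub>n \<le> g + \<bar>g\<^sub>n - g\<bar>\<close> isolates a part that tends to zero in \<open>L\<^sup>1\<close> and leaves a fixed integrable majorant.\<close>

lemma small_modular_approx:
  fixes h :: "'a \<Rightarrow> 'b::euclidean_space"
  assumes h: "integrable lborel h" and g: "integrable lborel (modular_density h)"
    and K: "compact K" "K \<subseteq> \<Omega>" "\<And>y. y \<notin> K \<Longrightarrow> h y = 0"
    and small: "C * moll_const TYPE('a) * (\<integral>y. modular_density h y \<partial>lborel) \<le> 1"
    and "0 < (\<delta>::real)" "0 < r"
  shows "\<exists>\<epsilon>. 0 < \<epsilon> \<and> \<epsilon> < r \<and>
    (\<integral>\<^sup>+x. ennreal (modular_density (\<lambda>x. h x - conv (moll \<epsilon>) h x) x) \<partial>lborel) < ennreal \<delta>"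
proof -
  let ?N = "DIM('a)"
  let ?g = "modular_density h"
  have [measurable]: "h \<in> borel_measurable borel" "?g \<in> borel_measurable borel" using h g by auto
  obtain r1 where r1: "r1 > 0"
    "\<And>\<epsilon>. 0 < \<epsilon> \<and> \<epsilon> < r1 \<Longrightarrow> (\<integral>\<^sup>+x. ennreal (norm (conv (moll \<epsilon>) h x - h x)) \<partial>lborel) \<le> ennreal 1"
    using moll_conv_tendsto_L1[OF h, of 1] by auto
  \<comment> \<open>All radii stay below \<open>r1\<close> (so that the errors are integrable), below \<open>1\<close>, and so small that
    \<open>moll_pointwise_bound\<close> applies.\<close>
  define r0 where "r0 = min (min r r1) (min 1 (1 / (\<bar>D\<bar> + 1)))"
  have r0: "0 < r0" "r0 \<le> r" "r0 \<le> r1" "r0 \<le> 1" "r0 \<le> 1 / (\<bar>D\<bar> + 1)"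
    using assms(8) r1(1) by (auto simp: r0_def min_le_iff_disj add_nonneg_pos)
  define e where "e n = r0 / real (n + 2)" for n
  have e: "0 < e n" "e n < r0" for n using r0(1) by (simp_all add: e_def divide_less_eq)
  have e_lim: "e \<longlonglongrightarrow> 0"
    unfolding e_def using LIMSEQ_ignore_initial_segment[OF lim_const_over_n[of r0], of 2] by simp
  have eD: "D * e n ^ ?N \<le> 1" for n
  proof -
    have "e n ^ ?N \<le> e n ^ 1"
      using e[of n] r0 by (intro power_decreasing) auto
    then have "e n ^ ?N \<le> 1 / (\<bar>D\<bar> + 1)" using e[of n] r0 by simp
    then have "\<bar>D\<bar> * e n ^ ?N \<le> \<bar>D\<bar> * (1 / (\<bar>D\<bar> + 1))" by (intro mult_left_mono) auto
    also have "\<dots> \<le> 1" by (simp add: field_simps)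
    finally show ?thesis using e[of n] by (smt (verit) mult_right_mono zero_le_power abs_ge_self)
  qed
  define hn where "hn n = conv (moll (e n)) h" for n
  define gn where "gn n = conv (moll (e n)) ?g" for n
  have [measurable]: "(moll (e n) :: 'a \<Rightarrow> real) \<in> borel_measurable borel" for n by (rule moll_measurable[OF e(1)])
  have [measurable]: "hn n \<in> borel_measurable borel" "gn n \<in> borel_measurable borel" for n
    unfolding hn_def gn_def conv_def by measurable
  have lim: "eventually (\<lambda>n. (\<integral>\<^sup>+x. ennreal (norm (conv (moll (e n)) f x - f x)) \<partial>lborel) \<le> ennreal \<eta>) sequentially"
    if f: "integrable lborel f" and \<eta>: "0 < \<eta>" for \<eta> and f :: "'a \<Rightarrow> 'c::euclidean_space"
  proof -
    obtain r2 where r2: "0 < r2" "\<And>\<epsilon>. 0 < \<epsilon> \<and> \<epsilon> < r2 \<Longrightarrow> (\<integral>\<^sup>+x. ennreal (norm (conv (moll \<epsilon>) f x - f x)) \<partial>lborel) \<le> ennreal \<eta>"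
      using moll_conv_tendsto_L1[OF f \<eta>] by metis
    have "eventually (\<lambda>n. e n < r2) sequentially" using order_tendstoD(2)[OF e_lim r2(1)] .
    then show ?thesis by eventually_elim (use r2 e in auto)
  qed
  define u where "u n x = hn n x - h x" for n x
  have ui: "integrable lborel (u n)" for n
    unfolding integrable_iff_bounded
  proof
    have "(\<integral>\<^sup>+x. ennreal (norm (u n x)) \<partial>lborel) \<le> ennreal 1"
      unfolding u_def hn_def using e[of n] r0 by (intro r1(2)) auto
    then show "(\<integral>\<^sup>+x. ennreal (norm (u n x)) \<partial>lborel) < \<infinity>" by (rule le_less_trans) simp
  qed (simp add: u_def[abs_def])
  have "(\<lambda>n. \<integral>x. norm (u n x) \<partial>lborel) \<longlonglongrightarrow> 0"
  proof (rule LIMSEQ_I)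
    fix \<eta> :: real assume "0 < \<eta>"
    then have "eventually (\<lambda>n. (\<integral>\<^sup>+x. ennreal (norm (u n x)) \<partial>lborel) \<le> ennreal (\<eta> / 2)) sequentially"
      unfolding u_def hn_def by (intro lim h) simp
    then have "eventually (\<lambda>n. norm ((\<integral>x. norm (u n x) \<partial>lborel) - 0) < \<eta>) sequentially"
    proof eventually_elim
      case (elim n)
      then have "ennreal (\<integral>x. norm (u n x) \<partial>lborel) \<le> ennreal (\<eta> / 2)"
        using ui[of n] by (subst (asm) nn_integral_eq_integral) auto
      then have "(\<integral>x. norm (u n x) \<partial>lborel) \<le> \<eta> / 2" using \<open>0 < \<eta>\<close> by (simp add: ennreal_le_iff)
      moreover have "0 \<le> (\<integral>x. norm (u n x) \<partial>lborel)" by simp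
      ultimately show ?case using \<open>0 < \<eta>\<close> by simp
    qed
    then show "\<exists>no. \<forall>n\<ge>no. norm ((\<integral>x. norm (u n x) \<partial>lborel) - 0) < \<eta>" by (simp add: eventually_sequentially)
  qed
  then obtain \<kappa> :: "nat \<Rightarrow> nat" where \<kappa>: "strict_mono \<kappa>" "AE x in lborel. (\<lambda>n. u (\<kappa> n) x) \<longlonglongrightarrow> 0"
    using tendsto_L1_AE_subseq[of lborel u] ui by blast
  obtain R where R: "\<And>x. x \<in> K \<Longrightarrow> norm x \<le> R"
    using compact_imp_bounded[OF K(1)] by (auto simp: bounded_iff)
  define B where "B = cball (0::'a) (R + 1)"
  define E where "E n = modular_density (\<lambda>x. h x - hn n x)" for n
  have [measurable]: "E n \<in> borel_measurable borel" for n
    unfolding E_def by (rule modular_density_measurable) measurable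
  define C1 where "C1 = 2 powr Q * (1 + 2 powr Q * (C + \<bar>D\<bar>))"
  have C1: "0 \<le> C1" using C_pos by (simp add: C1_def)
  have bd: "E n x \<le> C1 * (?g x + gn n x + indicator B x)" for n x
  proof -
    have gn0: "0 \<le> gn n x"
      unfolding gn_def conv_def by (auto intro!: integral_nonneg_AE simp: moll_nonneg e modular_density_nonneg)
    have rhs0: "0 \<le> C1 * (?g x + gn n x + indicator B x)"
      using C1 gn0 modular_density_nonneg[of h x] by simp
    show ?thesis
    proof (cases "x \<in> \<Omega>")
      case False then show ?thesis using rhs0 by (simp add: E_def modular_density_def)
    next
      case x: True
      have P: "2 powr Q \<ge> 1" using Q_nonneg by (intro ge_one_powr_ge_zero) auto
      have hb: "\<Phi> x (norm (hn n x)) \<le> 2 powr Q * (C + \<bar>D\<bar>) * (gn n x + indicator B x)"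
      proof (cases "x \<in> B")
        case True
        have "\<Phi> x (norm (hn n x)) \<le> 2 powr Q * (C * gn n x + D)"
          unfolding hn_def gn_def
          by (rule moll_pointwise_bound[OF h g _ x e(1) _ eD small]) (use K e[of n] r0 in force)+
        also have "C * gn n x + D \<le> (C + \<bar>D\<bar>) * (gn n x + 1)"
        proof -
          have "0 \<le> \<bar>D\<bar> * gn n x" using gn0 by simp
          then show ?thesis using C_pos abs_ge_self[of D] unfolding distrib_left distrib_right by linarith
        qed
        finally show ?thesis using True by (simp add: mult.assoc)
      next
        case False
        have "hn n x = 0"
          unfolding hn_def
        proof (rule conv_eq_0)
          fix y assume "h y \<noteq> 0"
          then have "norm y \<le> R" using R K(3) by blast
          moreover have "norm x > R + 1" using False by (simp add: B_def)
          ultimately have "1 \<le> norm (x - y)" using norm_triangle_ineq2[of x y] by linarith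
          then show "moll (e n) (x - y) = 0" using e[of n] r0 by (intro moll_eq_0) auto
        qed
        then show ?thesis using gn0 C_pos by (simp add: zero x)
      qed
      have "E n x = \<Phi> x (norm (h x - hn n x))" using x by (simp add: E_def modular_density_def)
      also have "\<dots> \<le> \<Phi> x (norm (h x) + norm (hn n x))"
        by (intro mono x norm_ge_zero norm_triangle_ineq4)
      also have "\<dots> \<le> 2 powr Q * (?g x + \<Phi> x (norm (hn n x)))"
        using sum_le[OF x, of "norm (h x)" "norm (hn n x)"] x by (simp add: modular_density_def)
      also have "\<dots> \<le> 2 powr Q * (?g x + 2 powr Q * (C + \<bar>D\<bar>) * (gn n x + indicator B x))"
        using hb by (intro mult_left_mono add_left_mono) auto
      also have "\<dots> \<le> 2 powr Q * ((1 + 2 powr Q * (C + \<bar>D\<bar>)) * ?g x + (1 + 2 powr Q * (C + \<bar>D\<bar>)) * (gn n x + indicator B x))"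
        using gn0 C_pos modular_density_nonneg[of h x]
        by (intro mult_left_mono add_mono mult_right_mono) (auto simp: mult_le_cancel_right1)
      also have "\<dots> = C1 * (?g x + gn n x + indicator B x)" by (simp add: C1_def algebra_simps)
      finally show ?thesis .
    qed
  qed
  \<comment> \<open>The fixed majorant that is left after splitting off \<open>C1 \<bar>gn - g\<bar>\<close>.\<close>
  define w where "w x = C1 * (2 * ?g x + indicator B x)" for x
  have w0: "0 \<le> w x" for x
    unfolding w_def by (intro mult_nonneg_nonneg C1 add_nonneg_nonneg) (auto simp: modular_density_nonneg)
  have E0: "0 \<le> E n x" for n x by (simp add: E_def modular_density_nonneg)
  have [measurable]: "B \<in> sets borel" by (simp add: B_def)
  have wi: "integrable lborel w"
    unfolding w_def B_def using g
    by (intro integrable_mult_right Bochner_Integration.integrable_add integrable_real_indicator emeasure_bounded_finite) auto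
  have Ew: "ennreal (E n x) \<le> ennreal (C1 * norm (gn n x - ?g x)) + ennreal (min (E n x) (w x))" for n x
  proof -
    have "E n x \<le> C1 * norm (gn n x - ?g x) + w x"
    proof -
      have "C1 * (?g x + gn n x + indicator B x) \<le> C1 * (\<bar>gn n x - ?g x\<bar> + (2 * ?g x + indicator B x))"
        by (intro mult_left_mono C1) auto
      then show ?thesis using bd[of n x] by (simp add: w_def algebra_simps)
    qed
    moreover have "0 \<le> C1 * norm (gn n x - ?g x)" using C1 by simp
    moreover have "0 \<le> min (E n x) (w x)" by (simp add: E0 w0)
    ultimately show ?thesis by (simp flip: ennreal_plus)
  qed
  have "(\<lambda>n. \<integral>x. min (E (\<kappa> n) x) (w x) \<partial>lborel) \<longlonglongrightarrow> (\<integral>x. 0 \<partial>(lborel :: 'a measure))"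
  proof (rule integral_dominated_convergence[where w=w])
    show "AE x in lborel. (\<lambda>n. min (E (\<kappa> n) x) (w x)) \<longlonglongrightarrow> 0"
      using \<kappa>(2)
    proof eventually_elim
      case (elim x)
      have "(\<lambda>n. E (\<kappa> n) x) \<longlonglongrightarrow> 0"
      proof (cases "x \<in> \<Omega>")
        case x: True
        have nl: "(\<lambda>n. norm (u (\<kappa> n) x)) \<longlonglongrightarrow> 0" using elim by (rule tendsto_norm_zero)
        show ?thesis
        proof (rule tendsto_sandwich[of "\<lambda>_. 0" _ _ "\<lambda>n. norm (u (\<kappa> n) x) * \<Phi> x 1"])
          show "eventually (\<lambda>n. E (\<kappa> n) x \<le> norm (u (\<kappa> n) x) * \<Phi> x 1) sequentially"
            using order_tendstoD(2)[OF nl zero_less_one]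
          proof eventually_elim
            case (elim n)
            then show ?case
              using contract[OF x, of "norm (u (\<kappa> n) x)" 1] x by (simp add: E_def modular_density_def u_def norm_minus_commute)
          qed
          show "(\<lambda>n. norm (u (\<kappa> n) x) * \<Phi> x 1) \<longlonglongrightarrow> 0" using nl by (rule tendsto_mult_left_zero)
        qed (auto simp: E_def modular_density_nonneg)
      qed (simp add: E_def modular_density_def)
      then have "(\<lambda>n. min (E (\<kappa> n) x) (w x)) \<longlonglongrightarrow> min 0 (w x)" by (intro tendsto_min tendsto_const)
      then show ?case using w0[of x] by simp
    qed
    show "AE x in lborel. norm (min (E (\<kappa> n) x) (w x)) \<le> w x" for n
      by (intro AE_I2) (simp add: E0 w0 min_def)
    show "integrable lborel w" by (rule wi)
    then have [measurable]: "w \<in> borel_measurable borel" by auto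
    show "(\<lambda>x. min (E (\<kappa> n) x) (w x)) \<in> borel_measurable lborel" for n by measurable
  qed auto
  then have "(\<lambda>n. \<integral>x. min (E (\<kappa> n) x) (w x) \<partial>lborel) \<longlonglongrightarrow> 0"
    by (simp only: Bochner_Integration.integral_zero)
  then have ev1: "eventually (\<lambda>n. (\<integral>x. min (E (\<kappa> n) x) (w x) \<partial>lborel) < \<delta> / 2) sequentially"
    by (rule order_tendstoD) (use assms(7) in simp)
  have "eventually (\<lambda>n. (\<integral>\<^sup>+x. ennreal (norm (gn n x - ?g x)) \<partial>lborel) \<le> ennreal (\<delta> / (2 * (C1 + 1)))) sequentially"
    unfolding gn_def using C1 assms(7) by (intro lim g) (auto intro!: divide_pos_pos)
  then have ev2: "eventually (\<lambda>n. (\<integral>\<^sup>+x. ennreal (norm (gn (\<kappa> n) x - ?g x)) \<partial>lborel) \<le> ennreal (\<delta> / (2 * (C1 + 1)))) sequentially"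
    using filterlim_subseq[OF \<kappa>(1)] by (auto simp: filterlim_iff)
  obtain n where n: "(\<integral>x. min (E (\<kappa> n) x) (w x) \<partial>lborel) < \<delta> / 2"
    "(\<integral>\<^sup>+x. ennreal (norm (gn (\<kappa> n) x - ?g x)) \<partial>lborel) \<le> ennreal (\<delta> / (2 * (C1 + 1)))"
    using eventually_conj[OF ev1 ev2] by (auto simp: eventually_sequentially)
  have mi: "integrable lborel (\<lambda>x. min (E (\<kappa> n) x) (w x))"
    using wi by (rule Bochner_Integration.integrable_bound)
      (use wi in \<open>auto simp: E0 w0 min_def\<close>)
  have "(\<integral>\<^sup>+x. ennreal (E (\<kappa> n) x) \<partial>lborel)
      \<le> (\<integral>\<^sup>+x. ennreal (C1 * norm (gn (\<kappa> n) x - ?g x)) + ennreal (min (E (\<kappa> n) x) (w x)) \<partial>lborel)"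
    by (intro nn_integral_mono Ew)
  also have "\<dots> = (\<integral>\<^sup>+x. ennreal C1 * ennreal (norm (gn (\<kappa> n) x - ?g x)) \<partial>lborel) + (\<integral>\<^sup>+x. ennreal (min (E (\<kappa> n) x) (w x)) \<partial>lborel)"
    using mi C1 by (subst nn_integral_add) (auto simp: ennreal_mult)
  also have "(\<integral>\<^sup>+x. ennreal C1 * ennreal (norm (gn (\<kappa> n) x - ?g x)) \<partial>lborel) = ennreal C1 * (\<integral>\<^sup>+x. ennreal (norm (gn (\<kappa> n) x - ?g x)) \<partial>lborel)"
    by (rule nn_integral_cmult) measurable
  also have "(\<integral>\<^sup>+x. ennreal (min (E (\<kappa> n) x) (w x)) \<partial>lborel) = ennreal (\<integral>x. min (E (\<kappa> n) x) (w x) \<partial>lborel)"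
    by (intro nn_integral_eq_integral mi AE_I2) (simp add: E0 w0)
  also have "ennreal C1 * (\<integral>\<^sup>+x. ennreal (norm (gn (\<kappa> n) x - ?g x)) \<partial>lborel) + ennreal (\<integral>x. min (E (\<kappa> n) x) (w x) \<partial>lborel)
      \<le> ennreal C1 * ennreal (\<delta> / (2 * (C1 + 1))) + ennreal (\<integral>x. min (E (\<kappa> n) x) (w x) \<partial>lborel)"
    by (intro add_right_mono mult_left_mono n(2)) auto
  also have "\<dots> = ennreal (C1 * (\<delta> / (2 * (C1 + 1))) + (\<integral>x. min (E (\<kappa> n) x) (w x) \<partial>lborel))"
  proof -
    have "0 \<le> (\<integral>x. min (E (\<kappa> n) x) (w x) \<partial>lborel)"
      by (intro integral_nonneg_AE AE_I2) (simp add: E0 w0)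
    moreover have d: "0 \<le> \<delta> / (2 * (C1 + 1))" using C1 assms(7) by simp
    ultimately show ?thesis
      by (simp only: ennreal_plus[OF mult_nonneg_nonneg[OF C1 d]] ennreal_mult[OF C1 d])
  qed
  also have "\<dots> < ennreal \<delta>"
  proof (rule ennreal_lessI)
    have "C1 * (\<delta> / (2 * (C1 + 1))) \<le> (C1 + 1) * (\<delta> / (2 * (C1 + 1)))"
      using C1 assms(7) by (intro mult_right_mono) auto
    also have "\<dots> = \<delta> / 2" using C1 by (simp add: field_simps)
    finally show "C1 * (\<delta> / (2 * (C1 + 1))) + (\<integral>x. min (E (\<kappa> n) x) (w x) \<partial>lborel) < \<delta>"
      using n(1) by linarith
  qed (use assms(7) in simp)
  finally have "(\<integral>\<^sup>+x. ennreal (E (\<kappa> n) x) \<partial>lborel) < ennreal \<delta>" .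
  then show ?thesis
    unfolding E_def hn_def using e[of "\<kappa> n"] r0(2) by (intro exI[of _ "e (\<kappa> n)"]) auto
qed

text \<open>The smallness hypothesis is removed by scaling: \<open>contract\<close> makes the modular of a small multiple of \<open>h\<close>
small, and \<open>dilate\<close> undoes the scaling in the conclusion.\<close>

proposition modular_approx:
  fixes h :: "'a \<Rightarrow> 'b::euclidean_space"
  assumes h: "integrable lborel h" and g: "integrable lborel (modular_density h)"
    and K: "compact K" "K \<subseteq> \<Omega>" "\<And>y. y \<notin> K \<Longrightarrow> h y = 0"
    and \<delta>: "0 < (\<delta>::real)" and r: "0 < r"
  obtains \<epsilon> where "0 < \<epsilon>" "\<epsilon> < r"
    "(\<integral>\<^sup>+x. ennreal (modular_density (\<lambda>x. h x - conv (moll \<epsilon>) h x) x) \<partial>lborel) < ennreal \<delta>"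
proof -
  define M where "M = C * moll_const TYPE('a) * (\<integral>y. modular_density h y \<partial>lborel)"
  have M: "0 \<le> M"
    unfolding M_def using C_pos moll_const_pos[where 'a='a] modular_density_nonneg
    by (intro mult_nonneg_nonneg integral_nonneg_AE AE_I2) auto
  \<comment> \<open>The scaling factor that makes the modular small enough for \<open>small_modular_approx\<close>.\<close>
  define l where "l = 1 / (M + 1)"
  have l: "0 < l" "l \<le> 1" "l * M \<le> 1" using M by (auto simp: l_def field_simps)
  define h' where "h' x = l *\<^sub>R h x" for x
  have [measurable]: "h \<in> borel_measurable borel" using h by auto
  have dh: "modular_density h' x \<le> l * modular_density h x" for x
    using contract[of x l "norm (h x)"] l by (cases "x \<in> \<Omega>") (auto simp: modular_density_def h'_def)
  have h': "integrable lborel h'" using h by (simp add: h'_def[abs_def])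
  have g': "integrable lborel (modular_density h')"
  proof (rule Bochner_Integration.integrable_bound[where f="\<lambda>x. l * modular_density h x"])
    show "modular_density h' \<in> borel_measurable lborel"
      using modular_density_measurable[of h'] by (simp add: h'_def[abs_def])
    show "AE x in lborel. norm (modular_density h' x) \<le> norm (l * modular_density h x)"
      using dh l by (intro AE_I2) (simp add: abs_mult abs_of_nonneg[OF modular_density_nonneg])
  qed (use g in simp)
  have "(\<integral>y. modular_density h' y \<partial>lborel) \<le> (\<integral>y. l * modular_density h y \<partial>lborel)"
    using g g' by (intro integral_mono dh) auto
  then have "C * moll_const TYPE('a) * (\<integral>y. modular_density h' y \<partial>lborel) \<le> C * moll_const TYPE('a) * (l * (\<integral>y. modular_density h y \<partial>lborel))"
    using C_pos moll_const_pos[where 'a='a] by (intro mult_left_mono) auto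
  also have "\<dots> = l * M" by (simp add: M_def)
  finally have small: "C * moll_const TYPE('a) * (\<integral>y. modular_density h' y \<partial>lborel) \<le> 1" using l(3) by simp
  define L where "L = (1 / l) powr Q"
  have L: "0 < L" using l by (simp add: L_def)
  obtain \<epsilon> where e: "0 < \<epsilon>" "\<epsilon> < r"
    "(\<integral>\<^sup>+x. ennreal (modular_density (\<lambda>x. h' x - conv (moll \<epsilon>) h' x) x) \<partial>lborel) < ennreal (\<delta> / L)"
    using small_modular_approx[OF h' g' K(1,2) _ small, of "\<delta> / L" r] K(3) \<delta> r L by (auto simp: h'_def)
  note [measurable] = moll_measurable[OF e(1), where 'a='a]
  have [measurable]: "h' \<in> borel_measurable borel" using h' by auto
  have [measurable]: "conv (moll \<epsilon>) h' \<in> borel_measurable borel"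
    unfolding conv_def by measurable
  have "modular_density (\<lambda>x. h x - conv (moll \<epsilon>) h x) x \<le> L * modular_density (\<lambda>x. h' x - conv (moll \<epsilon>) h' x) x" for x
  proof (cases "x \<in> \<Omega>")
    case True
    have "conv (moll \<epsilon>) h' x = l *\<^sub>R conv (moll \<epsilon>) h x"
      using conv_integrable[OF moll_test_fun[OF e(1)] h, of x]
      by (simp only: conv_def h'_def scaleR_left_commute[of _ l] integral_scaleR_right)
    then have "norm (h' x - conv (moll \<epsilon>) h' x) = l * norm (h x - conv (moll \<epsilon>) h x)"
      using l by (simp add: h'_def flip: scaleR_diff_right)
    then have "norm (h x - conv (moll \<epsilon>) h x) = (1 / l) * norm (h' x - conv (moll \<epsilon>) h' x)"
      using l by simp
    moreover have "\<Phi> x ((1 / l) * norm (h' x - conv (moll \<epsilon>) h' x)) \<le> L * \<Phi> x (norm (h' x - conv (moll \<epsilon>) h' x))"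
      unfolding L_def using l by (intro dilate True) auto
    ultimately show ?thesis using True by (simp add: modular_density_def)
  qed (simp add: modular_density_def)
  then have "(\<integral>\<^sup>+x. ennreal (modular_density (\<lambda>x. h x - conv (moll \<epsilon>) h x) x) \<partial>lborel)
    \<le> (\<integral>\<^sup>+x. ennreal L * ennreal (modular_density (\<lambda>x. h' x - conv (moll \<epsilon>) h' x) x) \<partial>lborel)"
    using L by (intro nn_integral_mono) (auto simp flip: ennreal_mult' intro: ennreal_leI)
  also have "\<dots> = ennreal L * (\<integral>\<^sup>+x. ennreal (modular_density (\<lambda>x. h' x - conv (moll \<epsilon>) h' x) x) \<partial>lborel)"
  proof (rule nn_integral_cmult)
    have "modular_density (\<lambda>x. h' x - conv (moll \<epsilon>) h' x) \<in> borel_measurable borel"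
      by (rule modular_density_measurable) measurable
    then show "(\<lambda>x. ennreal (modular_density (\<lambda>x. h' x - conv (moll \<epsilon>) h' x) x)) \<in> borel_measurable lborel" by simp
  qed
  also have "\<dots> < ennreal L * ennreal (\<delta> / L)"
    using e(3) L by (intro ennreal_mult_strict_left_mono) auto
  also have "\<dots> = ennreal \<delta>" using L \<delta> by (simp flip: ennreal_mult)
  finally show thesis using that e by blast
qed

end

lemma borel_weak_gradient_diff:
  assumes 1: "borel_weak_gradient \<Omega> u g" and 2: "borel_weak_gradient \<Omega> u' g'"
  shows "borel_weak_gradient \<Omega> (\<lambda>x. u x - u' x) (\<lambda>x. g x - g' x)"
  unfolding borel_weak_gradient_def
proof (intro conjI allI impI)
  show "(\<lambda>x. u x - u' x) \<in> borel_measurable borel" "(\<lambda>x. g x - g' x) \<in> borel_measurable borel"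
    using 1 2 by (auto simp: borel_weak_gradient_def)
  fix K assume K: "compact K \<and> K \<subseteq> \<Omega>"
  then have "integrable lborel (\<lambda>x. indicator K x *\<^sub>R u x)" "integrable lborel (\<lambda>x. indicator K x *\<^sub>R g x)"
    "integrable lborel (\<lambda>x. indicator K x *\<^sub>R u' x)" "integrable lborel (\<lambda>x. indicator K x *\<^sub>R g' x)"
    using 1 2 unfolding borel_weak_gradient_def by blast+
  then show "integrable lborel (\<lambda>x. indicator K x *\<^sub>R (u x - u' x))" "integrable lborel (\<lambda>x. indicator K x *\<^sub>R (g x - g' x))"
    unfolding scaleR_diff_right by (auto intro: Bochner_Integration.integrable_diff)
next
  fix \<eta> i assume \<eta>: "test_fun \<Omega> \<eta>" and i: "(i::'a) \<in> Basis"
  note D = test_fun_derivative[OF \<eta>, of i]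
  have "(\<integral>x. (u x - u' x) * frechet_derivative \<eta> (at x) i \<partial>lborel)
    = (\<integral>x. u x * frechet_derivative \<eta> (at x) i \<partial>lborel) - (\<integral>x. u' x * frechet_derivative \<eta> (at x) i \<partial>lborel)"
    using borel_weak_gradient_integrable(1)[OF 1 D] borel_weak_gradient_integrable(1)[OF 2 D]
    by (simp add: left_diff_distrib mult.commute)
  also have "\<dots> = - ((\<integral>x. (\<eta> x *\<^sub>R g x) \<bullet> i \<partial>lborel) - (\<integral>x. (\<eta> x *\<^sub>R g' x) \<bullet> i \<partial>lborel))"
    by (simp add: borel_weak_gradient_parts[OF 1 \<eta> i] borel_weak_gradient_parts[OF 2 \<eta> i] mult.commute)
  also have "(\<integral>x. (\<eta> x *\<^sub>R g x) \<bullet> i \<partial>lborel) - (\<integral>x. (\<eta> x *\<^sub>R g' x) \<bullet> i \<partial>lborel)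
    = (\<integral>x. (\<eta> x *\<^sub>R g x) \<bullet> i - (\<eta> x *\<^sub>R g' x) \<bullet> i \<partial>lborel)"
    by (intro Bochner_Integration.integral_diff[symmetric] integrable_inner_left
        borel_weak_gradient_integrable(2)[OF 1 \<eta>] borel_weak_gradient_integrable(2)[OF 2 \<eta>])
  also have "\<dots> = (\<integral>x. ((g x - g' x) \<bullet> i) * \<eta> x \<partial>lborel)"
    by (intro Bochner_Integration.integral_cong) (auto simp: inner_diff_left algebra_simps)
  finally show "(\<integral>x. (u x - u' x) * frechet_derivative \<eta> (at x) i \<partial>lborel) = - (\<integral>x. ((g x - g' x) \<bullet> i) * \<eta> x \<partial>lborel)" .
qed

text \<open>By uniqueness, the arbitrary choice made in \<open>weak_gradient\<close> may be replaced by an explicit Borel function.\<close>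

lemma weak_gradient_AE_eq:
  fixes \<Omega> :: "'a::euclidean_space set"
  assumes \<Omega>: "open \<Omega>" and w: "borel_weak_gradient \<Omega> u' g'" and ae: "AE x in lborel. x \<in> \<Omega> \<longrightarrow> u x = u' x"
  shows "has_weak_gradient \<Omega> u (weak_gradient \<Omega> u)" "AE x in lborel. x \<in> \<Omega> \<longrightarrow> weak_gradient \<Omega> u x = g' x"
proof -
  have m: "u' \<in> borel_measurable borel" "g' \<in> borel_measurable borel" using w by (auto simp: borel_weak_gradient_def)
  have "has_weak_gradient \<Omega> u g'"
    using ae by (subst has_weak_gradient_iff_borel[OF \<Omega> m]) (auto intro: w)
  then show hw: "has_weak_gradient \<Omega> u (weak_gradient \<Omega> u)"
    unfolding weak_gradient_def by (rule someI[of "has_weak_gradient \<Omega> u"])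
  then have "locally_integrable_on (weak_gradient \<Omega> u) \<Omega>" by (simp add: has_weak_gradient_def)
  then obtain k where k: "k \<in> borel_measurable borel" "AE x in lborel. x \<in> \<Omega> \<longrightarrow> weak_gradient \<Omega> u x = k x"
    using locally_integrable_borel_version[OF \<Omega>] by metis
  have "AE x in lborel. x \<in> \<Omega> \<longrightarrow> u x = u' x \<and> weak_gradient \<Omega> u x = k x"
    using ae k(2) by eventually_elim auto
  from has_weak_gradient_iff_borel[OF \<Omega> m(1) k(1) this] hw have "borel_weak_gradient \<Omega> u' k" by simp
  from borel_weak_gradient_unique[OF \<Omega> this w] k(2)
  show "AE x in lborel. x \<in> \<Omega> \<longrightarrow> weak_gradient \<Omega> u x = g' x"
    by eventually_elim auto
qed

lemma grad_eqI:
  assumes "open T" "x \<in> T" "\<And>y. y \<in> T \<Longrightarrow> f y = h y" "(h has_derivative D) (at x)"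
  shows "grad f x = (\<Sum>i\<in>Basis. D i *\<^sub>R i)"
proof -
  have "(f has_derivative D) (at x)"
    by (rule has_derivative_transform_within_open[OF assms(4,1,2)]) (simp add: assms(3))
  then have "frechet_derivative f (at x) = D" using frechet_derivative_at by metis
  then show ?thesis by (simp add: grad_def)
qed

lemma grad_const: "open T \<Longrightarrow> x \<in> T \<Longrightarrow> (\<And>y. y \<in> T \<Longrightarrow> f y = c) \<Longrightarrow> grad f x = 0"
  using grad_eqI[of T x f "\<lambda>y. c" "\<lambda>h. 0"] by simp

lemma grad_sum:
  assumes "open T" "x \<in> T" "\<And>y. y \<in> T \<Longrightarrow> f y = (\<Sum>j\<in>J. h j y)" "\<And>j. smooth_on UNIV (h j)"
  shows "grad f x = (\<Sum>j\<in>J. grad (h j) x)"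
proof -
  have "((\<lambda>y. \<Sum>j\<in>J. h j y) has_derivative (\<lambda>v. \<Sum>j\<in>J. frechet_derivative (h j) (at x) v)) (at x)"
    using smooth_on_has_derivative[OF assms(4)] by (intro has_derivative_sum) auto
  from grad_eqI[OF assms(1-3) this] show ?thesis
    by (simp add: grad_def scaleR_sum_left) (rule sum.swap)
qed

lemma integrable_PairI:
  fixes f :: "'a \<Rightarrow> 'b::euclidean_space" and g :: "'a \<Rightarrow> 'c::euclidean_space"
  assumes "integrable M f" "integrable M g"
  shows "integrable M (\<lambda>x. (f x, g x))"
proof -
  have "integrable M (\<lambda>x. (f x, 0::'c) + (0::'b, g x))"
    by (intro Bochner_Integration.integrable_add
        integrable_bounded_linear[OF _ assms(1), of "\<lambda>a. (a, 0)"] integrable_bounded_linear[OF _ assms(2), of "\<lambda>a. (0, a)"]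
        bounded_linear_Pair bounded_linear_ident bounded_linear_zero)
  then show ?thesis by simp
qed

lemma conv_Pair:
  fixes f :: "'a::euclidean_space \<Rightarrow> 'b::euclidean_space" and g :: "'a \<Rightarrow> 'c::euclidean_space"
  assumes k: "test_fun \<Omega> k" and f: "integrable lborel f" "integrable lborel g"
  shows "conv k (\<lambda>x. (f x, g x)) x = (conv k f x, conv k g x)"
proof (rule prod_eqI)
  note i = conv_integrable[OF k integrable_PairI[OF f], of x]
  show "fst (conv k (\<lambda>x. (f x, g x)) x) = fst (conv k f x, conv k g x)"
    using integral_bounded_linear[OF bounded_linear_fst i] by (simp add: conv_def)
  show "snd (conv k (\<lambda>x. (f x, g x)) x) = snd (conv k f x, conv k g x)"
    using integral_bounded_linear[OF bounded_linear_snd i] by (simp add: conv_def)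
qed

section \<open>Density of smooth functions\<close>

context comparable_modular
begin

abbreviation \<phi> :: "'a \<Rightarrow> real \<Rightarrow> ennreal" where "\<phi> \<equiv> \<lambda>x t. ennreal (\<Phi> x t)"

lemma nn_integral_lebesgue_on:
  "(\<integral>\<^sup>+x. f x \<partial>lebesgue_on \<Omega>) = (\<integral>\<^sup>+x. f x * indicator \<Omega> x \<partial>lborel)"
  using open_dom by (subst nn_integral_restrict_space) (auto simp: nn_integral_completion)

lemma modular_eq_density:
  fixes f :: "'a \<Rightarrow> 'b::real_normed_vector"
  assumes "AE x in lborel. x \<in> \<Omega> \<longrightarrow> \<bar>w x\<bar> = norm (f x)"
  shows "modular \<Omega> \<phi> w = (\<integral>\<^sup>+x. ennreal (modular_density f x) \<partial>lborel)"
  unfolding modular_def nn_integral_lebesgue_on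
proof (rule nn_integral_cong_AE)
  show "AE x in lborel. ennreal (\<Phi> x \<bar>w x\<bar>) * indicator \<Omega> x = ennreal (modular_density f x)"
    using assms
  proof eventually_elim
    case (elim x)
    then show ?case by (cases "x \<in> \<Omega>") (auto simp: modular_density_def)
  qed
qed

lemma modular_density_scale:
  assumes "0 \<le> l"
  shows "modular_density (\<lambda>x. l *\<^sub>R f x) x \<le> max 1 l powr Q * modular_density f x"
  using dilate_max[of x l "norm (f x)"] assms by (cases "x \<in> \<Omega>") (auto simp: modular_density_def)

lemma modular_density_mono:
  "(x \<in> \<Omega> \<Longrightarrow> norm (f x) \<le> norm (g x)) \<Longrightarrow> modular_density f x \<le> modular_density g x"
  by (cases "x \<in> \<Omega>") (auto simp: modular_density_def intro: mono)

lemma modular_density_le_sum: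
  assumes "x \<in> \<Omega> \<Longrightarrow> norm (f x) \<le> norm (g x) + norm (h x)"
  shows "modular_density f x \<le> 2 powr Q * (modular_density g x + modular_density h x)"
proof (cases "x \<in> \<Omega>")
  case True
  then have "\<Phi> x (norm (f x)) \<le> \<Phi> x (norm (g x) + norm (h x))" using assms by (intro mono) auto
  also have "\<dots> \<le> 2 powr Q * (\<Phi> x (norm (g x)) + \<Phi> x (norm (h x)))" by (rule sum_le[OF True]) auto
  finally show ?thesis using True by (simp add: modular_density_def)
qed (simp add: modular_density_def)

lemma modular_density_integrable_bound:
  fixes f :: "'a \<Rightarrow> 'b::euclidean_space"
  assumes "f \<in> borel_measurable borel" "integrable lborel k" "\<And>x. modular_density f x \<le> k x"
  shows "integrable lborel (modular_density f)"
  using assms(2)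
proof (rule Bochner_Integration.integrable_bound)
  show "modular_density f \<in> borel_measurable lborel" using modular_density_measurable[OF assms(1)] by simp
  show "AE x in lborel. norm (modular_density f x) \<le> norm (k x)"
  proof (rule AE_I2)
    fix x show "norm (modular_density f x) \<le> norm (k x)"
      using assms(3)[of x] modular_density_nonneg[of f x] by simp
  qed
qed

lemma integrable_modular_density_iff:
  fixes f :: "'a \<Rightarrow> 'b::euclidean_space"
  assumes "f \<in> borel_measurable borel"
  shows "integrable lborel (modular_density f) \<longleftrightarrow> (\<integral>\<^sup>+x. ennreal (modular_density f x) \<partial>lborel) < \<infinity>"
  using modular_density_measurable[OF assms] unfolding integrable_iff_bounded
  by (simp add: modular_density_nonneg)

text \<open>If \<open>m\<close> is the largest of the numbers \<open>2\<^sup>j\<^sup>+\<^sup>1 \<bar>a\<^sub>j\<bar>\<close>, then \<open>\<Sum>\<bar>a\<^sub>j\<bar> \<le> m\<close>, and \<open>\<Phi>(x,m)\<close> is one of the summands on the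
right. Thus monotonicity replaces the countable subadditivity of a norm.\<close>

lemma modular_density_sum_le:
  fixes a :: "nat \<Rightarrow> 'a \<Rightarrow> 'b::euclidean_space"
  assumes x: "x \<in> \<Omega>"
  shows "ennreal (modular_density (\<lambda>x. \<Sum>j<n. a j x) x)
    \<le> (\<Sum>j. ennreal (modular_density (\<lambda>x. 2 ^ Suc j *\<^sub>R a j x) x))"
proof (cases "n = 0")
  case True
  then show ?thesis using x by (simp add: modular_density_def zero)
next
  case False
  define m where "m = Max ((\<lambda>j. norm (2 ^ Suc j *\<^sub>R a j x)) ` {..<n})"
  have fin: "finite ((\<lambda>j. norm (2 ^ Suc j *\<^sub>R a j x)) ` {..<n})" "(\<lambda>j. norm (2 ^ Suc j *\<^sub>R a j x)) ` {..<n} \<noteq> {}"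
    using False by auto
  obtain k where k: "k < n" "m = norm (2 ^ Suc k *\<^sub>R a k x)"
    using Max_in[OF fin] by (auto simp: m_def)
  have m: "norm (a j x) \<le> m * (1 / 2) ^ Suc j" if "j < n" for j
  proof -
    have "norm (2 ^ Suc j *\<^sub>R a j x) \<le> m" unfolding m_def using that by (intro Max_ge) auto
    then show ?thesis by (simp add: power_one_over field_simps)
  qed
  have "norm (\<Sum>j<n. a j x) \<le> (\<Sum>j<n. m * (1 / 2) ^ Suc j)"
    by (rule order_trans[OF norm_sum]) (intro sum_mono, use m in auto)
  also have "\<dots> = m * (\<Sum>j<n. (1 / 2) ^ Suc j)" by (simp add: sum_distrib_left)
  also have "(\<Sum>j<n. (1 / 2) ^ Suc j) = 1 - (1 / 2 :: real) ^ n" by (induction n) auto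
  also have "m * (1 - (1 / 2) ^ n) \<le> m * 1" using k by (intro mult_left_mono) auto
  finally have "modular_density (\<lambda>x. \<Sum>j<n. a j x) x \<le> modular_density (\<lambda>x. 2 ^ Suc k *\<^sub>R a k x) x"
    using k by (intro modular_density_mono) simp
  then have "ennreal (modular_density (\<lambda>x. \<Sum>j<n. a j x) x) \<le> ennreal (modular_density (\<lambda>x. 2 ^ Suc k *\<^sub>R a k x) x)"
    by (rule ennreal_leI)
  also have "\<dots> = (\<Sum>j\<in>{k}. ennreal (modular_density (\<lambda>x. 2 ^ Suc j *\<^sub>R a j x) x))" by simp
  also have "\<dots> \<le> (\<Sum>j. ennreal (modular_density (\<lambda>x. 2 ^ Suc j *\<^sub>R a j x) x))"
    by (rule sum_le_suminf) auto
  finally show ?thesis .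
qed

lemma L_space_iff:
  fixes f :: "'a \<Rightarrow> 'b::euclidean_space"
  assumes f: "f \<in> borel_measurable borel"
    and w: "w' \<in> borel_measurable borel" "AE x in lborel. x \<in> \<Omega> \<longrightarrow> w x = w' x" "\<And>x. \<bar>w' x\<bar> = norm (f x)"
  shows "w \<in> L_space \<Omega> \<phi> \<longleftrightarrow> integrable lborel (modular_density f)"
proof -
  have "(\<lambda>x. indicator \<Omega> x *\<^sub>R w x) \<in> borel_measurable lebesgue"
  proof (rule measurable_lebesgue_cong_AE)
    note [measurable] = w(1) borel_open[OF open_dom]
    have "(\<lambda>x. indicator \<Omega> x *\<^sub>R w' x) \<in> borel_measurable borel"
      by measurable
    then show "(\<lambda>x. indicator \<Omega> x *\<^sub>R w' x) \<in> borel_measurable lebesgue"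
      by (simp add: measurable_completion)
    have "AE x in lborel. indicator \<Omega> x *\<^sub>R w x = indicator \<Omega> x *\<^sub>R w' x"
      using w(2) by eventually_elim (auto simp: indicator_def)
    then show "AE x in lebesgue. indicator \<Omega> x *\<^sub>R w x = indicator \<Omega> x *\<^sub>R w' x"
      by (rule AE_completion)
  qed
  then have "w \<in> borel_measurable (lebesgue_on \<Omega>)"
    using open_dom by (subst borel_measurable_restrict_space_iff) auto
  moreover have "modular \<Omega> \<phi> w = (\<integral>\<^sup>+x. ennreal (modular_density f x) \<partial>lborel)"
  proof (rule modular_eq_density)
    show "AE x in lborel. x \<in> \<Omega> \<longrightarrow> \<bar>w x\<bar> = norm (f x)"
      using w(2) by eventually_elim (use w(3) in auto)
  qed
  ultimately show ?thesis
    unfolding L_space_def using integrable_modular_density_iff[OF f] by simp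
qed

text \<open>The theorem of Meyers and Serrin, for an arbitrary open set.\<close>

theorem smooth_dense: "dense_in_W1 \<Omega> \<phi> ({u. smooth_on \<Omega> u} \<inter> W1_space \<Omega> \<phi>)"
  unfolding dense_in_W1_def
proof (intro conjI ballI allI impI)
  fix u and \<epsilon> :: real assume u: "u \<in> W1_space \<Omega> \<phi>" and \<epsilon>: "0 < \<epsilon>"
  define l where "l = \<epsilon> / 2"
  have l: "0 < l" using \<epsilon> by (simp add: l_def)
  let ?g = "weak_gradient \<Omega> u"
  have hw: "has_weak_gradient \<Omega> u ?g"
    using u someI_ex[of "has_weak_gradient \<Omega> u"] unfolding W1_space_def weak_gradient_def by blast
  obtain u' where u': "u' \<in> borel_measurable borel" "AE x in lborel. x \<in> \<Omega> \<longrightarrow> u x = u' x"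
    using locally_integrable_borel_version[OF open_dom] hw unfolding has_weak_gradient_def by metis
  obtain g' where g': "g' \<in> borel_measurable borel" "AE x in lborel. x \<in> \<Omega> \<longrightarrow> ?g x = g' x"
    using locally_integrable_borel_version[OF open_dom] hw unfolding has_weak_gradient_def by metis
  note [measurable] = u'(1) g'(1)
  have "AE x in lborel. x \<in> \<Omega> \<longrightarrow> u x = u' x \<and> ?g x = g' x"
    using u'(2) g'(2) by eventually_elim auto
  from has_weak_gradient_iff_borel[OF open_dom u'(1) g'(1) this] hw
  have bw: "borel_weak_gradient \<Omega> u' g'" by simp
  have "AE x in lborel. x \<in> \<Omega> \<longrightarrow> norm (?g x) = norm (g' x)"
    using g'(2) by eventually_elim auto
  then have mdu: "integrable lborel (modular_density u')" and mdg: "integrable lborel (modular_density g')"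
    using u L_space_iff[OF u'(1) u'(1) u'(2)] L_space_iff[OF g'(1), of "\<lambda>x. norm (g' x)" "\<lambda>x. norm (?g x)"]
    by (auto simp: W1_space_def)
  obtain \<theta> :: "nat \<Rightarrow> 'a \<Rightarrow> real" where \<theta>: "\<And>n. smooth_on UNIV (\<theta> n)"
    "\<And>n x. x \<in> exhaust \<Omega> n \<Longrightarrow> \<theta> n x = 1" "\<And>n x. x \<notin> exhaust \<Omega> (Suc n) \<Longrightarrow> \<theta> n x = 0" "\<And>x. \<theta> 0 x = 0"
    using exhausting_cutoffs[of \<Omega>] by metis
  have \<theta>t: "test_fun \<Omega> (\<theta> n)" for n
    using \<theta>(1,3) by (intro test_funI[OF _ exhaust_compact[of \<Omega> "Suc n"] exhaust_subset]) auto
  \<comment> \<open>The telescoping partition of unity.\<close>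
  define \<zeta> where "\<zeta> j x = \<theta> (Suc j) x - \<theta> j x" for j x
  have \<zeta>t: "test_fun \<Omega> (\<zeta> j)" for j
    unfolding \<zeta>_def by (rule test_fun_diff[OF \<theta>t \<theta>t])
  have \<zeta>0: "\<zeta> j x = 0" if "x \<in> exhaust \<Omega> j \<or> x \<notin> exhaust \<Omega> (Suc (Suc j))" for j x
  proof (cases "x \<in> exhaust \<Omega> j")
    case True
    then have "x \<in> exhaust \<Omega> (Suc j)" using exhaust_mono[of j "Suc j" \<Omega>] by auto
    then show ?thesis using True \<theta>(2) by (simp add: \<zeta>_def)
  next
    case False
    then have "x \<notin> exhaust \<Omega> (Suc (Suc j))" "x \<notin> exhaust \<Omega> (Suc j)"
      using that exhaust_mono[of "Suc j" "Suc (Suc j)" \<Omega>] by auto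
    then show ?thesis using \<theta>(3) by (simp add: \<zeta>_def)
  qed
  have sum_\<zeta>: "(\<Sum>j<n. \<zeta> j x) = \<theta> n x" for n x
    by (induction n) (auto simp: \<zeta>_def \<theta>(4))
  have sum_grad_\<zeta>: "(\<Sum>j<n. grad (\<zeta> j) x) = grad (\<theta> n) x" for n x
    using grad_sum[OF open_UNIV UNIV_I, where f="\<theta> n" and J="{..<n}" and h=\<zeta> and x=x] sum_\<zeta> test_fun_smooth[OF \<zeta>t] by simp
  have supp_grad: "grad (\<zeta> j) x = 0" if "x \<notin> exhaust \<Omega> (Suc (Suc j))" for j x
    by (rule grad_const[of "- exhaust \<Omega> (Suc (Suc j))"])
      (use that \<zeta>0 exhaust_compact[of \<Omega> "Suc (Suc j)"] in \<open>auto intro: compact_imp_closed\<close>)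
  define F where "F j x = \<zeta> j x * u' x" for j x
  define G where "G j x = \<zeta> j x *\<^sub>R g' x + u' x *\<^sub>R grad (\<zeta> j) x" for j x
  \<comment> \<open>Mollifying the pair yields one radius that is good for the function and for its gradient.\<close>
  define h where "h j x = (F j x, G j x)" for j x
  have Fi: "integrable lborel (F j)" and Gi: "integrable lborel (G j)" for j
    using borel_weak_gradient_cutoff(1,2)[OF bw \<zeta>t[of j]] by (simp_all add: F_def[abs_def] G_def[abs_def])
  have hi: "integrable lborel (h j)" for j
    unfolding h_def[abs_def] by (rule integrable_PairI[OF Fi Gi])
  have h0: "h j x = 0" if "x \<notin> exhaust \<Omega> (Suc (Suc j))" for j x
    using \<zeta>0[of x j] supp_grad[OF that] that by (simp add: h_def F_def G_def zero_prod_def)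
  have mdh: "integrable lborel (modular_density (h j))" for j
  proof -
    obtain B1 where B1: "0 \<le> B1" "\<And>x. \<bar>\<zeta> j x\<bar> \<le> B1" using test_fun_bounded[OF \<zeta>t[of j]] by metis
    obtain B2 where B2: "0 \<le> B2" "\<And>x v. \<bar>frechet_derivative (\<zeta> j) (at x) v\<bar> \<le> B2 * norm v"
      using test_fun_derivative_bounded[OF \<zeta>t[of j]] by metis
    define B where "B = B1 + real DIM('a) * B2"
    have B: "0 \<le> B" using B1 B2 by (simp add: B_def)
    have gB: "norm (grad (\<zeta> j) x) \<le> real DIM('a) * B2" for x
    proof -
      have "norm (frechet_derivative (\<zeta> j) (at x) i *\<^sub>R i) \<le> B2" if "i \<in> Basis" for i
        using B2(2)[of x i] that by simp
      then have "norm (grad (\<zeta> j) x) \<le> (\<Sum>i\<in>(Basis::'a set). B2)"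
        unfolding grad_def by (intro order_trans[OF norm_sum] sum_mono)
      then show ?thesis by simp
    qed
    have nh: "norm (h j x) \<le> norm (B *\<^sub>R u' x) + norm (B *\<^sub>R g' x)" for x
    proof -
      have "norm (h j x) \<le> norm (F j x) + norm (G j x)" unfolding h_def by (rule norm_Pair_le)
      also have "norm (G j x) \<le> norm (\<zeta> j x *\<^sub>R g' x) + norm (u' x *\<^sub>R grad (\<zeta> j) x)"
        unfolding G_def by (rule norm_triangle_ineq)
      also have "norm (u' x *\<^sub>R grad (\<zeta> j) x) \<le> \<bar>u' x\<bar> * (real DIM('a) * B2)"
        using gB[of x] by (simp add: mult_left_mono)
      also have "norm (\<zeta> j x *\<^sub>R g' x) \<le> B * norm (g' x)"
        using B1(2)[of x] B2(1) by (simp add: B_def mult_right_mono add_increasing2)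
      also have "norm (F j x) \<le> B1 * \<bar>u' x\<bar>"
        using B1(2)[of x] by (simp add: F_def abs_mult mult_right_mono)
      finally have "norm (h j x) \<le> B1 * \<bar>u' x\<bar> + (B * norm (g' x) + \<bar>u' x\<bar> * (real DIM('a) * B2))" by simp
      also have "\<dots> = B * \<bar>u' x\<bar> + B * norm (g' x)" by (simp add: B_def algebra_simps)
      finally show ?thesis using B by (simp add: abs_mult)
    qed
    show ?thesis
    proof (rule modular_density_integrable_bound)
      show "h j \<in> borel_measurable borel" using hi by auto
      let ?M = "2 powr Q * max 1 B powr Q"
      show "integrable lborel (\<lambda>x. ?M * (modular_density u' x + modular_density g' x))"
        using mdu mdg by simp
      show "modular_density (h j) x \<le> ?M * (modular_density u' x + modular_density g' x)" for x
      proof -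
        have "modular_density (h j) x \<le> 2 powr Q * (modular_density (\<lambda>x. B *\<^sub>R u' x) x + modular_density (\<lambda>x. B *\<^sub>R g' x) x)"
          by (rule modular_density_le_sum) (rule nh)
        also have "\<dots> \<le> 2 powr Q * (max 1 B powr Q * modular_density u' x + max 1 B powr Q * modular_density g' x)"
          by (intro mult_left_mono add_mono modular_density_scale B) auto
        finally show ?thesis by (simp add: algebra_simps)
      qed
    qed
  qed
  \<comment> \<open>The radius is below the gap around the support of the \<open>j\<close>-th piece, so the mollified pieces remain locally finite.
    The weight \<open>2\<^sup>j\<^sup>+\<^sup>1\<close> is the one required by \<open>modular_density_sum_le\<close>, and the bounds add up to \<open>1/2\<close>.\<close>
  have ex: "\<exists>e. 0 < e \<and> e < exhaust_gap (Suc (Suc j)) \<and>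
    (\<integral>\<^sup>+x. ennreal (modular_density (\<lambda>x. 2 ^ Suc j *\<^sub>R ((1 / l) *\<^sub>R (h j x - conv (moll e) (h j) x))) x) \<partial>lborel) \<le> ennreal ((1 / 2) ^ Suc (Suc j))" for j
  proof -
    define M where "M = max 1 (2 ^ Suc j / l) powr Q"
    have M: "0 < M" by (simp add: M_def)
    have d: "0 < (1 / 2) ^ Suc (Suc j) / M" using M by simp
    obtain e where e: "0 < e" "e < exhaust_gap (Suc (Suc j))"
      "(\<integral>\<^sup>+x. ennreal (modular_density (\<lambda>x. h j x - conv (moll e) (h j) x) x) \<partial>lborel) < ennreal ((1 / 2) ^ Suc (Suc j) / M)"
      by (rule modular_approx[OF hi mdh exhaust_compact exhaust_subset h0 d exhaust_gap_pos])
    note [measurable] = moll_measurable[OF e(1), where 'a='a]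
    have [measurable]: "h j \<in> borel_measurable borel" using hi by auto
    have "(\<lambda>x. h j x - conv (moll e) (h j) x) \<in> borel_measurable borel" unfolding conv_def by measurable
    from modular_density_measurable[OF this]
    have [measurable]: "modular_density (\<lambda>x. h j x - conv (moll e) (h j) x) \<in> borel_measurable lborel" by simp
    have "modular_density (\<lambda>x. 2 ^ Suc j *\<^sub>R ((1 / l) *\<^sub>R (h j x - conv (moll e) (h j) x))) x
      \<le> M * modular_density (\<lambda>x. h j x - conv (moll e) (h j) x) x" for x
      using modular_density_scale[of "2 ^ Suc j / l" "\<lambda>x. h j x - conv (moll e) (h j) x" x] l by (simp add: M_def)
    then have "(\<integral>\<^sup>+x. ennreal (modular_density (\<lambda>x. 2 ^ Suc j *\<^sub>R ((1 / l) *\<^sub>R (h j x - conv (moll e) (h j) x))) x) \<partial>lborel)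
      \<le> (\<integral>\<^sup>+x. ennreal M * ennreal (modular_density (\<lambda>x. h j x - conv (moll e) (h j) x) x) \<partial>lborel)"
      using M by (intro nn_integral_mono) (simp flip: ennreal_mult', rule ennreal_leI, simp)
    also have "\<dots> = ennreal M * (\<integral>\<^sup>+x. ennreal (modular_density (\<lambda>x. h j x - conv (moll e) (h j) x) x) \<partial>lborel)"
      by (rule nn_integral_cmult) measurable
    also have "\<dots> \<le> ennreal M * ennreal ((1 / 2) ^ Suc (Suc j) / M)"
      by (intro mult_left_mono less_imp_le[OF e(3)]) simp
    also have "\<dots> = ennreal (M * ((1 / 2) ^ Suc (Suc j) / M))" using M by (intro ennreal_mult[symmetric]) auto
    also have "M * ((1 / 2) ^ Suc (Suc j) / M) = (1 / 2) ^ Suc (Suc j)" using M by simp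
    finally show ?thesis using e(1,2) by (intro exI[of _ e] conjI)
  qed
  have "\<exists>e. \<forall>j. 0 < e j \<and> e j < exhaust_gap (Suc (Suc j)) \<and>
    (\<integral>\<^sup>+x. ennreal (modular_density (\<lambda>x. 2 ^ Suc j *\<^sub>R ((1 / l) *\<^sub>R (h j x - conv (moll (e j)) (h j) x))) x) \<partial>lborel) \<le> ennreal ((1 / 2) ^ Suc (Suc j))"
    by (intro choice allI) (rule ex)
  then obtain e where E: "\<forall>j. 0 < e j \<and> e j < exhaust_gap (Suc (Suc j)) \<and>
    (\<integral>\<^sup>+x. ennreal (modular_density (\<lambda>x. 2 ^ Suc j *\<^sub>R ((1 / l) *\<^sub>R (h j x - conv (moll (e j)) (h j) x))) x) \<partial>lborel) \<le> ennreal ((1 / 2) ^ Suc (Suc j))" ..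
  have e: "0 < e j" "e j < exhaust_gap (Suc (Suc j))" for j
    by (rule conjunct1[OF spec[OF E]], rule conjunct1[OF conjunct2[OF spec[OF E]]])
  have small: "(\<integral>\<^sup>+x. ennreal (modular_density (\<lambda>x. 2 ^ Suc j *\<^sub>R ((1 / l) *\<^sub>R (h j x - conv (moll (e j)) (h j) x))) x) \<partial>lborel) \<le> ennreal ((1 / 2) ^ Suc (Suc j))" for j
    by (rule conjunct2[OF conjunct2[OF spec[OF E]]])
  note et = moll_test_fun[OF e(1), where 'a='a]
  define V where "V j = conv (moll (e j)) (F j)" for j
  have Vs: "smooth_on UNIV (V j)" for j
    unfolding V_def by (rule conv_smooth[OF et Fi])
  have gradV: "grad (V j) x = conv (moll (e j)) (G j) x" for j x
    unfolding V_def
    by (rule grad_conv[OF et Fi Gi]) (use borel_weak_gradient_cutoff(3)[OF bw \<zeta>t[of j]] in \<open>simp add: F_def G_def\<close>)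
  have hconv: "conv (moll (e j)) (h j) x = (V j x, grad (V j) x)" for j x
    unfolding gradV unfolding V_def h_def[abs_def] by (rule conv_Pair[OF et Fi Gi])
  have gap_anti: "exhaust_gap n \<le> exhaust_gap m" if "m \<le> n" for m n
    unfolding exhaust_gap_def using that by (intro divide_left_mono mult_mono) auto
  have V0: "V j x = 0" if "x \<in> exhaust \<Omega> n" "n < j" for j n x
    unfolding V_def
  proof (rule conv_eq_0)
    fix y assume y: "F j y \<noteq> 0"
    have "\<not> dist x y \<le> exhaust_gap n"
    proof
      assume "dist x y \<le> exhaust_gap n"
      then have "y \<in> exhaust \<Omega> (Suc n)" using exhaust_gap that by blast
      then have "y \<in> exhaust \<Omega> j" using exhaust_mono[of "Suc n" j \<Omega>] that by auto
      then show False using y \<zeta>0[of y j] by (simp add: F_def)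
    qed
    then have "e j \<le> norm (x - y)" using e(2)[of j] gap_anti[of n "Suc (Suc j)"] that by (simp add: dist_norm)
    then show "moll (e j) (x - y) = 0" by (rule moll_eq_0[OF e(1)])
  qed
  define v where "v x = (\<Sum>j. V j x)" for x
  have v: "v x = (\<Sum>j<Suc n. V j x)" if "x \<in> exhaust \<Omega> n" for n x
    unfolding v_def by (rule suminf_finite) (use V0[OF that] in auto)
  have v_nhd: "\<exists>T n. open T \<and> x \<in> T \<and> T \<subseteq> exhaust \<Omega> n \<and> x \<in> exhaust \<Omega> n" if x: "x \<in> \<Omega>" for x
    using exhaust_nhd[OF open_dom x] by (metis interior_subset open_interior subsetD)
  have vs: "smooth_on \<Omega> v"
  proof (rule smooth_on_local)
    fix x assume "x \<in> \<Omega>"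
    then obtain T n where T: "open T" "x \<in> T" "T \<subseteq> exhaust \<Omega> n" using v_nhd by blast
    have "smooth_on T (\<lambda>x. \<Sum>j<Suc n. V j x)"
      by (intro smooth_on_sum T smooth_on_subset[OF Vs]) auto
    then have "smooth_on T v" using smooth_on_cong[OF T(1), of v "\<lambda>x. \<Sum>j<Suc n. V j x"] v T(3) by blast
    then show "\<exists>T. open T \<and> x \<in> T \<and> smooth_on T v" using T by blast
  qed
  define vB where "vB x = indicator \<Omega> x *\<^sub>R v x" for x
  define gB where "gB x = indicator \<Omega> x *\<^sub>R grad v x" for x
  have bv: "borel_weak_gradient \<Omega> vB gB"
    unfolding vB_def[abs_def] gB_def[abs_def] by (rule smooth_borel_weak_gradient[OF open_dom vs])
  then have [measurable]: "vB \<in> borel_measurable borel" "gB \<in> borel_measurable borel"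
    by (auto simp: borel_weak_gradient_def)
  define b where "b j x = (1 / l) *\<^sub>R (h j x - conv (moll (e j)) (h j) x)" for j x
  \<comment> \<open>The scaled errors of the function and of its gradient are the components of \<open>W\<close>, so one bound on the modular of
    \<open>W\<close> serves both.\<close>
  define W where "W x = (1 / l) *\<^sub>R (u' x - vB x, g' x - gB x)" for x
  have [measurable]: "W \<in> borel_measurable borel" unfolding W_def[abs_def] by measurable
  have W_sum: "\<exists>n. W x = (\<Sum>j<n. b j x)" if x: "x \<in> \<Omega>" for x
  proof -
    obtain T n where T: "open T" "x \<in> T" "T \<subseteq> exhaust \<Omega> n" "x \<in> exhaust \<Omega> n" using v_nhd[OF x] by blast
    have xn: "x \<in> exhaust \<Omega> (Suc n)" using T(4) exhaust_mono[of n "Suc n" \<Omega>] by auto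
    have "(\<Sum>j<Suc n. F j x) = (\<Sum>j<Suc n. \<zeta> j x) * u' x" unfolding F_def by (rule sum_distrib_right[symmetric])
    also have "\<dots> = u' x" unfolding sum_\<zeta> using \<theta>(2)[OF xn] by simp
    finally have Fs: "(\<Sum>j<Suc n. F j x) = u' x" .
    have "grad (\<theta> (Suc n)) x = 0"
      by (rule grad_const[OF T(1,2), of _ 1]) (use T(3) exhaust_mono[of n "Suc n" \<Omega>] \<theta>(2) in auto)
    then have Gs: "(\<Sum>j<Suc n. G j x) = g' x"
      unfolding G_def sum.distrib scaleR_sum_left[symmetric] scaleR_sum_right[symmetric] sum_\<zeta> sum_grad_\<zeta>
      using \<theta>(2)[OF xn] by simp
    have gVs: "(\<Sum>j<Suc n. grad (V j) x) = gB x"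
    proof -
      have vT: "v y = (\<Sum>j<Suc n. V j y)" if "y \<in> T" for y using T(3) that by (intro v) blast
      show ?thesis using grad_sum[OF T(1,2) vT Vs] x by (simp only: gB_def indicator_simps scaleR_one)
    qed
    have Vsum: "(\<Sum>j<Suc n. V j x) = vB x"
      using v[OF T(4)] x by (simp only: vB_def indicator_simps scaleR_one)
    have "(\<Sum>j<Suc n. h j x - conv (moll (e j)) (h j) x) = (u' x - vB x, g' x - gB x)"
      by (rule prod_eqI) (simp_all only: hconv h_def diff_Pair fst_sum snd_sum fst_conv snd_conv sum_subtractf Fs Gs gVs Vsum)
    then show ?thesis
      unfolding W_def b_def by (intro exI[of _ "Suc n"]) (simp only: scaleR_sum_right[symmetric])
  qed
  have hm [measurable]: "b j \<in> borel_measurable borel" for j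
  proof -
    note [measurable] = moll_measurable[OF e(1)[of j], where 'a='a]
    have [measurable]: "h j \<in> borel_measurable borel" using hi by auto
    show ?thesis unfolding b_def[abs_def] conv_def by measurable
  qed
  have W_small: "(\<integral>\<^sup>+x. ennreal (modular_density W x) \<partial>lborel) \<le> ennreal (1 / 2)"
  proof -
    have "ennreal (modular_density W x) \<le> (\<Sum>j. ennreal (modular_density (\<lambda>x. 2 ^ Suc j *\<^sub>R b j x) x))" for x
    proof (cases "x \<in> \<Omega>")
      case True
      then obtain n where n: "W x = (\<Sum>j<n. b j x)" using W_sum by blast
      then have "modular_density W x = modular_density (\<lambda>x. \<Sum>j<n. b j x) x" by (simp add: modular_density_def)
      then show ?thesis using modular_density_sum_le[OF True, where a=b and n=n] by simp
    qed (simp add: modular_density_def)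
    then have "(\<integral>\<^sup>+x. ennreal (modular_density W x) \<partial>lborel)
      \<le> (\<integral>\<^sup>+x. (\<Sum>j. ennreal (modular_density (\<lambda>x. 2 ^ Suc j *\<^sub>R b j x) x)) \<partial>lborel)"
      by (intro nn_integral_mono)
    also have "\<dots> = (\<Sum>j. \<integral>\<^sup>+x. ennreal (modular_density (\<lambda>x. 2 ^ Suc j *\<^sub>R b j x) x) \<partial>lborel)"
    proof (rule nn_integral_suminf)
      fix j
      have "modular_density (\<lambda>x. 2 ^ Suc j *\<^sub>R b j x) \<in> borel_measurable borel"
        by (rule modular_density_measurable) measurable
      then show "(\<lambda>x. ennreal (modular_density (\<lambda>x. 2 ^ Suc j *\<^sub>R b j x) x)) \<in> borel_measurable lborel" by simp
    qed
    also have "\<dots> \<le> (\<Sum>j. ennreal ((1 / 2) ^ Suc (Suc j)))"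
      using small by (intro suminf_le) (auto simp: b_def)
    also have "\<dots> = ennreal (1 / 2)"
    proof (rule suminf_ennreal_eq)
      have "(\<lambda>j. (1 / 2 :: real) * (1 / 2) ^ Suc j) sums (1 / 2 * 1)"
        by (intro sums_mult power_half_series)
      then show "(\<lambda>j. (1 / 2 :: real) ^ Suc (Suc j)) sums (1 / 2)" by simp
    qed simp
    finally show ?thesis .
  qed
  have Wi: "integrable lborel (modular_density W)"
  proof -
    have "(\<integral>\<^sup>+x. ennreal (modular_density W x) \<partial>lborel) < \<infinity>"
      by (rule le_less_trans[OF W_small]) (simp only: infinity_ennreal_def ennreal_less_top)
    then show ?thesis by (subst integrable_modular_density_iff) auto
  qed
  have vB_ae: "AE x in lborel. x \<in> \<Omega> \<longrightarrow> v x = vB x" by (simp add: vB_def)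
  have sW: "norm (u' x - vB x) \<le> norm (l *\<^sub>R W x)" "norm (g' x - gB x) \<le> norm (l *\<^sub>R W x)" for x
    using l norm_fst_le[of "u' x - vB x" "g' x - gB x"] norm_snd_le[of "g' x - gB x" "u' x - vB x"] by (simp_all add: W_def)
  have md_bound: "integrable lborel (modular_density k)"
    if k: "k \<in> borel_measurable borel" "integrable lborel (modular_density k')" "\<And>x. norm (k x) \<le> norm (k' x) + norm (l *\<^sub>R W x)"
    for k k' :: "'a \<Rightarrow> 'c::euclidean_space"
  proof (rule modular_density_integrable_bound[OF k(1)])
    show "integrable lborel (\<lambda>x. 2 powr Q * (modular_density k' x + max 1 l powr Q * modular_density W x))"
      using k(2) Wi by simp
    show "modular_density k x \<le> 2 powr Q * (modular_density k' x + max 1 l powr Q * modular_density W x)" for x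
    proof -
      have "modular_density k x \<le> 2 powr Q * (modular_density k' x + modular_density (\<lambda>x. l *\<^sub>R W x) x)"
        by (rule modular_density_le_sum) (rule k(3))
      also have "\<dots> \<le> 2 powr Q * (modular_density k' x + max 1 l powr Q * modular_density W x)"
        using l by (intro mult_left_mono add_left_mono modular_density_scale) auto
      finally show ?thesis .
    qed
  qed
  have vW1: "v \<in> W1_space \<Omega> \<phi>"
  proof -
    note wv = weak_gradient_AE_eq[OF open_dom bv vB_ae]
    have "integrable lborel (modular_density vB)"
    proof (rule md_bound[OF _ mdu])
      show "norm (vB x) \<le> norm (u' x) + norm (l *\<^sub>R W x)" for x
        using sW(1)[of x] norm_triangle_sub[of "vB x" "u' x"] by (simp add: norm_minus_commute)
    qed measurable
    then have "v \<in> L_space \<Omega> \<phi>" using vB_ae by (subst L_space_iff[of vB vB]) auto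
    moreover have "integrable lborel (modular_density gB)"
    proof (rule md_bound[OF _ mdg])
      show "norm (gB x) \<le> norm (g' x) + norm (l *\<^sub>R W x)" for x
        using sW(2)[of x] norm_triangle_sub[of "gB x" "g' x"] by (simp add: norm_minus_commute)
    qed measurable
    moreover have "AE x in lborel. x \<in> \<Omega> \<longrightarrow> norm (weak_gradient \<Omega> v x) = norm (gB x)"
      using wv(2) by eventually_elim auto
    ultimately show ?thesis
      using wv(1) L_space_iff[of gB "\<lambda>x. norm (gB x)" "\<lambda>x. norm (weak_gradient \<Omega> v x)"]
      by (auto simp: W1_space_def)
  qed
  have "W1_norm \<Omega> \<phi> (\<lambda>x. u x - v x) \<le> l"
    unfolding W1_norm_def
  proof (rule cInf_lower, intro CollectI conjI l)
    have ae: "AE x in lborel. x \<in> \<Omega> \<longrightarrow> u x - v x = u' x - vB x"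
      using u'(2) vB_ae by eventually_elim auto
    note wd = weak_gradient_AE_eq[OF open_dom borel_weak_gradient_diff[OF bw bv] ae]
    have "modular \<Omega> \<phi> (\<lambda>x. (u x - v x) / l) = (\<integral>\<^sup>+x. ennreal (modular_density (\<lambda>x. (u' x - vB x) / l) x) \<partial>lborel)"
    proof (rule modular_eq_density)
      show "AE x in lborel. x \<in> \<Omega> \<longrightarrow> \<bar>(u x - v x) / l\<bar> = norm ((u' x - vB x) / l)"
        using ae by eventually_elim auto
    qed
    also have "\<dots> \<le> (\<integral>\<^sup>+x. ennreal (modular_density W x) \<partial>lborel)"
    proof (intro nn_integral_mono ennreal_leI modular_density_mono)
      show "norm ((u' x - vB x) / l) \<le> norm (W x)" for x
        using sW(1)[of x] l by (simp add: field_simps)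
    qed
    finally have 1: "modular \<Omega> \<phi> (\<lambda>x. (u x - v x) / l) \<le> ennreal (1 / 2)" using W_small by (rule order_trans)
    have "modular \<Omega> \<phi> (\<lambda>x. norm (weak_gradient \<Omega> (\<lambda>x. u x - v x) x) / l)
      = (\<integral>\<^sup>+x. ennreal (modular_density (\<lambda>x. (g' x - gB x) /\<^sub>R l) x) \<partial>lborel)"
    proof (rule modular_eq_density)
      show "AE x in lborel. x \<in> \<Omega> \<longrightarrow> \<bar>norm (weak_gradient \<Omega> (\<lambda>x. u x - v x) x) / l\<bar> = norm ((g' x - gB x) /\<^sub>R l)"
        using wd(2) by eventually_elim (use l in \<open>auto simp: divide_inverse\<close>)
    qed
    also have "\<dots> \<le> (\<integral>\<^sup>+x. ennreal (modular_density W x) \<partial>lborel)"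
    proof (intro nn_integral_mono ennreal_leI modular_density_mono)
      show "norm ((g' x - gB x) /\<^sub>R l) \<le> norm (W x)" for x
      proof -
        have "(g' x - gB x) /\<^sub>R l = snd (W x)" unfolding W_def snd_scaleR snd_conv inverse_eq_divide ..
        then show ?thesis using norm_snd_le[of "snd (W x)" "fst (W x)"] by (simp only: prod.collapse)
      qed
    qed
    finally have 2: "modular \<Omega> \<phi> (\<lambda>x. norm (weak_gradient \<Omega> (\<lambda>x. u x - v x) x) / l) \<le> ennreal (1 / 2)"
      using W_small by (rule order_trans)
    have "1 = ennreal (1 / 2 + 1 / 2)" by simp
    also have "\<dots> = ennreal (1 / 2) + ennreal (1 / 2)" by (rule ennreal_plus) auto
    finally have half: "ennreal (1 / 2) + ennreal (1 / 2) = 1" by (rule sym)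
    show "modular \<Omega> \<phi> (\<lambda>x. (u x - v x) / l) + modular \<Omega> \<phi> (\<lambda>x. norm (weak_gradient \<Omega> (\<lambda>x. u x - v x) x) / l) \<le> 1"
      using add_mono[OF 1 2] unfolding half .
  next
    show "bdd_below {l. 0 < l \<and> modular \<Omega> \<phi> (\<lambda>x. (u x - v x) / l)
        + modular \<Omega> \<phi> (\<lambda>x. norm (weak_gradient \<Omega> (\<lambda>x. u x - v x) x) / l) \<le> 1}"
      by (rule bdd_belowI[of _ 0]) auto
  qed
  then have "W1_norm \<Omega> \<phi> (\<lambda>x. u x - v x) < \<epsilon>" using \<epsilon> by (simp add: l_def)
  then show "\<exists>v\<in>{u. smooth_on \<Omega> u} \<inter> W1_space \<Omega> \<phi>. W1_norm \<Omega> \<phi> (\<lambda>x. u x - v x) < \<epsilon>"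
    using vs vW1 by blast
qed blast

end

section \<open>The logarithmic double phase function\<close>

lemma powr_mult_ln_le:
  assumes "0 < \<epsilon>" "0 < \<alpha>" shows "\<epsilon> powr \<alpha> * ln (1 / \<epsilon>) \<le> 1 / (\<alpha>::real)"
proof -
  have "\<alpha> * ln (1 / \<epsilon>) = ln (\<epsilon> powr (- \<alpha>))" using assms by (simp add: ln_powr ln_div)
  also have "\<dots> \<le> \<epsilon> powr (- \<alpha>)" using assms ln_le_minus_one[of "\<epsilon> powr (- \<alpha>)"] by simp
  finally have "\<epsilon> powr \<alpha> * (\<alpha> * ln (1 / \<epsilon>)) \<le> \<epsilon> powr \<alpha> * \<epsilon> powr (- \<alpha>)"
    by (intro mult_left_mono) auto
  also have "\<dots> = 1" using assms by (simp flip: powr_add)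
  finally show ?thesis using assms by (simp add: field_simps)
qed

text \<open>A quantity that is at most polynomially large in \<open>1/\<epsilon>\<close> has a logarithm that any power of \<open>\<epsilon>\<close> absorbs.\<close>

lemma powr_mult_ln_bound:
  fixes \<epsilon> s A R N \<eta> :: real
  assumes "0 < \<epsilon>" "\<epsilon> \<le> R" "1 \<le> s" "s \<le> A * \<epsilon> powr (- N)" "0 \<le> N" "0 < \<eta>"
  shows "\<epsilon> powr \<eta> * ln s \<le> R powr \<eta> * \<bar>ln A\<bar> + N / \<eta>"
proof -
  have A: "0 < A" using assms by (smt (verit) powr_gt_zero zero_less_mult_iff)
  have "ln s \<le> ln (A * \<epsilon> powr (- N))" using assms by (subst ln_le_cancel_iff) auto
  also have "\<dots> = ln A + N * ln (1 / \<epsilon>)" using A assms by (simp add: ln_mult ln_powr ln_div)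
  finally have "\<epsilon> powr \<eta> * ln s \<le> \<epsilon> powr \<eta> * (ln A + N * ln (1 / \<epsilon>))" by (intro mult_left_mono) auto
  also have "\<dots> = \<epsilon> powr \<eta> * ln A + N * (\<epsilon> powr \<eta> * ln (1 / \<epsilon>))" by (simp add: algebra_simps)
  also have "\<dots> \<le> R powr \<eta> * \<bar>ln A\<bar> + N * (1 / \<eta>)"
    using assms powr_mult_ln_le[OF assms(1,6)]
    by (intro add_mono mult_left_mono order_trans[OF mult_left_mono[OF abs_ge_self] mult_right_mono]) (auto intro!: powr_mono2)
  finally show ?thesis by simp
qed

lemma exp_1_plus_ge: "0 \<le> t \<Longrightarrow> 1 \<le> exp 1 + (t::real)"
  using exp_ge_add_one_self[of 1] by linarith

lemma ln_ge_1: "0 \<le> t \<Longrightarrow> 1 \<le> ln (exp 1 + t)" for t :: real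
  using ln_le_cancel_iff[of "exp 1" "exp 1 + t"] by (simp add: add_pos_nonneg)

lemma powr_le_self: "0 \<le> l \<Longrightarrow> l \<le> 1 \<Longrightarrow> 1 \<le> a \<Longrightarrow> l powr a \<le> (l::real)"
  using powr_mono'[of 1 a l] by simp

text \<open>The logarithm grows at most linearly under dilation, with constant one, because \<open>ln (e + t) \<ge> 1\<close>.\<close>

lemma ln_dilate:
  assumes "1 \<le> l" "0 \<le> t" shows "ln (exp 1 + l * t) \<le> l * ln (exp 1 + t :: real)"
proof -
  have "ln (exp 1 + l * t) - ln (exp 1 + t) \<le> ((exp 1 + l * t) - (exp 1 + t)) / (exp 1 + t)"
    using assms by (intro ln_diff_le) (auto simp: add_pos_nonneg)
  also have "\<dots> = (l - 1) * (t / (exp 1 + t))" by (simp add: algebra_simps diff_divide_distrib)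
  also have "\<dots> \<le> (l - 1) * ln (exp 1 + t)"
    using assms ln_ge_1[of t]
    by (intro mult_left_mono order_trans[OF _ ln_ge_1]) (auto simp: divide_le_eq add_pos_nonneg)
  finally show ?thesis by (simp add: algebra_simps)
qed

text \<open>Above the decay weight, \<open>t\<close> to the power \<open>\<bar>d\<bar>\<close> is at least \<open>c\<close> by the very form of the weight.\<close>

lemma decay_weight_comparison:
  assumes c: "0 < c" "c < 1" and t: "0 < t" "t \<le> 1" "decay_weight c \<bar>d\<bar> \<le> t"
  shows "t powr d \<le> 1 / c"
proof (cases "d = 0")
  case False
  have "c powr (1 / \<bar>d\<bar>) \<le> t" using t(3) False by (simp add: decay_weight_def)
  then have "(c powr (1 / \<bar>d\<bar>)) powr \<bar>d\<bar> \<le> t powr \<bar>d\<bar>" using c by (intro powr_mono2) auto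
  then have "c \<le> t powr \<bar>d\<bar>" using False c by (simp add: powr_powr)
  then have "1 / t powr \<bar>d\<bar> \<le> 1 / c" using c t by (intro divide_left_mono) auto
  then have "t powr (- \<bar>d\<bar>) \<le> 1 / c" using t by (simp add: powr_minus_divide)
  moreover have "t powr d \<le> t powr (- \<bar>d\<bar>)" using t by (intro powr_mono') auto
  ultimately show ?thesis by simp
qed (use c t in auto)

text \<open>The hypotheses of the theorem with their constants made explicit; \<open>gap\<close> is the bound on \<open>q/p\<close>.\<close>

locale log_double_phase =
  fixes S :: "'a::euclidean_space set" and p q \<mu> :: "'a \<Rightarrow> real"
    and \<gamma> \<theta> q\<^sub>m \<mu>\<^sub>m cp \<alpha>p cq \<alpha>q c\<mu> :: real
  assumes p1: "\<And>x. x \<in> S \<Longrightarrow> 1 \<le> p x" and pq: "\<And>x. x \<in> S \<Longrightarrow> p x \<le> q x"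
    and qm: "\<And>x. x \<in> S \<Longrightarrow> q x \<le> q\<^sub>m" and qm0: "0 \<le> q\<^sub>m"
    and mu: "\<And>x. x \<in> S \<Longrightarrow> 0 \<le> \<mu> x" "\<And>x. x \<in> S \<Longrightarrow> \<mu> x \<le> \<mu>\<^sub>m" and mum0: "0 \<le> \<mu>\<^sub>m"
    and holder_p: "\<And>x y. x \<in> S \<Longrightarrow> y \<in> S \<Longrightarrow> \<bar>p x - p y\<bar> \<le> cp * dist x y powr \<alpha>p" "0 \<le> cp" "0 < \<alpha>p"
    and holder_q: "\<And>x y. x \<in> S \<Longrightarrow> y \<in> S \<Longrightarrow> \<bar>q x - q y\<bar> \<le> cq * dist x y powr \<alpha>q" "0 \<le> cq" "0 < \<alpha>q"
    and holder_mu: "\<And>x y. x \<in> S \<Longrightarrow> y \<in> S \<Longrightarrow> \<bar>\<mu> x - \<mu> y\<bar> \<le> c\<mu> * dist x y powr \<gamma>" "0 \<le> c\<mu>" "0 < \<gamma>"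
    and ratio: "\<And>x. x \<in> S \<Longrightarrow> q x \<le> \<theta> * p x" "1 \<le> \<theta>"
    and gap: "real DIM('a) * (\<theta> - 1) < \<gamma>"
begin

definition H :: "'a \<Rightarrow> real \<Rightarrow> real" where
  "H x t = t powr p x + \<mu> x * t powr q x * ln (exp 1 + t)"

lemma q1: "x \<in> S \<Longrightarrow> 1 \<le> q x"
  using p1 pq order_trans by blast

lemma H_ge: "x \<in> S \<Longrightarrow> 0 \<le> t \<Longrightarrow> t powr p x \<le> H x t"
  unfolding H_def using mu(1)[of x] ln_ge_1[of t] by simp

lemma H_zero: "x \<in> S \<Longrightarrow> H x 0 = 0"
  using p1[of x] q1[of x] by (simp add: H_def)

lemma H_strict_mono: "x \<in> S \<Longrightarrow> 0 \<le> s \<Longrightarrow> s < t \<Longrightarrow> H x s < H x t"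
  unfolding H_def using mu(1)[of x] ln_ge_1[of s] ln_ge_1[of t] p1[of x] q1[of x]
  by (intro add_less_le_mono powr_less_mono2 mult_mono mult_left_mono powr_mono2)
    (auto simp: add_pos_nonneg exp_1_plus_ge)

lemma H_mono: "x \<in> S \<Longrightarrow> 0 \<le> s \<Longrightarrow> s \<le> t \<Longrightarrow> H x s \<le> H x t"
  using H_strict_mono[of x s t] by (cases "s = t") auto

lemma H_contract:
  assumes x: "x \<in> S" and l: "0 \<le> l" "l \<le> 1" and t: "0 \<le> t"
  shows "H x (l * t) \<le> l * H x t"
proof -
  have "l * t \<le> t" using l t by (simp add: mult_left_le_one_le)
  then have "H x (l * t) \<le> l * t powr p x + \<mu> x * (l * t powr q x) * ln (exp 1 + t)"
    unfolding H_def powr_mult using l t mu(1)[OF x] ln_ge_1[of "l * t"]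
    by (intro add_mono mult_mono mult_left_mono mult_right_mono powr_le_self p1[OF x] q1[OF x])
      (auto simp: add_pos_nonneg exp_1_plus_ge)
  then show ?thesis by (simp add: H_def algebra_simps)
qed

lemma H_dilate:
  assumes x: "x \<in> S" and l: "1 \<le> l" and t: "0 \<le> t"
  shows "H x (l * t) \<le> l powr (q\<^sub>m + 1) * H x t"
proof -
  have "l powr p x \<le> l powr (q\<^sub>m + 1)" "l powr q x \<le> l powr q\<^sub>m"
    using l pq[OF x] qm[OF x] by (auto intro!: powr_mono)
  then have "H x (l * t) \<le> l powr (q\<^sub>m + 1) * t powr p x + \<mu> x * (l powr q\<^sub>m * t powr q x) * (l * ln (exp 1 + t))"
    unfolding H_def powr_mult using l t mu(1)[OF x] ln_ge_1[of "l * t"]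
    by (intro add_mono mult_mono mult_left_mono mult_right_mono ln_dilate) (auto simp: add_pos_nonneg exp_1_plus_ge)
  also have "\<dots> = l powr (q\<^sub>m + 1) * H x t"
    using l by (simp add: H_def powr_add algebra_simps)
  finally show ?thesis .
qed

lemma H_cont: "x \<in> S \<Longrightarrow> continuous_on {0..} (H x)"
  unfolding H_def[abs_def] using p1[of x] q1[of x]
  by (intro continuous_intros continuous_on_powr' continuous_on_ln)
    (auto simp: add_nonneg_eq_0_iff dest: add_pos_nonneg[of "exp 1"])

definition H\<^sub>1 :: real where "H\<^sub>1 = 1 + \<mu>\<^sub>m * ln (exp 1 + 1)"

lemma H1_ge: "1 \<le> H\<^sub>1"
  using mum0 ln_ge_1[of 1] by (simp add: H\<^sub>1_def)

lemma H_at_1: "x \<in> S \<Longrightarrow> 1 \<le> H x 1" "x \<in> S \<Longrightarrow> H x 1 \<le> H\<^sub>1"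
  using mu[of x] ln_ge_1[of 1] by (auto simp: H_def H\<^sub>1_def intro!: mult_right_mono)

lemma H_surj:
  assumes x: "x \<in> S" and r: "0 \<le> r"
  obtains t where "0 \<le> t" "H x t = r"
proof -
  have "r \<le> max 1 r powr 1" by simp
  also have "\<dots> \<le> max 1 r powr p x" using p1[OF x] by (intro powr_mono) auto
  also have "\<dots> \<le> H x (max 1 r)" by (rule H_ge[OF x]) simp
  finally have "r \<le> H x (max 1 r)" .
  moreover have "H x 0 \<le> r" using H_zero[OF x] r by simp
  moreover have "continuous_on {0..max 1 r} (H x)" by (rule continuous_on_subset[OF H_cont[OF x]]) auto
  ultimately show thesis using IVT'[of "H x" 0 r "max 1 r"] that by force
qed

text \<open>Changing the exponent by at most \<open>c \<epsilon>\<^sup>\<alpha>\<close> changes a power of \<open>s\<close> by the factor \<open>exp (c \<epsilon>\<^sup>\<alpha> ln s)\<close>, which is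
bounded while \<open>s\<close> is at most polynomially large in \<open>1/\<epsilon>\<close>.\<close>

lemma holder_exponent_comparison:
  fixes f :: "'a \<Rightarrow> real"
  assumes A: "1 \<le> A" and R: "0 < R"
    and f: "\<And>x y. x \<in> S \<Longrightarrow> y \<in> S \<Longrightarrow> \<bar>f x - f y\<bar> \<le> c * dist x y powr \<alpha>" "0 \<le> c" "0 < \<alpha>"
  obtains L where "1 \<le> L" "\<And>x y \<epsilon> s. x \<in> S \<Longrightarrow> y \<in> S \<Longrightarrow> 0 < \<epsilon> \<Longrightarrow> \<epsilon> \<le> R \<Longrightarrow> dist x y \<le> \<epsilon> \<Longrightarrow> 1 \<le> s \<Longrightarrow>
    s \<le> A * \<epsilon> powr (- real DIM('a)) \<Longrightarrow> s powr f x \<le> L * s powr f y"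
proof
  let ?B = "R powr \<alpha> * \<bar>ln A\<bar> + real DIM('a) / \<alpha>"
  let ?L = "exp (c * ?B)"
  have B: "0 \<le> ?B" using f(3) by simp
  then show "1 \<le> ?L" using f(2) by simp
  fix x y \<epsilon> s assume *: "x \<in> S" "y \<in> S" "0 < \<epsilon>" "\<epsilon> \<le> R" "dist x y \<le> \<epsilon>" "1 \<le> s" "s \<le> A * \<epsilon> powr (- real DIM('a))"
  have "(f x - f y) * ln s \<le> (c * \<epsilon> powr \<alpha>) * ln s"
  proof (rule mult_right_mono)
    have "f x - f y \<le> c * dist x y powr \<alpha>" using f(1)[of x y] * by linarith
    also have "\<dots> \<le> c * \<epsilon> powr \<alpha>" using * f by (intro mult_left_mono powr_mono2) auto
    finally show "f x - f y \<le> c * \<epsilon> powr \<alpha>" .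
  qed (use * in simp)
  also have "\<dots> = c * (\<epsilon> powr \<alpha> * ln s)" by simp
  also have "\<dots> \<le> c * ?B"
    using * f by (intro mult_left_mono powr_mult_ln_bound) auto
  finally have "s powr (f x - f y) \<le> ?L" using * by (simp add: powr_def)
  then have "s powr (f x - f y) * s powr f y \<le> ?L * s powr f y" by (intro mult_right_mono) auto
  then show "s powr f x \<le> ?L * s powr f y" by (simp flip: powr_add)
qed

text \<open>The error \<open>c\<^sub>\<mu> \<epsilon>\<^sup>\<gamma> s\<^sup>q ln (e + s)\<close> made by replacing \<open>\<mu>(x)\<close> by \<open>\<mu>(y)\<close> is absorbed by \<open>s\<^sup>p\<close>: by the bound on
\<open>q/p\<close>, \<open>s\<^sup>q\<close> exceeds \<open>s\<^sup>p\<close> by at most \<open>\<epsilon>\<close> to the power \<open>-N(\<theta> - 1)\<close>, and the remaining positive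
power \<open>\<eta> = \<gamma> - N(\<theta> - 1)\<close> of \<open>\<epsilon>\<close> absorbs the logarithm.\<close>

lemma H_comparison:
  assumes A: "1 \<le> A" and R: "0 < R"
  obtains C where "0 < C" "\<And>x y \<epsilon> s. x \<in> S \<Longrightarrow> y \<in> S \<Longrightarrow> 0 < \<epsilon> \<Longrightarrow> \<epsilon> \<le> R \<Longrightarrow> dist x y \<le> \<epsilon> \<Longrightarrow> 1 \<le> s \<Longrightarrow>
    s powr p x \<le> A * \<epsilon> powr (- real DIM('a)) \<Longrightarrow> H x s \<le> C * H y s"
proof -
  let ?N = "real DIM('a)"
  obtain Lp where Lp: "1 \<le> Lp" "\<And>x y \<epsilon> s. x \<in> S \<Longrightarrow> y \<in> S \<Longrightarrow> 0 < \<epsilon> \<Longrightarrow> \<epsilon> \<le> R \<Longrightarrow> dist x y \<le> \<epsilon> \<Longrightarrow> 1 \<le> s \<Longrightarrow>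
    s \<le> A * \<epsilon> powr (- ?N) \<Longrightarrow> s powr p x \<le> Lp * s powr p y"
    using holder_exponent_comparison[OF A R holder_p] by metis
  obtain Lq where Lq: "1 \<le> Lq" "\<And>x y \<epsilon> s. x \<in> S \<Longrightarrow> y \<in> S \<Longrightarrow> 0 < \<epsilon> \<Longrightarrow> \<epsilon> \<le> R \<Longrightarrow> dist x y \<le> \<epsilon> \<Longrightarrow> 1 \<le> s \<Longrightarrow>
    s \<le> A * \<epsilon> powr (- ?N) \<Longrightarrow> s powr q x \<le> Lq * s powr q y"
    using holder_exponent_comparison[OF A R holder_q] by metis
  define \<eta> where "\<eta> = \<gamma> - ?N * (\<theta> - 1)"
  have \<eta>: "0 < \<eta>" using gap by (simp add: \<eta>_def)
  define L where "L = R powr \<eta> * ln (exp 1 + 1) + (R powr \<eta> * \<bar>ln A\<bar> + ?N / \<eta>)"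
  have L: "0 \<le> L" using \<eta> ln_ge_1[of 1] by (simp add: L_def)
  define C3 where "C3 = c\<mu> * A powr (\<theta> - 1) * L * Lp"
  have C3: "0 \<le> C3" using holder_mu(2) L Lp by (simp add: C3_def)
  show thesis
  proof (rule that)
    show "0 < Lp + Lq + C3" using Lp Lq C3 by linarith
    fix x y \<epsilon> s assume x: "x \<in> S" and y: "y \<in> S" and \<epsilon>: "0 < \<epsilon>" "\<epsilon> \<le> R" and d: "dist x y \<le> \<epsilon>" and s: "1 \<le> s"
      and sp: "s powr p x \<le> A * \<epsilon> powr (- ?N)"
    have "s powr 1 \<le> s powr p x" using s p1[OF x] by (intro powr_mono) auto
    then have sA: "s \<le> A * \<epsilon> powr (- ?N)" using sp s by simp
    let ?l = "ln (exp 1 + s)"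
    have l: "1 \<le> ?l" using s by (intro ln_ge_1) simp
    have cp: "s powr p x \<le> Lp * s powr p y" by (rule Lp(2)[OF x y \<epsilon> d s sA])
    have cq: "s powr q x \<le> Lq * s powr q y" by (rule Lq(2)[OF x y \<epsilon> d s sA])
    have lb: "\<epsilon> powr \<eta> * ?l \<le> L"
    proof -
      have "ln (exp 1 + s) \<le> ln ((exp 1 + 1) * s)"
        using s by (subst ln_le_cancel_iff) (auto simp: add_pos_pos algebra_simps mult_ge1_I)
      also have "\<dots> = ln (exp 1 + 1) + ln s" using s by (intro ln_mult_pos add_pos_pos exp_gt_zero) auto
      finally have "\<epsilon> powr \<eta> * ?l \<le> \<epsilon> powr \<eta> * (ln (exp 1 + 1) + ln s)" by (intro mult_left_mono) auto
      also have "\<dots> = \<epsilon> powr \<eta> * ln (exp 1 + 1) + \<epsilon> powr \<eta> * ln s" by (simp add: distrib_left)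
      also have "\<dots> \<le> L"
        unfolding L_def using \<epsilon> \<eta> s sA ln_ge_1[of 1]
        by (intro add_mono mult_right_mono powr_mono2 powr_mult_ln_bound) auto
      finally show ?thesis .
    qed
    have sq: "s powr q x \<le> s powr p x * (A powr (\<theta> - 1) * \<epsilon> powr (- (?N * (\<theta> - 1))))"
    proof -
      have "s powr q x \<le> s powr (p x + p x * (\<theta> - 1))"
        using s ratio(1)[OF x] by (intro powr_mono) (auto simp: algebra_simps)
      also have "\<dots> = s powr p x * (s powr p x) powr (\<theta> - 1)" by (simp add: powr_add powr_powr)
      also have "\<dots> \<le> s powr p x * (A * \<epsilon> powr (- ?N)) powr (\<theta> - 1)"
        using sp ratio(2) by (intro mult_left_mono powr_mono2) auto
      also have "(A * \<epsilon> powr (- ?N)) powr (\<theta> - 1) = A powr (\<theta> - 1) * \<epsilon> powr (- (?N * (\<theta> - 1)))"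
        using A by (simp add: powr_mult powr_powr)
      finally show ?thesis .
    qed
    have "\<mu> x \<le> \<mu> y + c\<mu> * \<epsilon> powr \<gamma>"
    proof -
      have "\<mu> x \<le> \<mu> y + c\<mu> * dist x y powr \<gamma>" using holder_mu(1)[OF x y] by linarith
      also have "c\<mu> * dist x y powr \<gamma> \<le> c\<mu> * \<epsilon> powr \<gamma>"
        using d holder_mu by (intro mult_left_mono powr_mono2) auto
      finally show ?thesis by simp
    qed
    then have "\<mu> x * s powr q x * ?l \<le> (\<mu> y + c\<mu> * \<epsilon> powr \<gamma>) * s powr q x * ?l"
      using l by (intro mult_right_mono) auto
    also have "\<dots> = \<mu> y * s powr q x * ?l + c\<mu> * \<epsilon> powr \<gamma> * s powr q x * ?l" by (simp add: algebra_simps)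
    also have "\<mu> y * s powr q x * ?l \<le> \<mu> y * (Lq * s powr q y) * ?l"
      using cq mu(1)[OF y] l by (intro mult_right_mono mult_left_mono) auto
    also have "c\<mu> * \<epsilon> powr \<gamma> * s powr q x * ?l \<le> C3 * s powr p y"
    proof -
      have "c\<mu> * \<epsilon> powr \<gamma> * s powr q x * ?l
          \<le> c\<mu> * \<epsilon> powr \<gamma> * (s powr p x * (A powr (\<theta> - 1) * \<epsilon> powr (- (?N * (\<theta> - 1))))) * ?l"
        using sq holder_mu(2) l by (intro mult_right_mono mult_left_mono) auto
      also have "\<dots> = c\<mu> * A powr (\<theta> - 1) * s powr p x * ((\<epsilon> powr \<gamma> * \<epsilon> powr (- (?N * (\<theta> - 1)))) * ?l)"
        by (simp add: mult_ac)
      also have "\<epsilon> powr \<gamma> * \<epsilon> powr (- (?N * (\<theta> - 1))) = \<epsilon> powr \<eta>" by (simp add: \<eta>_def flip: powr_add)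
      also have "c\<mu> * A powr (\<theta> - 1) * s powr p x * (\<epsilon> powr \<eta> * ?l) \<le> c\<mu> * A powr (\<theta> - 1) * (Lp * s powr p y) * L"
        using lb cp holder_mu(2) l Lp by (intro mult_mono mult_left_mono) auto
      also have "\<dots> = C3 * s powr p y" by (simp add: C3_def mult_ac)
      finally show ?thesis .
    qed
    finally have "H x s \<le> Lp * s powr p y + (\<mu> y * (Lq * s powr q y) * ?l + C3 * s powr p y)"
      unfolding H_def using cp by linarith
    also have "\<dots> = (Lp + C3) * s powr p y + Lq * (\<mu> y * s powr q y * ?l)" by (simp add: algebra_simps)
    also have "\<dots> \<le> (Lp + Lq + C3) * s powr p y + (Lp + Lq + C3) * (\<mu> y * s powr q y * ?l)"
      using Lp Lq C3 mu(1)[OF y] l by (intro add_mono mult_right_mono) auto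
    also have "\<dots> = (Lp + Lq + C3) * H y s" by (simp add: H_def algebra_simps)
    finally show "H x s \<le> (Lp + Lq + C3) * H y s" .
  qed
qed

text \<open>The bound on the power at \<open>x\<close> passes to \<open>y\<close> at the price of a larger constant, so that the two points may be
exchanged.\<close>

lemma H_comparison':
  assumes A: "1 \<le> A" and R: "0 < R"
  obtains C where "0 < C" "\<And>x y \<epsilon> s. x \<in> S \<Longrightarrow> y \<in> S \<Longrightarrow> 0 < \<epsilon> \<Longrightarrow> \<epsilon> \<le> R \<Longrightarrow> dist x y \<le> \<epsilon> \<Longrightarrow> 1 \<le> s \<Longrightarrow>
    s powr p x \<le> A * \<epsilon> powr (- real DIM('a)) \<Longrightarrow> H y s \<le> C * H x s"
proof -
  let ?N = "real DIM('a)"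
  obtain L where L: "1 \<le> L" "\<And>x y \<epsilon> s. x \<in> S \<Longrightarrow> y \<in> S \<Longrightarrow> 0 < \<epsilon> \<Longrightarrow> \<epsilon> \<le> R \<Longrightarrow> dist x y \<le> \<epsilon> \<Longrightarrow> 1 \<le> s \<Longrightarrow>
    s \<le> A * \<epsilon> powr (- ?N) \<Longrightarrow> s powr p x \<le> L * s powr p y"
    using holder_exponent_comparison[OF A R holder_p] by metis
  have "1 \<le> L * A" using mult_mono[OF L(1) A] L(1) by simp
  then obtain C where C: "0 < C" "\<And>x y \<epsilon> s. x \<in> S \<Longrightarrow> y \<in> S \<Longrightarrow> 0 < \<epsilon> \<Longrightarrow> \<epsilon> \<le> R \<Longrightarrow> dist x y \<le> \<epsilon> \<Longrightarrow> 1 \<le> s \<Longrightarrow>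
    s powr p x \<le> L * A * \<epsilon> powr (- ?N) \<Longrightarrow> H x s \<le> C * H y s"
    using H_comparison[OF _ R] by metis
  show thesis
  proof (rule that[OF C(1)])
    fix x y \<epsilon> s assume x: "x \<in> S" and y: "y \<in> S" and \<epsilon>: "0 < \<epsilon>" "\<epsilon> \<le> R" and d: "dist x y \<le> \<epsilon>" and s: "1 \<le> s"
      and sp: "s powr p x \<le> A * \<epsilon> powr (- ?N)"
    have "s powr 1 \<le> s powr p x" using s p1[OF x] by (intro powr_mono) auto
    then have sA: "s \<le> A * \<epsilon> powr (- ?N)" using sp s by simp
    have d': "dist y x \<le> \<epsilon>" using d by (simp add: dist_commute)
    have "s powr p y \<le> L * s powr p x" by (rule L(2)[OF y x \<epsilon> d' s sA])
    also have "\<dots> \<le> L * (A * \<epsilon> powr (- ?N))" using sp L(1) by (intro mult_left_mono) auto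
    finally show "H y s \<le> C * H x s" by (intro C(2)[OF y x \<epsilon> d' s]) (simp add: mult.assoc)
  qed
qed

lemma H_log_eq: "H_log p q \<mu> x t = ennreal (H x t)"
  by (simp add: H_log_def H_def)

lemma phi_inv_le:
  assumes "0 \<le> t" "r \<le> H x t" shows "phi_inv (H_log p q \<mu>) x r \<le> ennreal t"
  unfolding phi_inv_def H_log_eq using assms by (intro Inf_lower) (auto intro: ennreal_leI)

lemma phi_inv_ge:
  assumes "0 < r" "\<And>t. 0 \<le> t \<Longrightarrow> r \<le> H x t \<Longrightarrow> b \<le> t"
  shows "ennreal b \<le> phi_inv (H_log p q \<mu>) x r"
  unfolding phi_inv_def H_log_eq
proof (rule Inf_greatest, clarify)
  fix t :: real assume t: "0 \<le> t" "ennreal r \<le> ennreal (H x t)"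
  then have "r \<le> H x t" using assms(1) by (cases "0 \<le> H x t") (auto simp: ennreal_le_iff ennreal_neg)
  then show "ennreal b \<le> ennreal t" using assms(2) t(1) by (intro ennreal_leI) auto
qed

text \<open>A height below which \<open>H\<close> is less than one, uniformly in \<open>x\<close>.\<close>

definition \<beta>\<^sub>0 :: real where "\<beta>\<^sub>0 = 1 / (2 * H\<^sub>1)"

lemma beta0: "0 < \<beta>\<^sub>0" "\<beta>\<^sub>0 \<le> 1 / 2"
  using H1_ge by (auto simp: \<beta>\<^sub>0_def divide_le_eq)

lemma H_beta0: "x \<in> S \<Longrightarrow> H x \<beta>\<^sub>0 < 1"
proof -
  assume x: "x \<in> S"
  have "H x (\<beta>\<^sub>0 * 1) \<le> \<beta>\<^sub>0 * H x 1" using beta0 by (intro H_contract x) auto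
  also have "\<dots> \<le> \<beta>\<^sub>0 * H\<^sub>1" using beta0 H_at_1(2)[OF x] by (intro mult_left_mono) auto
  also have "\<dots> < 1" using H1_ge by (simp add: \<beta>\<^sub>0_def)
  finally show ?thesis by simp
qed

lemma le_of_H_le:
  assumes "x \<in> S" "0 \<le> t" "0 \<le> b" "H x b < r" "r \<le> H x t"
  shows "b \<le> t"
  using H_mono[of x t b] assms by force

lemma A0:
  assumes "open \<Omega>" "\<Omega> \<subseteq> S"
  shows "cond_A0 \<Omega> (H_log p q \<mu>)"
  unfolding cond_A0_def
proof (intro exI conjI)
  show "0 < \<beta>\<^sub>0" "\<beta>\<^sub>0 \<le> 1" using beta0 by auto
  have "ennreal \<beta>\<^sub>0 \<le> phi_inv (H_log p q \<mu>) x 1 \<and> phi_inv (H_log p q \<mu>) x 1 \<le> ennreal (1 / \<beta>\<^sub>0)" if "x \<in> \<Omega>" for x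
  proof
    have x: "x \<in> S" using that assms by auto
    show "ennreal \<beta>\<^sub>0 \<le> phi_inv (H_log p q \<mu>) x 1"
      using beta0 H_beta0[OF x] le_of_H_le[OF x] by (intro phi_inv_ge) auto
    have "phi_inv (H_log p q \<mu>) x 1 \<le> ennreal 1" using H_at_1[OF x] by (intro phi_inv_le) auto
    also have "\<dots> \<le> ennreal (1 / \<beta>\<^sub>0)" using beta0 by (intro ennreal_leI) simp
    finally show "phi_inv (H_log p q \<mu>) x 1 \<le> ennreal (1 / \<beta>\<^sub>0)" .
  qed
  then show "AE x in lebesgue_on \<Omega>. ennreal \<beta>\<^sub>0 \<le> phi_inv (H_log p q \<mu>) x 1 \<and> phi_inv (H_log p q \<mu>) x 1 \<le> ennreal (1 / \<beta>\<^sub>0)"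
    by (intro AE_I2) (simp add: space_restrict_space)
qed

text \<open>With \<open>t = H(x,s) \<le> 1/\<bar>B\<bar>\<close> and \<open>\<epsilon>\<close> the diameter of the ball, the comparison gives \<open>H(y,s) \<le> C t\<close>, hence
\<open>H(y,\<beta> s) < t\<close> for small \<open>\<beta>\<close>; heights \<open>s \<le> 1\<close> are covered by \<open>\<beta>\<^sub>0\<close>, because \<open>t \<ge> 1\<close>.\<close>

lemma A1:
  assumes "\<Omega> \<subseteq> S"
  shows "cond_A1 \<Omega> (H_log p q \<mu>)"
proof -
  let ?N = "DIM('a)"
  let ?V = "unit_ball_vol (real ?N)"
  have V: "0 < ?V" by simp
  \<comment> \<open>A ball of measure at most \<open>1\<close> has radius at most \<open>R/2\<close>; \<open>A\<close> converts \<open>1/\<bar>B\<bar>\<close> into a power of the diameter.\<close>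
  define R where "R = 2 * max 1 (1 / ?V)"
  define A where "A = max 1 (2 ^ ?N / ?V)"
  obtain C where C: "0 < C" "\<And>x y \<epsilon> s. x \<in> S \<Longrightarrow> y \<in> S \<Longrightarrow> 0 < \<epsilon> \<Longrightarrow> \<epsilon> \<le> R \<Longrightarrow> dist x y \<le> \<epsilon> \<Longrightarrow> 1 \<le> s \<Longrightarrow>
    s powr p x \<le> A * \<epsilon> powr (- real ?N) \<Longrightarrow> H y s \<le> C * H x s"
    using H_comparison'[of A R] by (auto simp: A_def R_def)
  define \<beta> where "\<beta> = min \<beta>\<^sub>0 (1 / (2 * C))"
  have \<beta>: "0 < \<beta>" "\<beta> \<le> \<beta>\<^sub>0" "\<beta> * C < 1" "\<beta> \<le> 1"
  proof -
    have "\<beta> * C \<le> 1 / (2 * C) * C" unfolding \<beta>_def using C by (intro mult_right_mono) auto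
    then show "\<beta> * C < 1" using C by simp
  qed (use beta0 C in \<open>auto simp: \<beta>_def min_le_iff_disj\<close>)
  have main: "ennreal \<beta> * phi_inv (H_log p q \<mu>) x t \<le> phi_inv (H_log p q \<mu>) y t"
    if r: "0 < r" "measure lebesgue (ball z r) \<le> 1" and x: "x \<in> ball z r \<inter> \<Omega>" and y: "y \<in> ball z r \<inter> \<Omega>"
      and t: "1 \<le> t" "t \<le> 1 / measure lebesgue (ball z r)" for x y z :: 'a and r t
  proof -
    have xS: "x \<in> S" "y \<in> S" using x y assms by auto
    have m: "measure lebesgue (ball z r) = ?V * r ^ ?N" using r by (simp add: content_ball)
    have rR: "2 * r \<le> R"
    proof (cases "r \<le> 1")
      case False
      then have "r ^ 1 \<le> r ^ ?N" by (intro power_increasing) (auto simp: Suc_le_eq)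
      also have "\<dots> \<le> 1 / ?V" using r m V by (simp add: field_simps)
      finally show ?thesis by (simp add: R_def)
    qed (simp add: R_def)
    obtain s where s: "0 \<le> s" "H x s = t" using H_surj[OF xS(1), of t] t by auto
    have "H y (\<beta> * s) < t"
    proof (cases "s \<le> 1")
      case True
      have "\<beta> * s \<le> \<beta>\<^sub>0 * 1" using \<beta> True s beta0 by (intro mult_mono) auto
      then have "H y (\<beta> * s) \<le> H y \<beta>\<^sub>0" using s \<beta> by (intro H_mono xS) auto
      then show ?thesis using H_beta0[OF xS(2)] t by simp
    next
      case False
      have d: "dist x y \<le> 2 * r"
        using x y dist_triangle[of x y z] by (auto simp: dist_commute)
      have "s powr p x \<le> t" using H_ge[OF xS(1) s(1)] s by simp
      also have "\<dots> \<le> 1 / (?V * r ^ ?N)" using t m by simp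
      also have "\<dots> = 2 ^ ?N / ?V * (2 * r) powr (- real ?N)"
        using r V by (simp add: powr_minus powr_realpow power_mult_distrib field_simps)
      also have "\<dots> \<le> A * (2 * r) powr (- real ?N)"
        unfolding A_def by (intro mult_right_mono) auto
      finally have "H y s \<le> C * H x s"
        using False r by (intro C(2)[OF xS _ rR d]) auto
      then have "\<beta> * H y s \<le> \<beta> * (C * t)" using s \<beta> by (intro mult_left_mono) auto
      also have "\<dots> < t" using \<beta>(3) t by (simp flip: mult.assoc)
      finally have "\<beta> * H y s < t" .
      moreover have "H y (\<beta> * s) \<le> \<beta> * H y s" using s \<beta> by (intro H_contract xS) auto
      ultimately show ?thesis by simp
    qed
    have "ennreal \<beta> * phi_inv (H_log p q \<mu>) x t \<le> ennreal \<beta> * ennreal s"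
      using s by (intro mult_left_mono phi_inv_le) auto
    also have "\<dots> = ennreal (\<beta> * s)" using \<beta> s by (simp add: ennreal_mult)
    also have "\<dots> \<le> phi_inv (H_log p q \<mu>) y t"
      using t \<beta> s \<open>H y (\<beta> * s) < t\<close> le_of_H_le[OF xS(2)] by (intro phi_inv_ge) auto
    finally show ?thesis .
  qed
  show ?thesis
    unfolding cond_A1_def
  proof (intro exI[of _ \<beta>] conjI allI impI)
    show "\<beta> < 1" using \<beta> beta0 by linarith
    fix z :: 'a and r :: real
    assume r: "0 < r \<and> measure lebesgue (ball z r) \<le> 1"
    show "AE x in lebesgue_on (ball z r \<inter> \<Omega>). AE y in lebesgue_on (ball z r \<inter> \<Omega>). \<forall>t\<in>{1..1 / measure lebesgue (ball z r)}.
        ennreal \<beta> * phi_inv (H_log p q \<mu>) x t \<le> phi_inv (H_log p q \<mu>) y t"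
      by (intro AE_I2 ballI main[of r z]) (use r in \<open>auto simp: space_restrict_space\<close>)
  qed (rule \<beta>)
qed

text \<open>The exponent \<open>q\<^sub>m + 1\<close> has one unit to spare, which absorbs the logarithm.\<close>

lemma aDec:
  assumes "\<Omega> \<subseteq> S"
  shows "cond_aDec \<Omega> (H_log p q \<mu>)"
  unfolding cond_aDec_def
proof (rule exI[of _ "q\<^sub>m + 1"], rule exI[of _ 1], intro conjI AE_I2 allI impI)
  fix x s t assume x: "x \<in> space (lebesgue_on \<Omega>)" and st: "0 < s \<and> s < (t::real)"
  have xS: "x \<in> S" using x assms by (auto simp: space_restrict_space)
  define Q where "Q = q\<^sub>m + 1"
  have "H x (t / s * s) \<le> (t / s) powr Q * H x s" unfolding Q_def using st by (intro H_dilate xS) auto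
  then have "t powr (- Q) * H x t \<le> t powr (- Q) * ((t / s) powr Q * H x s)"
    using st by (intro mult_left_mono) auto
  also have "\<dots> = s powr (- Q) * H x s" using st by (simp add: powr_divide powr_minus_divide)
  finally show "ennreal (t powr (- (q\<^sub>m + 1))) * H_log p q \<mu> x t \<le> ennreal (1 * s powr (- (q\<^sub>m + 1))) * H_log p q \<mu> x s"
    unfolding Q_def by (simp add: H_log_eq flip: ennreal_mult') (rule ennreal_leI, simp)
qed (use qm0 in auto)

text \<open>At heights up to one, \<open>H(x,\<tau>)\<close> lies between \<open>\<tau>\<^sup>p\<close> and \<open>H\<^sub>1 \<tau>\<^sup>p\<close>, so the inverse behaves like \<open>t\<close> to the power
\<open>1/p\<close>. For \<open>t \<ge> h(x) + h(y)\<close> the powers at \<open>x\<close> and at \<open>y\<close> are both compared with the power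
\<open>1/p\<^sub>\<infinity>\<close>, each at the cost of a factor \<open>1/c\<close>; for \<open>t\<close> between \<open>1\<close> and \<open>s\<close> constants suffice.\<close>

lemma A2:
  assumes \<Omega>: "open \<Omega>" "\<Omega> \<subseteq> S" and nek: "nekvinda \<Omega> (\<lambda>x. ereal (p x))"
  shows "cond_A2 \<Omega> (H_log p q \<mu>)"
proof -
  obtain r_inf c where c: "0 < c" "c < 1" and
    fin: "(\<integral>\<^sup>+x. ennreal (decay_weight c \<bar>real_of_ereal (1 / ereal (p x)) - real_of_ereal (1 / r_inf)\<bar>) \<partial>lebesgue_on \<Omega>) < \<infinity>"
    using nek unfolding nekvinda_def by blast
  have [measurable]: "p \<in> borel_measurable (lebesgue_on \<Omega>)"
    using nek borel_measurable_real_of_ereal[of "\<lambda>x. ereal (p x)" "lebesgue_on \<Omega>"] unfolding nekvinda_def by simp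
  define \<kappa> where "\<kappa> = real_of_ereal (1 / r_inf)"
  define h where "h x = decay_weight c \<bar>1 / p x - \<kappa>\<bar>" for x
  have h_eq: "decay_weight c \<bar>real_of_ereal (1 / ereal (p x)) - real_of_ereal (1 / r_inf)\<bar> = h x" if "x \<in> \<Omega>" for x
    using p1[of x] that \<Omega> by (auto simp: h_def \<kappa>_def one_ereal_def)
  have h0: "0 \<le> h x" for x by (simp add: h_def decay_weight_def)
  have h1: "h x \<le> 1" for x
    using c powr_le1[of "1 / \<bar>1 / p x - \<kappa>\<bar>" c] by (simp add: h_def decay_weight_def)
  have hm: "h \<in> borel_measurable (lebesgue_on \<Omega>)"
    unfolding h_def decay_weight_def by measurable
  have hi: "integrable (lebesgue_on \<Omega>) h"
    unfolding integrable_iff_bounded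
  proof
    have "(\<integral>\<^sup>+x. ennreal (norm (h x)) \<partial>lebesgue_on \<Omega>) = (\<integral>\<^sup>+x. ennreal (decay_weight c \<bar>real_of_ereal (1 / ereal (p x)) - real_of_ereal (1 / r_inf)\<bar>) \<partial>lebesgue_on \<Omega>)"
      by (intro nn_integral_cong) (simp add: h_eq h0 space_restrict_space)
    then show "(\<integral>\<^sup>+x. ennreal (norm (h x)) \<partial>lebesgue_on \<Omega>) < \<infinity>" using fin by simp
  qed (rule hm)
  have main: "ennreal (c\<^sup>2 / (H\<^sub>1 * (1 + s))) * phi_inv (H_log p q \<mu>) x t \<le> phi_inv (H_log p q \<mu>) y t"
    if s: "0 < s" and x: "x \<in> \<Omega>" and y: "y \<in> \<Omega>" and t: "h x + h y \<le> t" "t \<le> s" for s x y t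
  proof -
    have xS: "x \<in> S" and yS: "y \<in> S" using x y \<Omega> by auto
    have px: "1 \<le> p x" "1 \<le> p y" using p1 xS yS by auto
    let ?\<beta> = "c\<^sup>2 / (H\<^sub>1 * (1 + s))"
    have \<beta>: "0 < ?\<beta>" using c s H1_ge by simp
    have tx: "h x \<le> t" "h y \<le> t" using t h0[of x] h0[of y] by auto
    show ?thesis
    proof (cases "t = 0")
      case True
      have "phi_inv (H_log p q \<mu>) x t \<le> ennreal 0" using H_zero[OF xS] True by (intro phi_inv_le) auto
      then show ?thesis by simp
    next
      case False
      then have t0: "0 < t" using tx h0[of x] by simp
      define a b where "a = t powr (1 / p x)" and "b = t powr (1 / p y)"
      have a0: "0 < a" "0 < b" using t0 by (auto simp: a_def b_def)
      have "t = a powr p x" using t0 px by (simp add: a_def powr_powr)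
      then have inv: "phi_inv (H_log p q \<mu>) x t \<le> ennreal a"
        using a0 H_ge[OF xS, of a] by (intro phi_inv_le) auto
      have c1: "c\<^sup>2 \<le> 1" using c by (simp add: power_le_one)
      have \<beta>1: "?\<beta> \<le> 1 / (1 + s)" "?\<beta> * (1 + s) \<le> 1 / H\<^sub>1"
      proof -
        have "c\<^sup>2 / H\<^sub>1 \<le> 1 / H\<^sub>1" "1 / H\<^sub>1 \<le> 1" using c1 H1_ge by (auto intro!: divide_right_mono)
        moreover have "?\<beta> = c\<^sup>2 / H\<^sub>1 / (1 + s)" "?\<beta> * (1 + s) = c\<^sup>2 / H\<^sub>1" using s by auto
        ultimately show "?\<beta> \<le> 1 / (1 + s)" "?\<beta> * (1 + s) \<le> 1 / H\<^sub>1"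
          using s divide_right_mono[of "c\<^sup>2 / H\<^sub>1" 1 "1 + s"] by auto
      qed
      have key: "?\<beta> * a \<le> 1 \<and> ?\<beta> * a \<le> b / H\<^sub>1"
      proof (cases "t \<le> 1")
        case True
        have "a \<le> 1" unfolding a_def using True t0 px by (intro powr_le1) auto
        have 1: "t powr (1 / p x - \<kappa>) \<le> 1 / c" "t powr (- (1 / p y - \<kappa>)) \<le> 1 / c"
          by (rule decay_weight_comparison[OF c t0 True]; use tx in \<open>simp add: h_def abs_minus_commute\<close>)+
        have "a = t powr (1 / p x - \<kappa>) * t powr (- (1 / p y - \<kappa>)) * b"
          unfolding a_def b_def by (simp flip: powr_add)
        also have "\<dots> \<le> 1 / c * (1 / c) * b" using 1 a0 c by (intro mult_right_mono mult_mono) auto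
        finally have "c\<^sup>2 * a \<le> b" using c by (simp add: field_simps power2_eq_square)
        have "?\<beta> * a \<le> b / (H\<^sub>1 * (1 + s))"
          using \<open>c\<^sup>2 * a \<le> b\<close> H1_ge s by (simp add: divide_right_mono)
        also have "\<dots> \<le> b / (H\<^sub>1 * 1)" using a0 H1_ge s by (intro divide_left_mono mult_left_mono) auto
        finally have "?\<beta> * a \<le> b / H\<^sub>1" by simp
        moreover have "?\<beta> * a \<le> 1 * 1"
          using \<open>a \<le> 1\<close> \<beta>1(1) a0 s by (intro mult_mono) (auto intro: order_trans)
        ultimately show ?thesis by simp
      next
        case False
        have "a \<le> t powr 1" unfolding a_def using False px by (intro powr_mono) auto
        then have "a \<le> 1 + s" using t False by simp
        then have "?\<beta> * a \<le> ?\<beta> * (1 + s)" using \<beta> by (intro mult_left_mono) auto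
        then have "?\<beta> * a \<le> 1 / H\<^sub>1" using \<beta>1(2) by simp
        moreover have "1 \<le> b" unfolding b_def using False px by (intro ge_one_powr_ge_zero) auto
        then have "1 / H\<^sub>1 \<le> b / H\<^sub>1" using H1_ge by (intro divide_right_mono) auto
        moreover have "1 / H\<^sub>1 \<le> 1" using H1_ge by simp
        ultimately show ?thesis by (blast intro: order_trans)
      qed
      have lower: "?\<beta> * a \<le> \<tau>" if \<tau>: "0 \<le> \<tau>" "t \<le> H y \<tau>" for \<tau>
      proof (cases "\<tau> \<le> 1")
        case True
        have "\<tau> powr q y \<le> \<tau> powr p y" using True \<tau> pq[OF yS] by (intro powr_mono') auto
        then have "\<mu> y * \<tau> powr q y * ln (exp 1 + \<tau>) \<le> \<mu>\<^sub>m * \<tau> powr p y * ln (exp 1 + 1)"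
          using mu[OF yS] mum0 True \<tau> ln_ge_1[of \<tau>] exp_1_plus_ge[of \<tau>]
          by (intro mult_mono) (auto simp: add_pos_nonneg)
        then have "H y \<tau> \<le> \<tau> powr p y * H\<^sub>1" by (simp add: H_def H\<^sub>1_def algebra_simps)
        then have "t / H\<^sub>1 \<le> \<tau> powr p y" using \<tau> H1_ge by (simp add: divide_le_eq)
        then have "(t / H\<^sub>1) powr (1 / p y) \<le> (\<tau> powr p y) powr (1 / p y)"
          using t0 H1_ge px by (intro powr_mono2) auto
        also have "\<dots> = \<tau>" using \<tau> px by (simp add: powr_powr)
        finally have "b / H\<^sub>1 powr (1 / p y) \<le> \<tau>" using t0 H1_ge by (simp add: b_def powr_divide)
        moreover have "H\<^sub>1 powr (1 / p y) \<le> H\<^sub>1 powr 1" using H1_ge px by (intro powr_mono) auto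
        then have "b / H\<^sub>1 \<le> b / H\<^sub>1 powr (1 / p y)" using a0 H1_ge by (intro divide_left_mono) auto
        ultimately show ?thesis using key by linarith
      qed (use key in linarith)
      have "ennreal ?\<beta> * phi_inv (H_log p q \<mu>) x t \<le> ennreal ?\<beta> * ennreal a"
        by (intro mult_left_mono inv) simp
      also have "\<dots> = ennreal (?\<beta> * a)" using \<beta> a0 by (simp only: ennreal_mult less_imp_le)
      also have "\<dots> \<le> phi_inv (H_log p q \<mu>) y t" by (intro phi_inv_ge t0 lower)
      finally show ?thesis .
    qed
  qed
  show ?thesis
    unfolding cond_A2_def
  proof (intro allI impI)
    fix s :: real assume s: "0 < s"
    have "0 < c\<^sup>2 / (H\<^sub>1 * (1 + s))" using c s H1_ge by simp
    moreover have "c\<^sup>2 / (H\<^sub>1 * (1 + s)) \<le> 1"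
    proof -
      have "c\<^sup>2 \<le> 1" using c by (simp add: power_le_one)
      also have "1 \<le> H\<^sub>1 * (1 + s)" using H1_ge s by (intro mult_ge1_I) auto
      finally have "c\<^sup>2 \<le> H\<^sub>1 * (1 + s)" .
      moreover have "0 < H\<^sub>1 * (1 + s)" using H1_ge s by simp
      ultimately show ?thesis by (simp only: divide_le_eq_1_pos)
    qed
    moreover have "\<exists>B. AE x in lebesgue_on \<Omega>. \<bar>h x\<bar> \<le> B"
      using h0 h1 by (intro exI[of _ 1] AE_I2) simp
    moreover have "AE x in lebesgue_on \<Omega>. AE y in lebesgue_on \<Omega>. \<forall>t\<in>{h x + h y..s}.
        ennreal (c\<^sup>2 / (H\<^sub>1 * (1 + s))) * phi_inv (H_log p q \<mu>) x t \<le> phi_inv (H_log p q \<mu>) y t"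
      by (intro AE_I2 ballI main s) (auto simp: space_restrict_space)
    ultimately show "\<exists>\<beta> h. 0 < \<beta> \<and> \<beta> \<le> 1 \<and> integrable (lebesgue_on \<Omega>) h \<and> (\<exists>C. AE x in lebesgue_on \<Omega>. \<bar>h x\<bar> \<le> C) \<and>
        (AE x in lebesgue_on \<Omega>. AE y in lebesgue_on \<Omega>. \<forall>t\<in>{h x + h y..s}.
          ennreal \<beta> * phi_inv (H_log p q \<mu>) x t \<le> phi_inv (H_log p q \<mu>) y t)"
      using hi by blast
  qed
qed

end

section \<open>From the hypotheses on the exponents to the two settings\<close>

lemma holder_on_nonneg_const:
  assumes "holder_on S \<gamma> f"
  obtains c where "0 \<le> c" "0 < \<gamma>" "\<And>x y. x \<in> S \<Longrightarrow> y \<in> S \<Longrightarrow> \<bar>f x - f y\<bar> \<le> c * dist x y powr \<gamma>"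
proof -
  obtain c where c: "0 < \<gamma>" "\<And>x y. x \<in> S \<Longrightarrow> y \<in> S \<Longrightarrow> \<bar>f x - f y\<bar> \<le> c * dist x y powr \<gamma>"
    using assms unfolding holder_on_def by auto
  have "\<bar>f x - f y\<bar> \<le> max c 0 * dist x y powr \<gamma>" if "x \<in> S" "y \<in> S" for x y
    by (rule order_trans[OF c(2)[OF that]]) (intro mult_right_mono, auto)
  then show thesis using that[of "max c 0"] c(1) by auto
qed

lemma holder_on_continuous:
  assumes "holder_on S \<gamma> f" shows "continuous_on S f"
proof -
  obtain c where c: "0 < \<gamma>" "\<And>x y. x \<in> S \<Longrightarrow> y \<in> S \<Longrightarrow> \<bar>f x - f y\<bar> \<le> c * dist x y powr \<gamma>"
    using holder_on_nonneg_const[OF assms] by metis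
  show ?thesis unfolding continuous_on_def
  proof
    fix x assume x: "x \<in> S"
    have "((\<lambda>y. dist y x) \<longlongrightarrow> dist x x) (at x within S)" by (intro tendsto_intros)
    then have "((\<lambda>y. dist y x powr \<gamma>) \<longlongrightarrow> 0 powr \<gamma>) (at x within S)"
      using c(1) by (intro tendsto_powr') auto
    then have "((\<lambda>y. c * dist y x powr \<gamma>) \<longlongrightarrow> 0) (at x within S)"
      using c(1) by (auto intro: tendsto_mult_right_zero)
    moreover have "eventually (\<lambda>y. norm (f y - f x) \<le> c * dist y x powr \<gamma>) (at x within S)"
      using c(2)[OF _ x] by (auto simp: eventually_at_filter)
    ultimately have "((\<lambda>y. f y - f x) \<longlongrightarrow> 0) (at x within S)" by (rule Lim_null_comparison[rotated])
    then show "(f \<longlongrightarrow> f x) (at x within S)" by (rule LIM_zero_cancel)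
  qed
qed

theorem theorem3p13:
  fixes \<Omega> :: "(real ^ 'n) set"
    and p q \<mu> :: "real ^ 'n \<Rightarrow> real"
    and \<gamma> :: real
  assumes "CARD('n) \<ge> 2"
    and "open \<Omega>" and "connected \<Omega>" and "\<not> bounded \<Omega>"
    and "p ` closure \<Omega> \<subseteq> {1..}" and "q ` closure \<Omega> \<subseteq> {1..}" and "\<mu> ` closure \<Omega> \<subseteq> {0..}"
    and "bounded (p ` closure \<Omega>)" and "bounded (q ` closure \<Omega>)" and "bounded (\<mu> ` closure \<Omega>)"
    and "holder_continuous_on (closure \<Omega>) p"
    and "holder_continuous_on (closure \<Omega>) q"
    and "holder_on (closure \<Omega>) \<gamma> \<mu>"
    and "nekvinda \<Omega> (\<lambda>x. ereal (p x))"
    and "\<forall>x\<in>closure \<Omega>. 1 < p x \<and> p x \<le> q x"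
    and "(SUP x\<in>closure \<Omega>. q x / p x) < 1 + \<gamma> / real CARD('n)"
  shows "cond_A0 \<Omega> (H_log p q \<mu>) \<and>
         cond_A1 \<Omega> (H_log p q \<mu>) \<and>
         cond_A2 \<Omega> (H_log p q \<mu>) \<and>
         cond_aDec \<Omega> (H_log p q \<mu>) \<and>
         dense_in_W1 \<Omega> (H_log p q \<mu>)
           ({u. smooth_on \<Omega> u} \<inter> W1_space \<Omega> (H_log p q \<mu>))"
proof -
  let ?S = "closure \<Omega>"
  have \<Omega>: "open \<Omega>" and sub: "\<Omega> \<subseteq> ?S" using assms(2) closure_subset by auto
  obtain x0 where x0: "x0 \<in> ?S" using assms(4) sub by (metis bounded_empty all_not_in_conv subsetD)
  have p1: "1 \<le> p x" and pq: "p x \<le> q x" and mu0: "0 \<le> \<mu> x" if "x \<in> ?S" for x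
    using that assms(5,7,15) by auto
  obtain q\<^sub>m where qm: "\<And>x. x \<in> ?S \<Longrightarrow> \<bar>q x\<bar> \<le> q\<^sub>m"
    using assms(9) by (auto simp: bounded_iff)
  obtain \<mu>\<^sub>m where mum: "\<And>x. x \<in> ?S \<Longrightarrow> \<bar>\<mu> x\<bar> \<le> \<mu>\<^sub>m"
    using assms(10) by (auto simp: bounded_iff)
  obtain \<alpha>p where hp: "holder_on ?S \<alpha>p p" using assms(11) by (auto simp: holder_continuous_on_def)
  obtain \<alpha>q where hq: "holder_on ?S \<alpha>q q" using assms(12) by (auto simp: holder_continuous_on_def)
  obtain cp where cp: "0 \<le> cp" "0 < \<alpha>p" "\<And>x y. x \<in> ?S \<Longrightarrow> y \<in> ?S \<Longrightarrow> \<bar>p x - p y\<bar> \<le> cp * dist x y powr \<alpha>p"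
    using holder_on_nonneg_const[OF hp] by metis
  obtain cq where cq: "0 \<le> cq" "0 < \<alpha>q" "\<And>x y. x \<in> ?S \<Longrightarrow> y \<in> ?S \<Longrightarrow> \<bar>q x - q y\<bar> \<le> cq * dist x y powr \<alpha>q"
    using holder_on_nonneg_const[OF hq] by metis
  obtain c\<mu> where c\<mu>: "0 \<le> c\<mu>" "0 < \<gamma>" "\<And>x y. x \<in> ?S \<Longrightarrow> y \<in> ?S \<Longrightarrow> \<bar>\<mu> x - \<mu> y\<bar> \<le> c\<mu> * dist x y powr \<gamma>"
    using holder_on_nonneg_const[OF assms(13)] by metis
  define \<theta> where "\<theta> = (SUP x\<in>?S. q x / p x)"
  have qp: "q x / p x \<le> q\<^sub>m" if "x \<in> ?S" for x
  proof -
    have "q x / p x \<le> q x / 1" using p1[OF that] pq[OF that] by (intro divide_left_mono) auto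
    then show ?thesis using qm[OF that] by simp
  qed
  have \<theta>: "q x / p x \<le> \<theta>" if "x \<in> ?S" for x
    unfolding \<theta>_def by (rule cSUP_upper[OF that bdd_aboveI2]) (rule qp)
  interpret log_double_phase ?S p q \<mu> \<gamma> \<theta> q\<^sub>m \<mu>\<^sub>m cp \<alpha>p cq \<alpha>q c\<mu>
  proof
    show "q x \<le> q\<^sub>m" if "x \<in> ?S" for x using qm[OF that] by simp
    show "\<mu> x \<le> \<mu>\<^sub>m" if "x \<in> ?S" for x using mum[OF that] by simp
    show "0 \<le> q\<^sub>m" "0 \<le> \<mu>\<^sub>m" using qm[OF x0] mum[OF x0] by simp_all
    show "q x \<le> \<theta> * p x" if "x \<in> ?S" for x using \<theta>[OF that] p1[OF that] by (simp add: divide_le_eq)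
    show "1 \<le> \<theta>" using \<theta>[OF x0] p1[OF x0] pq[OF x0] by (smt (verit) le_divide_eq_1_pos)
    show "real DIM(real ^ 'n) * (\<theta> - 1) < \<gamma>"
      using assms(1,16) by (simp add: \<theta>_def[symmetric] field_simps)
  qed (fact p1 pq mu0 cp cq c\<mu>)+
  obtain C where C: "0 < C" "\<And>x y \<epsilon> s. x \<in> ?S \<Longrightarrow> y \<in> ?S \<Longrightarrow> 0 < \<epsilon> \<Longrightarrow> \<epsilon> \<le> 1 \<Longrightarrow> dist x y \<le> \<epsilon> \<Longrightarrow> 1 \<le> s \<Longrightarrow>
    s powr p x \<le> 1 * \<epsilon> powr (- real DIM(real ^ 'n)) \<Longrightarrow> H x s \<le> C * H y s"
    using H_comparison[of 1 1] by (metis order_refl zero_less_one)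
  define pB where "pB x = indicator \<Omega> x *\<^sub>R p x" for x
  define qB where "qB x = indicator \<Omega> x *\<^sub>R q x" for x
  define \<mu>B where "\<mu>B x = indicator \<Omega> x *\<^sub>R \<mu> x" for x
  have cont_pq\<mu>: "continuous_on \<Omega> p" "continuous_on \<Omega> q" "continuous_on \<Omega> \<mu>"
    using holder_on_continuous[OF hp] holder_on_continuous[OF hq] holder_on_continuous[OF assms(13)]
      continuous_on_subset[OF _ sub] by blast+
  have [measurable]: "pB \<in> borel_measurable borel" "qB \<in> borel_measurable borel" "\<mu>B \<in> borel_measurable borel"
    unfolding pB_def[abs_def] qB_def[abs_def] \<mu>B_def[abs_def]
    by (rule borel_measurable_continuous_on_indicator[OF borel_open[OF \<Omega>]], rule cont_pq\<mu>)+
  interpret comparable_modular \<Omega> H "q\<^sub>m + 1" C "H\<^sub>1"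
  proof
    show "(\<lambda>x. indicator \<Omega> x * H x \<bar>w x\<bar>) \<in> borel_measurable borel" if [measurable]: "w \<in> borel_measurable borel" for w
    proof -
      note [measurable] = borel_open[OF \<Omega>]
      have "indicator \<Omega> x * H x \<bar>w x\<bar> = indicator \<Omega> x * (\<bar>w x\<bar> powr pB x + \<mu>B x * \<bar>w x\<bar> powr qB x * ln (exp 1 + \<bar>w x\<bar>))" for x
        by (cases "x \<in> \<Omega>") (simp_all add: H_def pB_def qB_def \<mu>B_def)
      moreover have "(\<lambda>x. indicator \<Omega> x * (\<bar>w x\<bar> powr pB x + \<mu>B x * \<bar>w x\<bar> powr qB x * ln (exp 1 + \<bar>w x\<bar>))) \<in> borel_measurable borel"
        by measurable
      ultimately show ?thesis by (simp only:)
    qed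
    show "H x s \<le> C * H y s" if "x \<in> \<Omega>" "y \<in> \<Omega>" "0 < \<epsilon>" "\<epsilon> \<le> 1" "dist x y < \<epsilon>" "1 \<le> s"
      and small: "H x s * \<epsilon> ^ DIM(real ^ 'n) \<le> 1" for x y s \<epsilon>
    proof (rule C(2))
      have "s powr p x \<le> H x s" using that sub by (intro H_ge) auto
      also have "\<dots> \<le> 1 / \<epsilon> ^ DIM(real ^ 'n)" using small \<open>0 < \<epsilon>\<close> by (simp add: pos_le_divide_eq)
      also have "\<dots> = 1 * \<epsilon> powr (- real DIM(real ^ 'n))"
        using \<open>0 < \<epsilon>\<close> by (simp add: powr_minus_divide powr_realpow)
      finally show "s powr p x \<le> 1 * \<epsilon> powr (- real DIM(real ^ 'n))" .
    qed (use that sub in auto)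
    show "0 \<le> q\<^sub>m + 1" using qm0 by simp
  qed (use \<Omega> sub H_mono H_zero H_contract H_dilate H_cont H_at_1(2) C(1) in \<open>blast+\<close>)
  have "H_log p q \<mu> = (\<lambda>x t. ennreal (H x t))" by (intro ext H_log_eq)
  then show ?thesis
    using A0[OF \<Omega> sub] A1[OF sub] A2[OF \<Omega> sub assms(14)] aDec[OF sub] smooth_dense by simp
qed

end
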